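(* Let $s_1,s_2,s_3\in\mathbb R$ satisfy $0<s_1<s_2<s_3$ and $s_1+s_2+s_3=1$, and let $S=\mathrm{diag}(s_1,s_2,s_3)$. Then the set $\mathcal L(S)$ is stable under lamination. That is: for all $F,G\in\mathcal L(S)$, $\lambda\in\mathbb R$ and $R\in SO(3)$ such that $\operatorname{rank}(\lambda F-R^tGR)=1$, and for every $t\in[0,1]$, the triple $m_{F,G}(\lambda,t)$ of ordered eigenvalues of $M_{F,G}(\lambda,t)$ belongs to $\mathcal L(S)$.
   Context: A triple in $\mathbb R^3$ is identified with the diagonal $3\times3$ matrix having these entries; all triples considered have positive entries and sum $1$. Rank-one trajectories. If $F,G$ are positive definite diagonal matrices with unit trace and $\operatorname{rank}(\lambda F-R^tGR)=1$ with $\lambda\in\mathbb R$, $R\in SO(3)$, then necessarily $\lambda>0$, $\lambda\ne1$, and there is a unit vector $n$ (unique up to sign) with $R^tGR=\lambda F+(1-\lambda)\,n\otimes n$. For $t\in[0,1]$ put $$M_{F,G}(\lambda,t)=\eta(\lambda,t)F+(1-\eta(\lambda,t))\,n\otimes n,\qquad \eta(\lambda,t)=\frac{\lambda}{\lambda+t(1-\lambda)},$$ so $M_{F,G}(\lambda,0)=F$ and $M_{F,G}(\lambda,1)=R^tGR$. Let $m_{F,G}(\lambda,t)\in\mathbb R^3$ be the triple of eigenvalues of $M_{F,G}(\lambda,t)$ in nondecreasing order. The set $\mathcal L(S)$. Let $u_\alpha$ and $u_\beta$ be respectively the smallest and the largest root of $$b(x)=6s_2x^2+x(s_1s_3-3s_2-4s_2^2)+2s_2^2$$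 (one has $s_1\le u_\alpha<\tfrac13<u_\beta\le s_3$ and $u_\alpha<s_2<u_\beta$). Set $\alpha=u_\alpha/s_2$, $\beta=u_\beta/s_2$, $U_\alpha=\mathrm{diag}(u_\alpha,u_\alpha,1-2u_\alpha)$, $U_\beta=\mathrm{diag}(1-2u_\beta,u_\beta,u_\beta)$. For $G=\mathrm{diag}(g_1,g_2,g_3)$ and $\lambda\notin\{0,1\}$ write $$n_i^2(S,G,\lambda)=\frac{(g_1-\lambda s_i)(g_2-\lambda s_i)(g_3-\lambda s_i)}{\lambda^2(1-\lambda)\prod_{j\ne i}(s_j-s_i)},\qquad i=1,2,3.$$ Let $n_\alpha$ be a unit vector whose squared components are $n_i^2(S,U_\alpha,\alpha)$, and $n_\beta$ a unit vector whose squared components are $n_i^2(S,U_\beta,\beta)$ (both have second component $0$; the signs do not matter). For $t\in[0,1]$ set $$M_\alpha(t)=\eta(\alpha,t)S+(1-\eta(\alpha,t))n_\alpha\otimes n_\alpha,\qquad M_\beta(t)=\eta(\beta,t)S+(1-\eta(\beta,t))n_\beta\otimes n_\beta .$$ These go from $S$ at $t=0$ to matrices orthogonally conjugate to $U_\alpha$, respectively $U_\beta$, at $t=1$. Let $\Gamma_\alpha$ (resp. $\Gamma_\beta$) be the curve in $\mathbb R^3$ described, for $t\in[0,1]$, by the triple of eigenvalues in nondecreasing order of $M_\alpha(t)$ (resp. $M_\beta(t)$). Both lie in the plane $m_1+m_2+m_3=1$. The closed curve $\Gamma$ is obtained as follows: take $\Gamma_\alpha$ together with its reflection across the line $m_1=m_2$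 in this plane, and all rotations of the result by multiples of $2\pi/3$ within the plane (about $(\frac13,\frac13,\frac13)$); likewise take $\Gamma_\beta$ together with its reflection across the line $m_2=m_3$, and all rotations by multiples of $2\pi/3$; $\Gamma$ is the union. Equivalently, $\Gamma$ is the union of the images of $\Gamma_\alpha\cup\Gamma_\beta$ under all permutations of the coordinates. $\Gamma$ is a simple closed Jordan curve in the plane. Then $\mathcal L(S)$ is the bounded closed region of the plane $m_1+m_2+m_3=1$ enclosed by $\Gamma$ (i.e. $\Gamma$ together with the bounded component of its complement in the plane). It is contained in the closed hexagon whose vertices are the permutations of $(s_1,s_2,s_3)$, and it is invariant under permutations of coordinates. *)

theory Defs
  imports "HOL-Analysis.Analysis"
begin

definition diag3 :: "real^3 \<Rightarrow> real^3^3" where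
  "diag3 d = (\<chi> i j. if i = j then d$i else 0)"

definition tensor :: "real^3 \<Rightarrow> real^3 \<Rightarrow> real^3^3" where
  "tensor u v = (\<chi> i j. u$i * v$j)"

(* Eigenvalues are counted with algebraic multiplicity: they are the roots of the
   characteristic polynomial.  The description is only used for symmetric matrices, for which
   the three eigenvalues are real, so that exactly one triple fits. *)
definition ordered_eigenvalues :: "real^3^3 \<Rightarrow> real^3" where
  "ordered_eigenvalues A =
     (THE m. m$1 \<le> m$2 \<and> m$2 \<le> m$3 \<and>
        (\<forall>x::real. det (x *\<^sub>R mat 1 - A) = (x - m$1) * (x - m$2) * (x - m$3)))"

definition eta :: "real \<Rightarrow> real \<Rightarrow> real" where
  "eta l t = l / (l + t * (1 - l))"

definition traj :: "real^3 \<Rightarrow> real^3 \<Rightarrow> real \<Rightarrow> real \<Rightarrow> real^3^3" where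
  "traj F n l t = eta l t *\<^sub>R diag3 F + (1 - eta l t) *\<^sub>R tensor n n"

(* For triples with positive entries and sum 1, if \<open>l *\<^sub>R diag3 F - transpose R ** diag3 G ** R\<close>
   has rank one, then such a vector exists and is unique up to sign, so \<open>tensor n n\<close> does not
   depend on the choice. *)
definition connecting_normal :: "real^3 \<Rightarrow> real^3 \<Rightarrow> real \<Rightarrow> real^3^3 \<Rightarrow> real^3" where
  "connecting_normal F G l R =
     (SOME n. norm n = 1 \<and>
        transpose R ** diag3 G ** R = l *\<^sub>R diag3 F + (1 - l) *\<^sub>R tensor n n)"

definition lam_M :: "real^3 \<Rightarrow> real^3 \<Rightarrow> real^3^3 \<Rightarrow> real \<Rightarrow> real \<Rightarrow> real^3^3" where
  "lam_M F G R l t = traj F (connecting_normal F G l R) l t"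

definition lam_m :: "real^3 \<Rightarrow> real^3 \<Rightarrow> real^3^3 \<Rightarrow> real \<Rightarrow> real \<Rightarrow> real^3" where
  "lam_m F G R l t = ordered_eigenvalues (lam_M F G R l t)"

definition stable_under_lamination :: "(real^3) set \<Rightarrow> bool" where
  "stable_under_lamination K \<longleftrightarrow>
     (\<forall>F\<in>K. \<forall>G\<in>K. \<forall>(l::real) (R::real^3^3).
        rotation_matrix R \<longrightarrow>
        rank (l *\<^sub>R diag3 F - transpose R ** diag3 G ** R) = 1 \<longrightarrow>
        (\<forall>t\<in>{0..1}. lam_m F G R l t \<in> K))"

definition b_poly :: "real^3 \<Rightarrow> real \<Rightarrow> real" where
  "b_poly s x = 6 * s$2 * x^2 + x * (s$1 * s$3 - 3 * s$2 - 4 * (s$2)^2) + 2 * (s$2)^2"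

definition u_alpha :: "real^3 \<Rightarrow> real" where
  "u_alpha s = Min {x. b_poly s x = 0}"

definition u_beta :: "real^3 \<Rightarrow> real" where
  "u_beta s = Max {x. b_poly s x = 0}"

definition alpha :: "real^3 \<Rightarrow> real" where
  "alpha s = u_alpha s / s$2"

definition beta :: "real^3 \<Rightarrow> real" where
  "beta s = u_beta s / s$2"

definition U_alpha :: "real^3 \<Rightarrow> real^3" where
  "U_alpha s = vector [u_alpha s, u_alpha s, 1 - 2 * u_alpha s]"

definition U_beta :: "real^3 \<Rightarrow> real^3" where
  "U_beta s = vector [1 - 2 * u_beta s, u_beta s, u_beta s]"

definition nsq :: "real^3 \<Rightarrow> real^3 \<Rightarrow> real \<Rightarrow> 3 \<Rightarrow> real" where
  "nsq s g l i =
     ((g$1 - l * s$i) * (g$2 - l * s$i) * (g$3 - l * s$i)) /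
     (l^2 * (1 - l) * (\<Prod>j\<in>UNIV - {i}. (s$j - s$i)))"

(* The signs of the components are left open; since the second component of n_alpha and of
   n_beta vanishes, they do not affect the eigenvalues along the trajectories. *)
definition n_alpha :: "real^3 \<Rightarrow> real^3" where
  "n_alpha s = (SOME n. norm n = 1 \<and> (\<forall>i. (n$i)^2 = nsq s (U_alpha s) (alpha s) i))"

definition n_beta :: "real^3 \<Rightarrow> real^3" where
  "n_beta s = (SOME n. norm n = 1 \<and> (\<forall>i. (n$i)^2 = nsq s (U_beta s) (beta s) i))"

definition M_alpha :: "real^3 \<Rightarrow> real \<Rightarrow> real^3^3" where
  "M_alpha s t = traj s (n_alpha s) (alpha s) t"

definition M_beta :: "real^3 \<Rightarrow> real \<Rightarrow> real^3^3" where
  "M_beta s t = traj s (n_beta s) (beta s) t"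

definition Gamma_alpha :: "real^3 \<Rightarrow> (real^3) set" where
  "Gamma_alpha s = (\<lambda>t. ordered_eigenvalues (M_alpha s t)) ` {0..1}"

definition Gamma_beta :: "real^3 \<Rightarrow> (real^3) set" where
  "Gamma_beta s = (\<lambda>t. ordered_eigenvalues (M_beta s t)) ` {0..1}"

(* In the plane of triples with sum 1, the reflections across the lines m_i = m_j are the
   transpositions of coordinates and the rotations by multiples of 2 pi / 3 are the cyclic
   permutations; together they give all coordinate permutations. *)
definition Gamma_curve :: "real^3 \<Rightarrow> (real^3) set" where
  "Gamma_curve s =
     {(\<chi> i. m$(p i)) | m p. m \<in> Gamma_alpha s \<union> Gamma_beta s \<and> p permutes (UNIV :: 3 set)}"

definition unit_sum_plane :: "(real^3) set" where
  "unit_sum_plane = {m. m$1 + m$2 + m$3 = 1}"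

(* The library's inside refers to the complement in the whole space; here the bounded component
   has to be taken in the plane. *)
definition lam_set :: "real^3 \<Rightarrow> (real^3) set" where
  "lam_set s = Gamma_curve s \<union>
     {x \<in> unit_sum_plane - Gamma_curve s.
        bounded (connected_component_set (unit_sum_plane - Gamma_curve s) x)}"

end

theory Submission
  imports Defs
begin

text \<open>Dividing \<open>M(t) = \<eta> F + (1 - \<eta>) n \<otimes> n\<close> by \<open>\<eta> > 0\<close> turns a trajectory into a straight
segment \<open>F + \<tau> n \<otimes> n\<close>, along which the characteristic polynomial is affine in \<open>\<tau>\<close>
(\<open>secular\<close>) and the eigenvalues are monotone and interlace (\<open>interlacing\<close>).  All conditions
below are homogeneous, so the normalisation of the trace can be dropped.

For a sorted triple \<open>x \<le> y \<le> z\<close> of sum 1 let \<open>b(u)\<close> be the quadratic polynomial that defines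
\<open>u_alpha\<close> and \<open>u_beta\<close>, now formed with \<open>x, y, z\<close> in place of \<open>s\<close>.  It satisfies
\<open>3 * b(1/3) = (y - x) * (y - z) \<le> 0\<close>, so that \<open>1/3\<close> separates its roots.  The arc
\<open>Gamma_alpha\<close> is the part of the conic \<open>b(u_alpha) = 0\<close> between \<open>S\<close> and \<open>U_alpha\<close>, and
similarly for \<open>Gamma_beta\<close>.  Hence \<open>lam_set\<close> consists of the triples with positive entries whose
sorted version satisfies both \<open>b(u_alpha) \<ge> 0\<close> and \<open>b(u_beta) \<ge> 0\<close> (\<open>lam_set_eq\<close>): this
set is bounded, its boundary is the union of the permuted arcs, and rays from the centre leave it
once and for all, so that the rest of the plane has only unbounded components.

Each of the two inequalities is stable under lamination on its own; the parameter
\<open>h = 2/(3u) - 1\<close> is used for \<open>u\<close>, and \<open>curve_form h\<close> for \<open>b(u)\<close>.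

Let \<open>h > 1\<close>.  The inequality becomes weaker as \<open>h\<close> grows, so \<open>h\<close> can be decreased until one
end of the trajectory, say \<open>F\<close>, lies on the boundary curve (\<open>largest_root\<close>).  Scale \<open>F\<close> so
that its eigenvalues are \<open>a \<le> 1 \<le> c\<close>.  At the point of the trajectory whose middle eigenvalue
is \<open>y\<close>, the inequality says \<open>(y - 1) * V(y) \<ge> 0\<close>, where \<open>V\<close> (\<open>crossing_poly\<close>) is a polynomial
that depends on \<open>F\<close> and \<open>n\<close> but not on \<open>\<tau>\<close> (\<open>gap_drift\<close>).  On either side of \<open>y = 1\<close> this polynomial
can change its sign only from plus to minus (\<open>crossing_poly_right\<close>, \<open>crossing_poly_left\<close>).
As \<open>y\<close> moves monotonically away from 1, the validity of the inequality at the other end \<open>G\<close>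
therefore propagates back to all points between \<open>F\<close> and \<open>G\<close>.  The sign property amounts to two
quotients being monotone, that is, to the nonnegativity of the symmetric polynomials in
\<open>cross23_identity\<close> and \<open>cross13_identity\<close>.

The case \<open>h < 1\<close> follows from the case \<open>h > 1\<close>: inversion of matrices maps segments in rank-one
directions to segments in rank-one directions and exchanges \<open>h\<close> with
\<open>(h + 1) / (3h - 1)\<close> (\<open>update_inverse\<close>, \<open>stable_lt1\<close>).\<close>

section \<open>Rank-one updates of a diagonal matrix\<close>

text \<open>The characteristic polynomial of \<open>diag(a, b, c) + t n \<otimes> n\<close> when \<open>p, q, r\<close> are the squares
of the components of \<open>n\<close> (\<open>charpoly_update\<close>).  Working with the squares alone makes the
signs of \<open>n\<close> disappear and keeps everything polynomial.\<close>

definition secular where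
  "secular a b c p q r t x = (x-a)*(x-b)*(x-c) -
     t*(p*((x-b)*(x-c)) + q*((x-a)*(x-c)) + r*((x-a)*(x-b)))" for x :: real

text \<open>The triple \<open>l, m, n\<close> is the spectrum of the updated matrix, with multiplicities.\<close>

definition rank_one_update where
  "rank_one_update a b c p q r t l m n \<longleftrightarrow> (\<forall>x. secular a b c p q r t x = (x-l)*(x-m)*(x-n))"

lemma sorted_roots_unique:
  fixes l m n :: real
  assumes eq: "\<And>x. (x-l)*(x-m)*(x-n) = (x-l')*(x-m')*(x-n')"
    and "l \<le> m" "m \<le> n" "l' \<le> m'" "m' \<le> n'"
  shows "l = l'" "m = m'" "n = n'"
proof -
  have "l \<in> {l',m',n'}" "l' \<in> {l,m,n}" "n \<in> {l',m',n'}" "n' \<in> {l,m,n}"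
    using eq[of l] eq[of l'] eq[of n] eq[of n'] by auto
  then show l: "l = l'" and n: "n = n'" using assms(2-) by auto
  have "l + m + n = l' + m' + n'" using eq[of 0] eq[of 1] eq[of "-1"] by (simp add: algebra_simps)
  then show "m = m'" using l n by simp
qed

lemma cubic_factor:
  fixes l m n A C D :: real
  assumes "l < m" "m < n"
    and "\<And>x. x \<in> {l,m,n} \<Longrightarrow> x^3 + A*x^2 + C*x + D = 0"
  shows "x^3 + A*x^2 + C*x + D = (x-l)*(x-m)*(x-n)"
proof -
  \<comment> \<open>the coefficients of the difference of the two monic cubics, a quadratic polynomial with three zeros\<close>
  define \<alpha> \<beta> \<gamma> where "\<alpha> = A + (l+m+n)" and "\<beta> = C - (l*m+m*n+l*n)" and "\<gamma> = D + l*m*n"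
  have d: "x^3 + A*x^2 + C*x + D - (x-l)*(x-m)*(x-n) = \<alpha>*x^2+\<beta>*x+\<gamma>" for x
    unfolding \<alpha>_def \<beta>_def \<gamma>_def by (simp add: algebra_simps power2_eq_square power3_eq_cube)
  have z: "\<alpha>*l^2+\<beta>*l+\<gamma> = 0" "\<alpha>*m^2+\<beta>*m+\<gamma> = 0" "\<alpha>*n^2+\<beta>*n+\<gamma> = 0"
    using d[of l] d[of m] d[of n] assms(3) by auto
  have "(m-l)*(\<alpha>*(l+m)+\<beta>) = 0" "(n-m)*(\<alpha>*(m+n)+\<beta>) = 0" using z by algebra+
  then have e: "\<alpha>*(l+m)+\<beta> = 0" "\<alpha>*(m+n)+\<beta> = 0" using assms(1,2) by auto
  then have "\<alpha>*(n-l) = 0" by algebra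
  then have "\<alpha> = 0" using assms(1,2) by simp
  then have "\<alpha> = 0" "\<beta> = 0" "\<gamma> = 0" using e z by auto
  then show ?thesis using d[of x] by simp
qed

lemma cubic_roots:
  fixes A C D :: real
  defines "f \<equiv> \<lambda>x. x^3 + A*x^2 + C*x + D"
  assumes "x0 < x1" "x1 \<le> x2" "x2 < x3" "x3 \<le> x4"
    and "f x0 < 0" "f x1 > 0" "f x2 > 0" "f x3 < 0" "f x4 < 0"
  obtains l m n where "x0 < l" "l < x1" "x2 < m" "m < x3" "x4 < n"
    "\<And>x. f x = (x-l)*(x-m)*(x-n)"
proof -
  have cont: "continuous_on S f" for S unfolding f_def by (intro continuous_intros)
  have i: "\<exists>x. y < x \<and> x < z \<and> f x = 0" if "y < z" "f y * f z < 0" for y z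
  proof -
    have "\<exists>x\<ge>y. x \<le> z \<and> f x = 0"
    proof (cases "f y < 0")
      case True
      then show ?thesis using IVT'[of f y 0 z] that cont by (auto simp: mult_less_0_iff)
    next
      case False
      then show ?thesis using IVT2'[of f z 0 y] that cont by (auto simp: mult_less_0_iff)
    qed
    then obtain x where "y \<le> x" "x \<le> z" "f x = 0" by auto
    moreover have "x \<noteq> y" "x \<noteq> z" using \<open>f x = 0\<close> that by auto
    ultimately show ?thesis by force
  qed
  obtain X where X: "x4 < X" "f X > 0"
  proof
    define M where "M = 1 + \<bar>A\<bar> + \<bar>C\<bar> + \<bar>D\<bar>"
    define X where "X = max (x4+1) M"
    show "x4 < X" unfolding X_def by simp
    have X1: "1 \<le> M" "M \<le> X" "1 \<le> X" unfolding X_def M_def by auto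
    have 1: "X \<le> X^2" "1 \<le> X^2" using X1 by (auto simp: self_le_power one_le_power)
    have "A*X^2 \<ge> - (\<bar>A\<bar>*X^2)"
      using mult_right_mono[of "-\<bar>A\<bar>" A "X^2"] by simp
    moreover have "C*X \<ge> - (\<bar>C\<bar>*X^2)"
    proof -
      have "\<bar>C*X\<bar> \<le> \<bar>C\<bar>*X^2" using 1 X1 by (simp add: abs_mult mult_left_mono)
      then show ?thesis by linarith
    qed
    moreover have "D \<ge> - (\<bar>D\<bar>*X^2)"
      using mult_left_mono[OF 1(2), of "\<bar>D\<bar>"] by simp
    moreover have "X^3 \<ge> M*X^2" using X1 by (simp add: power3_eq_cube power2_eq_square)
    ultimately have "f X \<ge> X^2" unfolding f_def M_def by (simp add: algebra_simps)
    then show "f X > 0" using 1 by linarith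
  qed
  obtain l where l: "x0 < l" "l < x1" "f l = 0" using i[of x0 x1] assms by (auto simp: mult_neg_pos)
  obtain m where m: "x2 < m" "m < x3" "f m = 0" using i[of x2 x3] assms by (auto simp: mult_pos_neg)
  obtain n where n: "x4 < n" "f n = 0" using i[of x4 X] X assms by (auto simp: mult_neg_pos)
  have "f x = (x-l)*(x-m)*(x-n)" for x
    unfolding f_def using l m n assms by (intro cubic_factor) (auto simp: f_def)
  then show thesis using that l m n by blast
qed

lemma secular_cubic:
  "secular a b c p q r t x = x^3 + (- (a+b+c+t*(p+q+r)))*x^2
     + (a*b+b*c+a*c + t*(p*(b+c)+q*(a+c)+r*(a+b)))*x
     + (- (a*b*c + t*(p*b*c+q*a*c+r*a*b)))"
  unfolding secular_def by (simp add: algebra_simps power2_eq_square power3_eq_cube)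

lemma update_coeffs:
  assumes "rank_one_update a b c p q r t l m n"
  shows "l+m+n = a+b+c+t*(p+q+r)"
    and "l*m+m*n+l*n = a*b+b*c+a*c + t*(p*(b+c)+q*(a+c)+r*(a+b))"
    and "l*m*n = a*b*c + t*(p*b*c+q*a*c+r*a*b)"
proof -
  have e: "secular a b c p q r t x = (x-l)*(x-m)*(x-n)" for x using assms by (simp add: rank_one_update_def)
  show "l*m*n = a*b*c + t*(p*b*c+q*a*c+r*a*b)" using e[of 0] unfolding secular_cubic by simp
  moreover show "l+m+n = a+b+c+t*(p+q+r)"
    using e[of 1] e[of "-1"] e[of 0] unfolding secular_cubic by (simp add: algebra_simps)
  ultimately show "l*m+m*n+l*n = a*b+b*c+a*c + t*(p*(b+c)+q*(a+c)+r*(a+b))"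
    using e[of 1] unfolding secular_cubic by (simp add: algebra_simps)
qed

lemma secular_roots:
  assumes "x0 < x1" "x1 \<le> x2" "x2 < x3" "x3 \<le> x4"
    and "secular a b c p q r t x0 < 0" "secular a b c p q r t x1 > 0" "secular a b c p q r t x2 > 0"
      "secular a b c p q r t x3 < 0" "secular a b c p q r t x4 < 0"
  obtains l m n where "x0 < l" "l < x1" "x2 < m" "m < x3" "x4 < n" "rank_one_update a b c p q r t l m n"
  by (rule cubic_roots[OF assms[unfolded secular_cubic]])
    (auto simp: rank_one_update_def secular_cubic intro: that)

text \<open>For distinct entries and positive weights the signs of \<open>secular\<close> at \<open>a, b, c\<close> locate the
roots for parameter \<open>t\<close>.  At such a root the weighted bracket of \<open>secular\<close> has the sign of
\<open>(x - a) * (x - b) * (x - c)\<close>, which gives the signs of the polynomial for a larger parameter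
\<open>u\<close> at the old roots, and hence the direction in which the roots have moved.\<close>

lemma interlacing_strict:
  assumes f: "a < b" "b < c" and w: "0 < p" "0 < q" "0 < r" and t: "0 < t" "t < u"
  obtains l m n l' m' n' where "rank_one_update a b c p q r t l m n" "rank_one_update a b c p q r u l' m' n'"
    "a < l" "l < l'" "l' < b" "b < m" "m < m'" "m' < c" "c < n" "n < n'"
proof -
  define ps where "ps x = p*((x-b)*(x-c)) + q*((x-a)*(x-c)) + r*((x-a)*(x-b))" for x
  have sec: "secular a b c p q r s x = (x-a)*(x-b)*(x-c) - s*ps x" for s x
    unfolding secular_def ps_def ..
  have at: "secular a b c p q r s a < 0" "secular a b c p q r s b > 0" "secular a b c p q r s c < 0"
    if "0 < s" for s
  proof -
    have "s*(p*((b-a)*(c-a))) > 0" "s*(q*((b-a)*(c-b))) > 0" "s*(r*((c-a)*(c-b))) > 0"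
      using that f w by simp_all
    then show "secular a b c p q r s a < 0" "secular a b c p q r s b > 0" "secular a b c p q r s c < 0"
      unfolding secular_def by (simp_all add: algebra_simps)
  qed
  obtain l m n where lmn: "a < l" "l < b" "b < m" "m < c" "c < n" "rank_one_update a b c p q r t l m n"
    using secular_roots[OF f(1) order_refl f(2) order_refl at(1)[OF t(1)] at(2)[OF t(1)] at(2)[OF t(1)]
      at(3)[OF t(1)] at(3)[OF t(1)]] .
  have step: "secular a b c p q r u x = - (u-t)*ps x" "t*ps x = (x-a)*(x-b)*(x-c)" 
    if "x \<in> {l,m,n}" for x
  proof -
    have "secular a b c p q r t x = 0" using that lmn(6) unfolding rank_one_update_def by auto
    then show "secular a b c p q r u x = - (u-t)*ps x" "t*ps x = (x-a)*(x-b)*(x-c)"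
      unfolding sec by (auto simp: algebra_simps)
  qed
  have "t*ps l > 0" using step(2)[of l] lmn f by (auto intro!: mult_neg_neg mult_pos_neg)
  then have "0 < ps l" using t by (simp add: zero_less_mult_iff)
  then have 1: "secular a b c p q r u l < 0" using step(1)[of l] t by (simp add: mult_neg_pos)
  have "t*ps m < 0" using step(2)[of m] lmn f by (auto intro!: mult_pos_neg)
  then have "ps m < 0" using t by (simp add: mult_less_0_iff)
  then have 2: "secular a b c p q r u m > 0" using step(1)[of m] t by (simp add: mult_neg_neg)
  have "t*ps n > 0" using step(2)[of n] lmn f by auto
  then have "0 < ps n" using t by (simp add: zero_less_mult_iff)
  then have 3: "secular a b c p q r u n < 0" using step(1)[of n] t by (simp add: mult_neg_pos)
  have u: "0 < u" using t by simp
  show thesis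
    by (rule secular_roots[OF lmn(2) less_imp_le[OF lmn(3)] lmn(4) less_imp_le[OF lmn(5)] 1 at(2)[OF u] 2 at(3)[OF u] 3])
      (rule that[OF lmn(6) _ lmn(1) _ _ lmn(3) _ _ lmn(5)])
qed

text \<open>The degenerate cases (repeated entries, vanishing weights, \<open>t = 0\<close> or \<open>t = u\<close>) are limits of
strict ones.  The six roots stay in a compact interval, so a subsequence converges.\<close>

lemma interlacing_pos:
  assumes f: "a \<le> b" "b \<le> c" and w: "0 \<le> p" "0 \<le> q" "0 \<le> r" and t: "0 \<le> t" "t \<le> u"
  obtains l m n l' m' n' where "rank_one_update a b c p q r t l m n" "rank_one_update a b c p q r u l' m' n'"
    "a \<le> l" "l \<le> l'" "l' \<le> b" "b \<le> m" "m \<le> m'" "m' \<le> c" "c \<le> n" "n \<le> n'"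
proof -
  define e :: "nat \<Rightarrow> real" where "e k = 1 / real (Suc k)" for k
  have e: "0 < e k" "e k \<le> 1" for k unfolding e_def by auto
  have e0: "e \<longlonglongrightarrow> 0" unfolding e_def using LIMSEQ_inverse_real_of_nat
    by (simp add: inverse_eq_divide)
  define P where "P k x \<longleftrightarrow> (case x of (l,m,n,l',m',n') \<Rightarrow>
     rank_one_update (a-e k) b (c+e k) (p+e k) (q+e k) (r+e k) (t+e k) l m n
     \<and> rank_one_update (a-e k) b (c+e k) (p+e k) (q+e k) (r+e k) (u+2*e k) l' m' n'
     \<and> a-e k < l \<and> l < l' \<and> l' < b \<and> b < m \<and> m < m' \<and> m' < c+e k \<and> c+e k < n \<and> n < n')" for k x
  have "\<exists>x. P k x" for k
  proof -
    have "a - e k < b" "b < c + e k" "0 < p + e k" "0 < q+e k" "0 < r+e k" "0 < t + e k" "t+e k < u+2*e k"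
      using assms e[of k] by auto
    then show ?thesis
    proof (rule interlacing_strict)
      fix l m n l' m' n'
      assume "rank_one_update (a-e k) b (c+e k) (p+e k) (q+e k) (r+e k) (t+e k) l m n"
        "rank_one_update (a-e k) b (c+e k) (p+e k) (q+e k) (r+e k) (u+2*e k) l' m' n'"
        "a-e k < l" "l < l'" "l' < b" "b < m" "m < m'" "m' < c+e k" "c+e k < n" "n < n'"
      then have "P k (l,m,n,l',m',n')" unfolding P_def prod.case by blast
      then show "\<exists>x. P k x" ..
    qed
  qed
  then obtain x where x: "P k (x k)" for k by metis
  have Pk: "rank_one_update (a-e k) b (c+e k) (p+e k) (q+e k) (r+e k) (t+e k) (fst (x k)) (fst (snd (x k))) (fst (snd (snd (x k))))"
    "rank_one_update (a-e k) b (c+e k) (p+e k) (q+e k) (r+e k) (u+2*e k) (fst (snd (snd (snd (x k)))))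
       (fst (snd (snd (snd (snd (x k)))))) (snd (snd (snd (snd (snd (x k))))))"
    "a-e k \<le> fst (x k)" "fst (x k) \<le> fst (snd (snd (snd (x k))))" "fst (snd (snd (snd (x k)))) \<le> b"
    "b \<le> fst (snd (x k))" "fst (snd (x k)) \<le> fst (snd (snd (snd (snd (x k)))))"
    "fst (snd (snd (snd (snd (x k))))) \<le> c+e k" "c+e k \<le> fst (snd (snd (x k)))"
    "fst (snd (snd (x k))) \<le> snd (snd (snd (snd (snd (x k)))))" for k
    using x[of k] unfolding P_def case_prod_beta by (simp_all only: less_imp_le)
  define M where "M = a+b+c+1+(u+2)*(p+q+r+3) - 2*(a-1)"
  define I where "I = {a-1..M}"
  have bnd: "x k \<in> I \<times> I \<times> I \<times> I \<times> I \<times> I" for k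
  proof -
    have "(u+2*e k)*(p+e k+(q+e k)+(r+e k)) \<le> (u+2)*(p+q+r+3)"
      using e[of k] w t by (intro mult_mono) auto
    moreover have "n1 \<le> a+b+c+1+R2 - 2*(a-1)"
      if "R1 \<le> R2" "l1+m1+n1 = a-e k+b+(c+e k)+R1" "a-1 \<le> l1" "a-1 \<le> m1" for l1 m1 n1 R1 R2 :: real
      using that by (simp add: algebra_simps)
    moreover have "a - 1 \<le> fst (snd (snd (snd (x k))))" "a - 1 \<le> fst (snd (snd (snd (snd (x k)))))"
      using Pk(3)[of k] Pk(4)[of k] Pk(6)[of k] Pk(7)[of k] e[of k] f by linarith+
    ultimately have "snd (snd (snd (snd (snd (x k))))) \<le> M"
      using update_coeffs(1)[OF Pk(2)[of k]] unfolding M_def by blast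
    then show ?thesis using Pk(3)[of k] Pk(4)[of k] Pk(5)[of k] Pk(6)[of k] Pk(7)[of k] Pk(8)[of k]
        Pk(9)[of k] Pk(10)[of k] e[of k] f
      unfolding I_def mem_Times_iff atLeastAtMost_iff by linarith
  qed
  have "compact (I \<times> I \<times> I \<times> I \<times> I \<times> I)" unfolding I_def by (intro compact_Times compact_Icc)
  then obtain y s where s: "strict_mono s" and y: "(x \<circ> s) \<longlonglongrightarrow> y"
    using bnd unfolding compact_def by (elim allE[of _ x]) auto
  have es: "(\<lambda>k. e (s k)) \<longlonglongrightarrow> 0" using LIMSEQ_subseq_LIMSEQ[OF e0 s] by (simp add: comp_def)
  have xs: "(\<lambda>k. x (s k)) \<longlonglongrightarrow> y" using y by (simp add: comp_def)
  note lims = tendsto_fst[OF xs] tendsto_fst[OF tendsto_snd[OF xs]] tendsto_fst[OF tendsto_snd[OF tendsto_snd[OF xs]]]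
    tendsto_fst[OF tendsto_snd[OF tendsto_snd[OF tendsto_snd[OF xs]]]]
    tendsto_fst[OF tendsto_snd[OF tendsto_snd[OF tendsto_snd[OF tendsto_snd[OF xs]]]]]
    tendsto_snd[OF tendsto_snd[OF tendsto_snd[OF tendsto_snd[OF tendsto_snd[OF xs]]]]]
  have ae: "(\<lambda>k. z - e (s k)) \<longlonglongrightarrow> z" "(\<lambda>k. z + e (s k)) \<longlonglongrightarrow> z"
    "(\<lambda>k. z + 2*e (s k)) \<longlonglongrightarrow> z" for z
    using tendsto_diff[OF tendsto_const es] tendsto_add[OF tendsto_const es]
      tendsto_add[OF tendsto_const tendsto_mult_left[OF es, of 2]] by auto
  have upd: "rank_one_update a b c p q r v l m n"
    if "\<And>k. rank_one_update (a-e (s k)) b (c+e (s k)) (p+e (s k)) (q+e (s k)) (r+e (s k)) (v' k) (l' k) (m' k) (n' k)"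
      "v' \<longlonglongrightarrow> v" "l' \<longlonglongrightarrow> l" "m' \<longlonglongrightarrow> m" "n' \<longlonglongrightarrow> n" for v' l' m' n' v l m n
    unfolding rank_one_update_def
  proof
    fix z
    have "(\<lambda>k. (z-l' k)*(z-m' k)*(z-n' k)) \<longlonglongrightarrow> (z-l)*(z-m)*(z-n)"
      by (intro tendsto_intros that)
    moreover have "(\<lambda>k. (z-l' k)*(z-m' k)*(z-n' k)) \<longlonglongrightarrow> secular a b c p q r v z"
    proof -
      have "(\<lambda>k. secular (a-e (s k)) b (c+e (s k)) (p+e (s k)) (q+e (s k)) (r+e (s k)) (v' k) z)
         \<longlonglongrightarrow> secular a b c p q r v z"
        unfolding secular_def by (intro tendsto_intros that ae)
      then show ?thesis using that(1) by (simp add: rank_one_update_def)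
    qed
    ultimately show "secular a b c p q r v z = (z-l)*(z-m)*(z-n)" by (rule LIMSEQ_unique[rotated])
  qed
  show thesis
  proof (rule that)
    show "rank_one_update a b c p q r t (fst y) (fst (snd y)) (fst (snd (snd y)))"
      by (rule upd[OF Pk(1) ae(2) lims(1-3)])
    show "rank_one_update a b c p q r u (fst (snd (snd (snd y)))) (fst (snd (snd (snd (snd y))))) (snd (snd (snd (snd (snd y)))))"
      by (rule upd[OF Pk(2) ae(3) lims(4-6)])
    show "a \<le> fst y" by (rule LIMSEQ_le[OF ae(1) lims(1)]) (use Pk in auto)
    show "fst y \<le> fst (snd (snd (snd y)))" by (rule LIMSEQ_le[OF lims(1) lims(4)]) (use Pk in auto)
    show "fst (snd (snd (snd y))) \<le> b" by (rule LIMSEQ_le[OF lims(4) tendsto_const]) (use Pk in auto)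
    show "b \<le> fst (snd y)" by (rule LIMSEQ_le[OF tendsto_const lims(2)]) (use Pk in auto)
    show "fst (snd y) \<le> fst (snd (snd (snd (snd y))))" by (rule LIMSEQ_le[OF lims(2) lims(5)]) (use Pk in auto)
    show "fst (snd (snd (snd (snd y)))) \<le> c" by (rule LIMSEQ_le[OF lims(5) ae(2)]) (use Pk in auto)
    show "c \<le> fst (snd (snd y))" by (rule LIMSEQ_le[OF ae(2) lims(3)]) (use Pk in auto)
    show "fst (snd (snd y)) \<le> snd (snd (snd (snd (snd y))))" by (rule LIMSEQ_le[OF lims(3) lims(6)]) (use Pk in auto)
  qed
qed

text \<open>Any sorted factorisation is the one of \<open>interlacing_pos\<close>, because sorted roots are unique.\<close>

lemma interlacing:
  assumes f: "a \<le> b" "b \<le> c" and w: "0 \<le> p" "0 \<le> q" "0 \<le> r" and t: "0 \<le> t" "t \<le> u"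
    and m: "rank_one_update a b c p q r t l m n" "l \<le> m" "m \<le> n"
    and m': "rank_one_update a b c p q r u l' m' n'" "l' \<le> m'" "m' \<le> n'"
  shows "a \<le> l" "l \<le> l'" "l' \<le> b" "b \<le> m" "m \<le> m'" "m' \<le> c" "c \<le> n" "n \<le> n'"
proof -
  obtain l1 m1 n1 l2 m2 n2 where 1: "rank_one_update a b c p q r t l1 m1 n1" "rank_one_update a b c p q r u l2 m2 n2"
    and o: "a \<le> l1" "l1 \<le> l2" "l2 \<le> b" "b \<le> m1" "m1 \<le> m2" "m2 \<le> c" "c \<le> n1" "n1 \<le> n2"
    by (rule interlacing_pos[OF f w t])
  have "(x-l1)*(x-m1)*(x-n1) = (x-l)*(x-m)*(x-n)" "(x-l2)*(x-m2)*(x-n2) = (x-l')*(x-m')*(x-n')" for x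
    using 1 m(1) m'(1) unfolding rank_one_update_def by metis+
  moreover have "l1 \<le> m1" "m1 \<le> n1" "l2 \<le> m2" "m2 \<le> n2" using o by linarith+
  ultimately have "l1 = l" "m1 = m" "n1 = n" "l2 = l'" "m2 = m'" "n2 = n'"
    using sorted_roots_unique m(2,3) m'(2,3) by metis+
  then show "a \<le> l" "l \<le> l'" "l' \<le> b" "b \<le> m" "m \<le> m'" "m' \<le> c" "c \<le> n" "n \<le> n'" using o by auto
qed

lemma update_minus:
  "rank_one_update a b c p q r t l m n \<longleftrightarrow> rank_one_update (-c) (-b) (-a) r q p (-t) (-n) (-m) (-l)"
proof -
  have s: "secular (-c) (-b) (-a) r q p (-t) x = - secular a b c p q r t (-x)" for x
    unfolding secular_def by (simp add: algebra_simps)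
  have f: "(x- -n)*(x- -m)*(x- -l) = - ((-x-l)*(-x-m)*(-x-n))" for x by (simp add: algebra_simps)
  have "(\<forall>x. secular a b c p q r t (-x) = (-x-l)*(-x-m)*(-x-n)) \<longleftrightarrow> 
    (\<forall>x. secular a b c p q r t x = (x-l)*(x-m)*(x-n))"
  proof safe
    fix x assume *: "\<forall>x. secular a b c p q r t (-x) = (-x-l)*(-x-m)*(-x-n)"
    show "secular a b c p q r t x = (x-l)*(x-m)*(x-n)" using *[rule_format, of "-x"] by simp
  qed blast
  then show ?thesis unfolding rank_one_update_def s f by simp
qed

lemma interlacing_neg:
  assumes f: "a \<le> b" "b \<le> c" and w: "0 \<le> p" "0 \<le> q" "0 \<le> r" and t: "u \<le> t" "t \<le> 0"
    and m: "rank_one_update a b c p q r t l m n" "l \<le> m" "m \<le> n"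
    and m': "rank_one_update a b c p q r u l' m' n'" "l' \<le> m'" "m' \<le> n'"
  shows "l' \<le> l" "l \<le> a" "a \<le> m'" "m' \<le> m" "m \<le> b" "b \<le> n'" "n' \<le> n" "n \<le> c"
proof -
  have "-c \<le> -b" "-b \<le> -a" "0 \<le> -t" "-t \<le> -u" "-n \<le> -m" "-m \<le> -l" "-n' \<le> -m'" "-m' \<le> -l'"
    using assms by auto
  note i = interlacing[OF this(1,2) w(3,2,1) this(3,4) m(1)[unfolded update_minus[of a]] this(5,6)
      m'(1)[unfolded update_minus[of a]] this(7,8)]
  show "l' \<le> l" "l \<le> a" "a \<le> m'" "m' \<le> m" "m \<le> b" "b \<le> n'" "n' \<le> n" "n \<le> c" using i by linarith+
qed

lemma update_exists_pos:
  assumes f: "a \<le> b" "b \<le> c" and w: "0 \<le> p" "0 \<le> q" "0 \<le> r" and t: "0 \<le> t"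
  shows "\<exists>l m n. rank_one_update a b c p q r t l m n \<and> l \<le> m \<and> m \<le> n"
proof (rule interlacing_pos[OF f w t order_refl])
  fix l m n l' m' n'
  assume u: "rank_one_update a b c p q r t l m n" "l \<le> l'" "l' \<le> b" "b \<le> m" "m \<le> m'" "m' \<le> c" "c \<le> n"
  have "l \<le> m" "m \<le> n" using u by linarith+
  then show ?thesis using u(1) by blast
qed

lemma update_exists:
  assumes f: "a \<le> b" "b \<le> c" and w: "0 \<le> p" "0 \<le> q" "0 \<le> r"
  shows "\<exists>l m n. rank_one_update a b c p q r t l m n \<and> l \<le> m \<and> m \<le> n"
proof (cases "0 \<le> t")
  case False
  have 1: "-c \<le> -b" "-b \<le> -a" "0 \<le> -t" using f False by auto
  obtain l m n where "rank_one_update (-c) (-b) (-a) r q p (-t) l m n" "l \<le> m" "m \<le> n"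
    using update_exists_pos[OF 1(1,2) w(3,2,1) 1(3)] by blast
  then have "rank_one_update a b c p q r t (-n) (-m) (-l)" "-n \<le> -m" "-m \<le> -l"
    using update_minus[of a b c p q r t "-n" "-m" "-l"] by auto
  then show ?thesis by blast
qed (rule update_exists_pos[OF assms])

section \<open>Trajectories that start on a boundary curve\<close>

text \<open>The inequality for a triple whose middle entry is \<open>x\<close> is governed by the cubic
\<open>Q(x) = (h B + B) x^3 - B (a + 1 + c) x^2 + a c\<close>.  At the outer entries of a boundary triple it
factors as \<open>Q(a) = a * flank_quad h B c a\<close> and \<open>Q(c) = c * flank_quad h B a c\<close>; the two
quadratics reappear as the coefficients of the outer weights in \<open>crossing_poly\<close>.\<close>

definition flank_quad :: "real \<Rightarrow> real \<Rightarrow> real \<Rightarrow> real \<Rightarrow> real" where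
  "flank_quad h B m x = h*B*x^2 - B*(1+m)*x + m"

text \<open>A triple \<open>(a, 1, c)\<close> on a boundary curve, scaled so that its middle entry is 1.  If
\<open>h = 2/(3u) - 1\<close> then \<open>B = 3 (1 - 2u)\<close>, and \<open>curve\<close> is the equation \<open>b(u) = 0\<close> of the triple
with that ratio of entries.  The assumption \<open>1 < h\<close> says \<open>u < 1/3\<close>.\<close>

locale boundary_triple =
  fixes h B a c :: real
  assumes h: "1 < h" and B: "B * (h + 1) = 3 * h - 1"
    and a: "0 < a" "a \<le> 1" and c: "1 \<le> c"
    and curve: "a*c - B*(a+c) + h*B = 0"
begin

lemma B_eq: "B = (3*h-1)/(h+1)" using B h by (simp add: field_simps)
lemma B_gt1: "1 < B" using h by (simp add: B_eq field_simps)

text \<open>The ratio of the largest to the middle entry is greatest where the curve meets the line on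
which the two smaller entries agree; there it equals \<open>(1 - 2u)/u = (3h - 1)/2\<close>.\<close>

lemma c_le: "2*c \<le> 3*h-1"
proof -
  have "B * (h-1)*(1-a) \<ge> 0" using B_gt1 h a by simp
  moreover have "(3*h-1)*(B-a) - 2*c*(B-a) = B*(h-1)*(1-a)"
    using curve B by algebra
  ultimately have "(3*h-1-2*c)*(B-a) \<ge> 0" by (simp add: algebra_simps)
  then show ?thesis using B_gt1 a by (simp add: zero_le_mult_iff)
qed

lemma c_gt1: "1 < c"
proof (rule ccontr)
  assume "\<not> ?thesis"
  then have "c = 1" using c by simp
  with curve have e: "a - B*(a+1) + h*B = 0" by simp
  have "(h-1)*(3*h-1-2*a) = 0" using e B by algebra
  then show False using h a by simp
qed

lemma c_lt_K: "c < h*B"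
proof -
  have "B*(h+1) < 2*h*B" using B_gt1 h by (simp add: algebra_simps)
  then show ?thesis using B c_le by (simp add: algebra_simps)
qed

lemma flank_quad_a_1: "(h+1)*flank_quad h B a 1 = (h-1)*(3*h-1-2*a)"
  using B unfolding flank_quad_def power2_eq_square mult_1_right by algebra

lemma flank_quad_a_pos_right:
  assumes "1 \<le> x" shows "0 < flank_quad h B a x"
proof -
  have "(h+1)*flank_quad h B a 1 > 0" unfolding flank_quad_a_1 using h a by simp
  then have 1: "flank_quad h B a 1 > 0" using h by (simp add: zero_less_mult_iff)
  have 2: "flank_quad h B a x = flank_quad h B a 1 + (x-1)*(h*B*(x-1) + B*(2*h-1-a))"
    unfolding flank_quad_def by (simp add: algebra_simps power2_eq_square)
  have "(x-1)*(h*B*(x-1) + B*(2*h-1-a)) \<ge> 0" using assms h a B_gt1 by simp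
  then show ?thesis using 1 2 by simp
qed

text \<open>The sign of the right-hand side tells how the quotient of \<open>(c - x) * (h B x - a c)\<close> by
\<open>flank_quad h B a x\<close> changes between \<open>x\<close> and \<open>y\<close>.  The difference vanishes for \<open>x = y\<close> and
also for \<open>c = 1\<close>, whence the two linear factors.\<close>

lemma cross23_identity:
  "(c-x)*(h*B*x-a*c)*flank_quad h B a y - (c-y)*(h*B*y-a*c)*flank_quad h B a x
   = (y-x)*((c-1)*(h*B*(3*h-1)*x*y - h*B*a*(c+1)*(x+y) + a^2*c*(1+B)))"
proof -
  have K: "h*B = B*(a+c)-a*c" and k: "3*h-1 = B*(a+c)-a*c+B" using curve B by (auto simp: algebra_simps)
  show ?thesis unfolding flank_quad_def K k by (simp add: algebra_simps power2_eq_square)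
qed

text \<open>Expanded around \<open>x = y = a\<close>, all coefficients are nonnegative by \<open>c_le\<close>.\<close>

lemma cross23_nonneg:
  assumes "a \<le> x" "a \<le> y"
  shows "h*B*(3*h-1)*x*y - h*B*a*(c+1)*(x+y) + a^2*c*(1+B) \<ge> 0"
proof -
  have k: "c+1 \<le> 3*h-1" using c_le h by simp
  have e: "h*B*(3*h-1)*x*y - h*B*a*(c+1)*(x+y) + a^2*c*(1+B)
     = h*B*(3*h-1)*((x-a)*(y-a)) + h*B*a*(3*h-1-(c+1))*((x-a)+(y-a))
      + a^2*(h*B*(3*h-1) - 2*h*B*(c+1) + c*(1+B))"
    by (simp add: algebra_simps power2_eq_square)
  have "(h+1)*(h*B*(3*h-1) - 2*h*B*(c+1) + c*(1+B)) = 3*h*(h-1)*(3*h-1-2*c)"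
    using B by algebra
  also have "\<dots> \<ge> 0" using h c_le by simp
  finally have "h*B*(3*h-1) - 2*h*B*(c+1) + c*(1+B) \<ge> 0"
    using h by (simp add: zero_le_mult_iff)
  then have "a^2*(h*B*(3*h-1) - 2*h*B*(c+1) + c*(1+B)) \<ge> 0" by simp
  moreover have "h*B*(3*h-1)*((x-a)*(y-a)) \<ge> 0" using assms h B_gt1 by simp
  moreover have "h*B*a*(3*h-1-(c+1))*((x-a)+(y-a)) \<ge> 0" using assms h B_gt1 a k by simp
  ultimately show ?thesis unfolding e by linarith
qed

text \<open>In the coordinates \<open>X = x - 1\<close>, \<open>Y = y - 1\<close> the quotient that appears in
\<open>cross13_identity\<close> starts with quadratic terms: the ratio of the two cubics compared there is
stationary to second order at 1.  This is what makes its sign tractable.\<close>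

definition cross13 where "cross13 x y =
   (let X = x-1; Y = y-1; S = X+Y; P = X*Y; p = a*c in
   p*((h-h*B)*(S^2-P) - h*B*P*S) + h*B*((h-1)*(S^2-P) + (3*h-2)*S*P + (3*h-1)*P^2))"

text \<open>The counterpart of \<open>cross23_identity\<close> for the two outer weights.  The first cubic becomes the
negative of the second when \<open>a\<close> and \<open>c\<close> are exchanged, so the difference is divisible by
\<open>c - a\<close> as well as by \<open>y - x\<close>.\<close>

lemma cross13_identity:
  "(c-x)*flank_quad h B c x*((y-a)*flank_quad h B a y) - (c-y)*flank_quad h B c y*((x-a)*flank_quad h B a x)
   = (y-x)*((c-a)*cross13 x y)"
proof -
  define r where "r = x+y"
  define q where "q = x*y"
  define p where "p = a*c"
  \<comment> \<open>kept apart from \<open>p\<close>, so that the curve enters only through \<open>B m = p + K\<close>\<close>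
  define m where "m = a+c"
  define K where "K = h*B"
  have Bm: "B*m = p + K" unfolding p_def m_def K_def using curve by (simp add: algebra_simps)
  have k: "K + B = 3*h-1" unfolding K_def using B by (simp add: algebra_simps)
  have 1: "(c-x)*flank_quad h B c x*((y-a)*flank_quad h B a y) - (c-y)*flank_quad h B c y*((x-a)*flank_quad h B a x)
    = (y-x)*(c-a)*(q*((1+B)*B+(K+B)*K*q-(1+B)*K*r)
       + m*(- (B*r)+K*(r^2-q)+B^2*q-K*B*q*r) + p*(- ((K+B)*r)+(1+B)+(K+B)*B*q))"
    unfolding flank_quad_def r_def q_def p_def m_def K_def
    by (simp add: algebra_simps power2_eq_square power3_eq_cube)
  have 2: "m*(- (B*r)+K*(r^2-q)+B^2*q-K*B*q*r) = (p+K)*(-r + h*(r^2-q)+B*q-K*q*r)"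
    using Bm K_def by algebra
  have 3: "q*((1+B)*B+(K+B)*K*q-(1+B)*K*r) + (p+K)*(-r + h*(r^2-q)+B*q-K*q*r)
      + p*(- ((K+B)*r)+(1+B)+(K+B)*B*q) = cross13 x y"
  proof -
    have e: "cross13 x y = p*((h-K)*((r-2)^2-(q-r+1)) - K*(q-r+1)*(r-2)) 
      + K*((h-1)*((r-2)^2-(q-r+1)) + (3*h-2)*(r-2)*(q-r+1) + (3*h-1)*(q-r+1)^2)"
      unfolding cross13_def Let_def r_def q_def p_def K_def by (simp add: algebra_simps)
    have B': "B*h = K" unfolding K_def by simp
    have KB: "K = 3*h-1-B" using k by simp
    have hB: "h*B = 3*h-1-B" using B by (simp add: algebra_simps)
    show ?thesis unfolding e KB using hB by algebra
  qed
  show ?thesis unfolding 1 2 3[symmetric] by (simp add: algebra_simps)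
qed

text \<open>To the right of 1 both \<open>X\<close> and \<open>Y\<close> are nonnegative, and so are all coefficients since
\<open>2 a c \<le> 3h - 1\<close>.\<close>

lemma cross13_right:
  assumes "1 \<le> x" "1 \<le> y" shows "cross13 x y \<ge> 0"
proof -
  define X Y where "X = x-1" and "Y = y-1"
  have XY: "X \<ge> 0" "Y \<ge> 0" using assms by (auto simp: X_def Y_def)
  define S P p where "S = X+Y" and "P = X*Y" and "p = a*c"
  have p: "2*p \<le> 3*h-1" using c_le mult_right_mono[of a 1 c] a c unfolding p_def by linarith
  have P: "P \<ge> 0" "S \<ge> 0" "S^2 - P \<ge> 0"
    using XY by (auto simp: P_def S_def power2_eq_square algebra_simps)
  have e: "cross13 x y = h*(p*(1-B)+B*(h-1))*(S^2-P) + h*B*(3*h-2-p)*(S*P) + h*B*(3*h-1)*P^2"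
    unfolding cross13_def Let_def X_def[symmetric] Y_def[symmetric] S_def[symmetric]
      P_def[symmetric] p_def[symmetric] by (simp add: algebra_simps)
  have "(h+1)*(p*(1-B)+B*(h-1)) = (h-1)*(3*h-1-2*p)" using B by algebra
  also have "\<dots> \<ge> 0" using h p by simp
  finally have "p*(1-B)+B*(h-1) \<ge> 0" using h by (simp add: zero_le_mult_iff)
  moreover have "3*h-2-p \<ge> 0" using p h by simp
  ultimately have "h*(p*(1-B)+B*(h-1))*(S^2-P) \<ge> 0" "h*B*(3*h-2-p)*(S*P) \<ge> 0"
    "h*B*(3*h-1)*P^2 \<ge> 0" using P h B_gt1 by simp_all
  then show ?thesis unfolding e by linarith
qed

text \<open>In terms of \<open>d = h - 1 > 0\<close> and \<open>z = 1 - a \<ge> 0\<close> the curve is parametrised rationally, which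
removes the constraint between \<open>a\<close>, \<open>c\<close> and \<open>h\<close>.\<close>

lemma left_coords:
  defines "d \<equiv> h - 1" and "z \<equiv> 1 - a"
  shows "(d+2)*B = 3*d+2" and "c*(2*d+(d+2)*z) = (3*d+2)*(d+z)"
proof -
  show 1: "(d+2)*B = 3*d+2" unfolding d_def using B by (simp add: algebra_simps)
  have "(d+2)*(c*(B-a)) = (d+2)*(B*(h-a))" using curve by algebra
  then show "c*(2*d+(d+2)*z) = (3*d+2)*(d+z)"
    using 1 unfolding d_def z_def by algebra
qed

text \<open>Up to a positive factor the value is
\<open>(z - xi) (d - (d + 1) xi)^2 + (d + 1) xi^2 (z + (d + 1) xi)\<close>, with \<open>xi = 1 - x \<le> z\<close>.\<close>

lemma flank_quad_c_pos_left:
  assumes "a \<le> x" "x < 1" shows "0 < flank_quad h B c x"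
proof -
  define d z xi where "d = h - 1" and "z = 1 - a" and "xi = 1 - x"
  have d: "d > 0" using h by (simp add: d_def)
  have xi: "0 < xi" "xi \<le> z" using assms by (auto simp: xi_def z_def)
  define D where "D = 2*d+(d+2)*z"
  have D: "D > 0" unfolding D_def using d xi by (simp add: add_pos_nonneg)
  have B': "(d+2)*B = 3*d+2" and c': "c*D = (3*d+2)*(d+z)"
    using left_coords unfolding d_def z_def D_def by auto
  have e: "(d+2)*(D*flank_quad h B c x) =
     (3*d+2)*(d^2*(z-xi) - 2*d*(d+1)*xi*(z-xi) + (d+1)*(d+2)*z*xi^2)"
  proof -
    have "h = d+1" "x = 1-xi" by (auto simp: d_def xi_def)
    moreover have "(d+2)*(D*((d+1)*B*(1-xi)^2 - B*(1+c)*(1-xi) + c)) =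
     (3*d+2)*(d^2*(z-xi) - 2*d*(d+1)*xi*(z-xi) + (d+1)*(d+2)*z*xi^2)"
      using B' c' unfolding D_def by algebra
    ultimately show ?thesis unfolding flank_quad_def by simp
  qed
  have "z*(d^2*(z-xi) - 2*d*(d+1)*xi*(z-xi) + (d+1)*(d+2)*z*xi^2)
     = (z-xi)*z*(d-(d+1)*xi)^2 + (d+1)*xi^2*((d+2)*z*z-(d+1)*z*(z-xi))"
    by algebra
  also have "\<dots> > 0"
  proof (rule add_nonneg_pos)
    have "(d+2)*z*z-(d+1)*z*(z-xi) = z*(z + (d+1)*xi)" by (simp add: algebra_simps)
    also have "\<dots> > 0" using xi d by (intro mult_pos_pos add_pos_pos) auto
    finally show "0 < (d+1)*xi^2*((d+2)*z*z-(d+1)*z*(z-xi))" using xi d by simp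
  qed (use xi in simp)
  finally have "d^2*(z-xi) - 2*d*(d+1)*xi*(z-xi) + (d+1)*(d+2)*z*xi^2 > 0"
    using xi by (simp add: zero_less_mult_iff)
  then have "(d+2)*(D*flank_quad h B c x) > 0" unfolding e using d by simp
  then show ?thesis using d D by (simp add: zero_less_mult_iff)
qed

text \<open>To the left of 1 the term of odd degree in \<open>cross13\<close> changes its sign, and nonnegativity holds
only where \<open>flank_quad h B a\<close> is nonnegative.  With \<open>x = 1 - z al\<close> and \<open>y = 1 - z be\<close> this
hypothesis reads \<open>X - al E + al^2 F \<ge> 0\<close>, and \<open>cross13\<close> is a nonnegative combination of this
quantity and of \<open>E - F (al + be)\<close>.\<close>

lemma cross13_left:
  assumes "a \<le> x" "x \<le> y" "y \<le> 1" and g: "0 \<le> flank_quad h B a x"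
  shows "0 \<le> flank_quad h B a y" and "0 \<le> cross13 x y"
proof -
  define d z where "d = h - 1" and "z = 1 - a"
  have d: "d > 0" using h by (simp add: d_def)
  have k: "3*d+2 > 0" using d by simp
  have "0 \<le> flank_quad h B a y \<and> 0 \<le> cross13 x y"
  proof (cases "z = 0")
    case True
    then have "x = 1" "y = 1" using assms by (auto simp: z_def)
    then show ?thesis using g cross13_right[of 1 1] by simp
  next
    case False
    then have z: "0 < z" "z < 1" using a by (auto simp: z_def)
    define al be where "al = (1-x)/z" and "be = (1-y)/z"
    have st: "0 \<le> be" "be \<le> al" "al \<le> 1" unfolding al_def be_def using assms z
      by (auto intro!: divide_right_mono simp: z_def)
    have xy: "x = 1 - z*al" "y = 1 - z*be" using z by (auto simp: al_def be_def)
    define D where "D = 2*d+(d+2)*z"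
    have D: "D > 0" unfolding D_def using d z by (simp add: add_pos_nonneg)
    have B': "(d+2)*B = 3*d+2" and c': "c*D = (3*d+2)*(d+z)"
      using left_coords unfolding d_def z_def D_def by auto
    define X E F where "X = d*(3*d+2*z)" and "E = z*(3*d+2)*(2*d+z)"
      and "F = z^2*(3*d+2)*(d+1)"
    have ga: "(3*d+2)*(d+2)*flank_quad h B a (1-z*r) = (3*d+2)*(X - r*E + r^2*F)" for r
    proof -
      have "h = d+1" "a = 1-z" by (auto simp: d_def z_def)
      moreover have "(d+2)*((d+1)*B*(1-z*r)^2 - B*(1+(1-z))*(1-z*r) + (1-z)) = X - r*E + r^2*F"
        unfolding X_def E_def F_def using B' by algebra
      ultimately show ?thesis unfolding flank_quad_def by simp
    qed
    have ga: "(d+2)*flank_quad h B a (1-z*r) = X - r*E + r^2*F" for r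
      using ga[of r] k by simp
    have g1: "X - al*E + al^2*F \<ge> 0" using g ga[of al] d unfolding xy by (metis add_pos_pos mult_nonneg_nonneg less_imp_le zero_less_numeral)
    \<comment> \<open>The parabola \<open>X - r E + r^2 F\<close> has its minimum at \<open>E / (2F)\<close>.  If its value at \<open>r = 1\<close> is
      negative, then \<open>al\<close> and \<open>be\<close> lie before its first zero; otherwise the minimum is beyond 1.\<close>
    have EF: "E \<ge> F*(al+be)"
    proof (cases "z*(3*d+2) \<le> 3*d")
      case True
      have "(2*d+1)*(z*(3*d+2)) \<le> (2*d+1)*(3*d)" using True d by simp
      then have "(3*d+2)*(2*d+z-2*(d+1)*z) \<ge> d" by (simp add: algebra_simps)
      then have "(3*d+2)*(2*d+z-2*(d+1)*z) \<ge> 0" using d by linarith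
      then have "z*((3*d+2)*(2*d+z-2*(d+1)*z)) \<ge> 0" using z by simp
      then have "E \<ge> F*2" unfolding E_def F_def by (simp add: algebra_simps power2_eq_square)
      moreover have "F*(al+be) \<le> F*2" using st z d unfolding F_def by (intro mult_left_mono) auto
      ultimately show ?thesis by linarith
    next
      case False
      have "X - E + F = d*((1-z)*(3*d-z*(3*d+2)))"
        unfolding X_def E_def F_def by algebra
      also have "\<dots> < 0" using d z False by (intro mult_pos_neg) auto
      finally have "0 < (X - al*E + al^2*F) - (X-E+F)" using g1 by linarith
      also have "\<dots> = (1-al)*(E-F*(1+al))" by algebra
      finally have "E - F*(1+al) > 0" using st by (simp add: zero_less_mult_iff)
      moreover have "F*(al+be) \<le> F*(1+al)" using st z d unfolding F_def by (intro mult_left_mono) auto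
      ultimately show ?thesis by linarith
    qed
    have "X - be*E + be^2*F = (X - al*E + al^2*F) + (al-be)*(E-F*(al+be))" by algebra
    also have "\<dots> \<ge> 0" using g1 EF st by simp
    finally have 1: "0 \<le> flank_quad h B a y" using ga[of be] d unfolding xy
      by (metis add_pos_pos zero_le_mult_iff less_imp_le zero_less_numeral not_less)
    have "(d+2)*(D*cross13 x y) = (d+1)*(3*d+2)*z^3*
       ((X-al*E+al^2*F)*(al^2+al*be+be^2-al*be*(al+be)) + al^3*(1-be)*(E-F*(al+be)))"
    proof -
      have ha: "h = d+1" "a = 1-z" by (auto simp: d_def z_def)
      have sub: "x - 1 = - (z*al)" "y - 1 = - (z*be)" using xy by auto
      have pD: "D*(a*c) = (1-z)*((3*d+2)*(d+z))" 
      proof -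
        have "D*(a*c) = a*(c*D)" by simp
        then show ?thesis unfolding c' ha(2) .
      qed
      define S P where "S = - (z*(al+be))" and "P = z^2*(al*be)"
      have SP: "x-1+(y-1) = S" "(x-1)*(y-1) = P"
        unfolding sub S_def P_def by (auto simp: algebra_simps power2_eq_square)
      have "(d+2)*(D*cross13 x y) =
          D*(a*c)*(h*((d+2)-(d+2)*B)*(S^2-P) - h*((d+2)*B)*(P*S))
          + h*((d+2)*B)*(D*((h-1)*(S^2-P) + (3*h-2)*(S*P) + (3*h-1)*P^2))"
        unfolding cross13_def Let_def SP by (simp add: algebra_simps)
      also have "\<dots> = (d+1)*(3*d+2)*((1-z)*(d+z)*(- (2*d)*(S^2-P) - (3*d+2)*(P*S))
          + D*(d*(S^2-P) + (3*d+1)*(S*P) + (3*d+2)*P^2))"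
        unfolding pD B' ha(1) by (simp add: algebra_simps)
      also have "(1-z)*(d+z)*(- (2*d)*(S^2-P) - (3*d+2)*(P*S))
          + D*(d*(S^2-P) + (3*d+1)*(S*P) + (3*d+2)*P^2)
        = z^3*((X-al*E+al^2*F)*(al^2+al*be+be^2-al*be*(al+be)) + al^3*(1-be)*(E-F*(al+be)))"
        unfolding X_def E_def F_def S_def P_def D_def
        by (simp add: algebra_simps power2_eq_square power3_eq_cube)
      finally show ?thesis by (simp only: mult.assoc)
    qed
    moreover have "al^2+al*be+be^2-al*be*(al+be) \<ge> 0"
    proof -
      have "al*be \<ge> 0" using st by simp
      moreover have "al*be*(al+be) \<le> 1*(al*be) + al*be" using st mult_left_mono[of "al+be" 2 "al*be"] by simp
      ultimately show ?thesis using sum_squares_ge_zero[of "al-be" 0] by (simp add: power2_eq_square algebra_simps)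
    qed
    ultimately have "(d+2)*(D*cross13 x y) \<ge> 0" using d z st g1 EF by simp
    then have "0 \<le> cross13 x y" using d D by (simp add: zero_le_mult_iff)
    then show ?thesis using 1 by simp
  qed
  then show "0 \<le> flank_quad h B a y" and "0 \<le> cross13 x y" by auto
qed

text \<open>The polynomial \<open>V\<close> whose sign at the middle eigenvalue decides the inequality along the whole
trajectory through the boundary triple.\<close>

definition crossing_poly where "crossing_poly n1 n2 n3 x = n1*((c-x)*flank_quad h B c x) + n2*((x-a)*((c-x)*(h*B*x-a*c)))
   - n3*((x-a)*flank_quad h B a x)"

text \<open>Up to the factor \<open>y / (h + 1)\<close> this is the inequality at the point with parameter \<open>t\<close> and
middle eigenvalue \<open>y\<close> (\<open>gap_curve_form\<close>): the middle entry is eliminated through the trace and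
the determinant, both of which are affine in \<open>t\<close>.\<close>

definition gap where "gap n1 n2 n3 t y = (h*B+B)*y^3 - B*(a+1+c)*y^2 + a*c
   + t*(n1*c+n2*(a*c)+n3*a - B*y^2)"

text \<open>The negative of the derivative of the characteristic polynomial with respect to \<open>t\<close>.\<close>

definition drift_poly where "drift_poly n1 n2 n3 x = n1*(x-1)*(x-c) + n2*(x-a)*(x-c) + n3*(x-a)*(x-1)"

text \<open>The left-hand side is the combination of the affine families \<open>gap\<close> and \<open>secular\<close> that
eliminates \<open>t\<close>.  It vanishes at 0 because both families have the same constant term up to sign,
and at 1 because the triple lies on the curve.\<close>

lemma crossing_poly_identity:
  assumes "n1 + n2 + n3 = 1"
  shows "((h*B+B)*x^3 - B*(a+1+c)*x^2 + a*c)*drift_poly n1 n2 n3 x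
     + (x-a)*(x-1)*(x-c)*(n1*c+n2*(a*c)+n3*a - B*x^2) = - ((x-1)*(x*crossing_poly n1 n2 n3 x))"
proof -
  have K: "h*B = B*(a+c)-a*c" using curve by simp
  have n: "n1 = 1-n2-n3" using assms by simp
  show ?thesis unfolding drift_poly_def crossing_poly_def flank_quad_def K n
    by (simp add: algebra_simps power2_eq_square power3_eq_cube)
qed

text \<open>At an eigenvalue \<open>y\<close> the parameter \<open>t\<close> can be eliminated, so that the sign of \<open>gap\<close> is that
of a polynomial in \<open>y\<close> alone, up to the factor \<open>drift_poly\<close>.  This factor is negative when \<open>y\<close> is
the middle eigenvalue, lies strictly between \<open>a\<close> and \<open>c\<close>, and differs from 1.\<close>

lemma gap_drift:
  assumes "n1 + n2 + n3 = 1" and root: "(y-a)*(y-1)*(y-c) = t*drift_poly n1 n2 n3 y"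
  shows "gap n1 n2 n3 t y * drift_poly n1 n2 n3 y = - ((y-1)*(y*crossing_poly n1 n2 n3 y))"
  unfolding crossing_poly_identity[OF assms(1), symmetric] root gap_def by (simp add: algebra_simps)

text \<open>Divided by \<open>(x - a) * flank_quad h B a x\<close>, which is positive for \<open>x > 1\<close>, the polynomial \<open>V\<close>
becomes a decreasing function: the quotients for the first and second weight decrease, and the
third one is constant.\<close>

lemma crossing_poly_right:
  assumes n: "0 \<le> n1" "0 \<le> n2" and xy: "1 \<le> x" "x \<le> y" "y \<le> c"
    and V: "0 \<le> crossing_poly n1 n2 n3 y" and y: "1 < y"
  shows "0 \<le> crossing_poly n1 n2 n3 x"
proof -
  have A: "(y-a)*flank_quad h B a y > 0" using flank_quad_a_pos_right[of y] xy y a by simp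
  have Ax: "(x-a)*flank_quad h B a x \<ge> 0" using flank_quad_a_pos_right[of x] xy a by simp
  have "crossing_poly n1 n2 n3 x*((y-a)*flank_quad h B a y) - crossing_poly n1 n2 n3 y*((x-a)*flank_quad h B a x)
    = n1*((y-x)*((c-a)*cross13 x y))
    + n2*((x-a)*(y-a)*((y-x)*((c-1)*(h*B*(3*h-1)*x*y - h*B*a*(c+1)*(x+y) + a^2*c*(1+B)))))"
    unfolding cross13_identity[symmetric] cross23_identity[symmetric] crossing_poly_def by (simp add: algebra_simps)
  also have "\<dots> \<ge> 0"
    using n xy a c cross13_right[of x y] cross23_nonneg[of x y] by simp
  finally have "crossing_poly n1 n2 n3 x*((y-a)*flank_quad h B a y) \<ge> crossing_poly n1 n2 n3 y*((x-a)*flank_quad h B a x)" by simp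
  moreover have "crossing_poly n1 n2 n3 y*((x-a)*flank_quad h B a x) \<ge> 0" using V Ax by simp
  ultimately have "crossing_poly n1 n2 n3 x*((y-a)*flank_quad h B a y) \<ge> 0" by linarith
  then show ?thesis using A by (simp add: zero_le_mult_iff)
qed

text \<open>Without a third weight \<open>V\<close> vanishes at \<open>c\<close>, so it is nonnegative before.\<close>

lemma crossing_poly_right_n3_0:
  assumes n: "0 \<le> n1" "0 \<le> n2" "n3 = 0" and x: "1 \<le> x" "x \<le> c"
  shows "0 \<le> crossing_poly n1 n2 n3 x"
proof (rule crossing_poly_right[OF n(1,2) x(1,2) order_refl])
  show "0 \<le> crossing_poly n1 n2 n3 c" by (simp add: crossing_poly_def n)
qed (rule c_gt1)

text \<open>The cubic has the root 1; the other factor is increasing on \<open>{1..}\<close>, and it is nonnegative at 1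
by \<open>c_le\<close>.\<close>

lemma cubic_nonneg_right:
  assumes "1 \<le> y" shows "0 \<le> (h*B+B)*y^3 - B*(a+1+c)*y^2 + a*c"
proof -
  have K: "h*B = B*(a+c)-a*c" using curve by simp
  have "a*c \<le> c" using a c by simp
  then have p: "2*(a*c) \<le> h*B+B" using c_le B by (simp add: algebra_simps)
  have "1 \<le> y^2" "y \<le> y^2" using assms by (auto simp: one_le_power self_le_power)
  then have "a*c*(1+y) \<le> a*c*(2*y^2)" using a c by (intro mult_left_mono) auto
  also have "\<dots> = 2*(a*c)*y^2" by simp
  also have "\<dots> \<le> (h*B+B)*y^2" using p by (intro mult_right_mono) auto
  finally have "(y-1)*((h*B+B)*y^2 - a*c*(1+y)) \<ge> 0" using assms by simp
  also have "(y-1)*((h*B+B)*y^2 - a*c*(1+y)) = (h*B+B)*y^3 - B*(a+1+c)*y^2 + a*c"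
    unfolding K by (simp add: algebra_simps power2_eq_square power3_eq_cube)
  finally show ?thesis .
qed

lemma gap_at_1: "gap n1 n2 n3 t 1 = t*(n1*c+n2*(a*c)+n3*a - B)"
  unfolding gap_def using curve by (simp add: algebra_simps)

lemma crossing_poly_at_1:
  assumes "n1 + n2 + n3 = 1" "n2 = 0"
  shows "crossing_poly n1 n2 n3 1 = (1-a)*(c-1)*(n1*c+n2*(a*c)+n3*a - B)"
proof -
  have K: "h*B = B*(a+c)-a*c" using curve by simp
  have n: "n1 = 1-n3" using assms by simp
  show ?thesis unfolding crossing_poly_def flank_quad_def K n assms(2)
    by (simp add: algebra_simps power2_eq_square)
qed

text \<open>Moving upwards from the boundary triple, the middle eigenvalue \<open>y\<close> of the intermediate point
lies between 1 and the one, \<open>z\<close>, of the end point, and \<open>crossing_poly_right\<close> carries the sign of \<open>V\<close>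
from \<open>z\<close> back to \<open>y\<close>.  The elimination of \<open>t\<close> degenerates when an eigenvalue does not move.
If \<open>y = z\<close> then \<open>gap\<close> is affine in \<open>t\<close> and nonnegative at both ends; if \<open>z = c\<close> the third weight
vanishes; if \<open>y = 1\<close> the second one does, and \<open>gap\<close> is a multiple of \<open>V(1)\<close>.  The assumption
\<open>special\<close> describes the case of the double eigenvalue \<open>a = 1\<close>.\<close>

lemma gap_nonneg_increasing:
  assumes n: "0 \<le> n1" "0 \<le> n2" "0 \<le> n3" "n1 + n2 + n3 = 1"
    and y: "(y-a)*(y-1)*(y-c) = t*drift_poly n1 n2 n3 y"
    and z: "(z-a)*(z-1)*(z-c) = u*drift_poly n1 n2 n3 z"
    and ord: "1 \<le> y" "y \<le> z" "z \<le> c" and tu: "0 \<le> t" "t \<le> u"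
    and N: "0 \<le> gap n1 n2 n3 u z"
    and same: "t = u \<Longrightarrow> y = z"
    and special: "a = 1 \<Longrightarrow> y = 1 \<Longrightarrow> 0 < t \<Longrightarrow> z = 1"
  shows "0 \<le> gap n1 n2 n3 t y"
proof (cases "y = z")
  case True
  show ?thesis
  proof (cases "u = 0")
    case True
    then show ?thesis using N same tu by simp
  next
    case False
    have "u * gap n1 n2 n3 t z = (u-t)*((h*B+B)*z^3 - B*(a+1+c)*z^2 + a*c) + t*gap n1 n2 n3 u z"
      unfolding gap_def by (simp add: algebra_simps)
    also have "\<dots> \<ge> 0" using cubic_nonneg_right[of z] ord N tu by simp
    finally have "u * gap n1 n2 n3 t z \<ge> 0" .
    then show ?thesis using False tu True by (simp add: zero_le_mult_iff)
  qed
next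
  case False
  then have "t \<noteq> u" using same by auto
  then have yz: "y < z" "t < u" "1 < z" "y < c" "0 < u" using False ord tu by auto
  have Vy: "0 \<le> crossing_poly n1 n2 n3 y"
  proof (cases "z = c")
    case True
    then have "n3 = 0" using z yz a unfolding drift_poly_def by auto
    then show ?thesis using crossing_poly_right_n3_0 n ord by simp
  next
    case False
    have "u*drift_poly n1 n2 n3 z < 0" unfolding z[symmetric]
      using False yz ord a by (intro mult_pos_neg) auto
    then have ps: "drift_poly n1 n2 n3 z < 0" using yz by (simp add: mult_less_0_iff)
    then have "gap n1 n2 n3 u z * drift_poly n1 n2 n3 z \<le> 0" using N by (simp add: mult_le_0_iff)
    then have "(z-1)*(z*crossing_poly n1 n2 n3 z) \<ge> 0" using gap_drift[OF n(4) z] by simp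
    then have "0 \<le> crossing_poly n1 n2 n3 z" using yz by (simp add: zero_le_mult_iff)
    then show ?thesis using crossing_poly_right[OF n(1,2)] ord yz by blast
  qed
  show ?thesis
  proof (cases "y = 1")
    case False
    then have "y > 1" using ord by simp
    then have neg: "t*drift_poly n1 n2 n3 y < 0" unfolding y[symmetric]
      using yz a by (intro mult_pos_neg) auto
    then have ps: "drift_poly n1 n2 n3 y < 0" using tu by (simp add: mult_less_0_iff)
    have "gap n1 n2 n3 t y * drift_poly n1 n2 n3 y \<le> 0"
      unfolding gap_drift[OF n(4) y] using Vy ord by simp
    then show ?thesis using ps by (simp add: mult_le_0_iff)
  next
    case True
    show ?thesis
    proof (cases "t = 0")
      case False
      then have t: "0 < t" using tu by simp
      have c1: "c > 1" using yz ord by simp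
      have a1: "a < 1" using special t True yz a by force
      have n2: "n2 = 0" using y True t c1 a1 unfolding drift_poly_def by auto
      have "(1-a)*(c-1)*(n1*c+n2*(a*c)+n3*a - B) \<ge> 0"
        using Vy crossing_poly_at_1[OF n(4) n2] True by simp
      moreover have "(1-a)*(c-1) > 0" using a1 c1 by simp
      ultimately have "n1*c+n2*(a*c)+n3*a - B \<ge> 0" by (simp only: zero_le_mult_iff) auto
      then show ?thesis using True t by (simp add: gap_at_1)
    qed (simp add: True gap_at_1)
  qed
qed

text \<open>As in \<open>crossing_poly_right\<close>, but now \<open>flank_quad h B a\<close> may be negative.  Where it is, all
three terms of \<open>V\<close> are nonnegative and not all of them vanish, so a value \<open>V(x) \<le> 0\<close> excludes
this case, and \<open>cross13_left\<close> applies from \<open>x\<close> on.\<close>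

lemma crossing_poly_left:
  assumes n: "0 \<le> n1" "0 \<le> n2" "0 \<le> n3" "n1 + n2 + n3 = 1" and xy: "a < x" "x < y" "y \<le> 1"
    and V: "crossing_poly n1 n2 n3 x \<le> 0"
  shows "crossing_poly n1 n2 n3 y \<le> 0"
proof -
  have A1: "(c-x)*flank_quad h B c x > 0" using flank_quad_c_pos_left[of x] xy c by simp
  have "a*c < a*(h*B)" using c_lt_K a by simp
  also have "\<dots> < x*(h*B)" using xy h B_gt1 by simp
  finally have A2: "(x-a)*((c-x)*(h*B*x-a*c)) > 0" using xy c by (simp add: mult.commute)
  have pos: "n1*((c-x)*flank_quad h B c x) \<ge> 0" "n2*((x-a)*((c-x)*(h*B*x-a*c))) \<ge> 0"
    using A1 A2 n by simp_all
  have g: "flank_quad h B a x \<ge> 0"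
  proof (rule ccontr)
    assume neg: "\<not> ?thesis"
    then have "(x-a)*flank_quad h B a x < 0" using xy by (simp add: mult_pos_neg)
    then have 3: "n3*((x-a)*flank_quad h B a x) \<le> 0" using n by (simp add: mult_nonneg_nonpos)
    then have "n1*((c-x)*flank_quad h B c x) = 0" "n2*((x-a)*((c-x)*(h*B*x-a*c))) = 0"
      "n3*((x-a)*flank_quad h B a x) = 0" using pos V unfolding crossing_poly_def by linarith+
    then have "n1 = 0" "n2 = 0" "n3 = 0" using A1 A2 \<open>(x-a)*flank_quad h B a x < 0\<close> by auto
    then show False using n by simp
  qed
  have gy: "flank_quad h B a y \<ge> 0" and cr: "cross13 x y \<ge> 0" using cross13_left[of x y] g xy by auto
  have A3y: "(y-a)*flank_quad h B a y \<ge> 0" using gy xy by simp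
  show ?thesis
  proof (cases "flank_quad h B a x = 0")
    case True
    then have "n1*((c-x)*flank_quad h B c x) = 0" "n2*((x-a)*((c-x)*(h*B*x-a*c))) = 0"
      using pos V unfolding crossing_poly_def True by linarith+
    then have "n1 = 0" "n2 = 0" using A1 A2 by auto
    then show ?thesis using A3y n unfolding crossing_poly_def by simp
  next
    case False
    then have A: "(x-a)*flank_quad h B a x > 0" using g xy by simp
    have "crossing_poly n1 n2 n3 x*((y-a)*flank_quad h B a y) - crossing_poly n1 n2 n3 y*((x-a)*flank_quad h B a x)
    = n1*((y-x)*((c-a)*cross13 x y))
    + n2*((x-a)*(y-a)*((y-x)*((c-1)*(h*B*(3*h-1)*x*y - h*B*a*(c+1)*(x+y) + a^2*c*(1+B)))))"
      unfolding cross13_identity[symmetric] cross23_identity[symmetric] crossing_poly_def by (simp add: algebra_simps)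
    also have "\<dots> \<ge> 0"
      using n xy a c cr cross23_nonneg[of x y] by simp
    finally have "crossing_poly n1 n2 n3 y*((x-a)*flank_quad h B a x) \<le> crossing_poly n1 n2 n3 x*((y-a)*flank_quad h B a y)" by simp
    also have "\<dots> \<le> 0" using V A3y by (simp add: mult_nonpos_nonneg)
    finally show ?thesis using A by (metis mult_pos_pos not_less)
  qed
qed

text \<open>When the first weight vanishes \<open>V\<close> has the trivial root \<open>a\<close>.  Here the sign is started from the
remaining factor, which is the form that \<open>crossing_poly_left\<close> takes in the limit \<open>x = a\<close>.\<close>

lemma crossing_poly_left_end:
  assumes n: "0 \<le> n2" "0 \<le> n3" "n2 + n3 = 1" and y: "a < y" "y \<le> 1"
    and V: "n2*((c-a)*(h*B*a-a*c)) \<le> n3*flank_quad h B a a"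
  shows "crossing_poly 0 n2 n3 y \<le> 0"
proof -
  have "a*(h*B-c) > 0" using c_lt_K a by simp
  then have "h*B*a-a*c > 0" by (simp add: algebra_simps)
  then have A2: "(c-a)*(h*B*a-a*c) > 0" using y c by simp
  have "n2*((c-a)*(h*B*a-a*c)) \<ge> 0" using A2 n by simp
  then have g: "flank_quad h B a a \<ge> 0"
  proof -
    have "n3 \<noteq> 0" using V A2 n by auto
    then show ?thesis using V n \<open>n2*((c-a)*(h*B*a-a*c)) \<ge> 0\<close> by (smt (verit) mult_nonneg_nonneg mult_pos_neg)
  qed
  have gy: "flank_quad h B a y \<ge> 0" using cross13_left[of a y] g y by auto
  have "n2*((c-y)*(h*B*y-a*c)) \<le> n3*flank_quad h B a y"
  proof (cases "flank_quad h B a a = 0")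
    case True
    then have "n2*((c-a)*(h*B*a-a*c)) \<le> 0" using V by simp
    then have "n2 \<le> 0" using A2 by (metis mult_pos_pos not_less)
    then have "n2 = 0" using n by simp
    then show ?thesis using gy n by simp
  next
    case False
    then have g: "flank_quad h B a a > 0" using g by simp
    have "(c-y)*(h*B*y-a*c)*flank_quad h B a a \<le> (c-a)*(h*B*a-a*c)*flank_quad h B a y"
    proof -
      have "(y-a)*((c-1)*(h*B*(3*h-1)*a*y - h*B*a*(c+1)*(a+y) + a^2*c*(1+B))) \<ge> 0"
        using y c cross23_nonneg[of a y] by simp
      then show ?thesis using cross23_identity[of a y] by simp
    qed
    then have "n2*((c-y)*(h*B*y-a*c)*flank_quad h B a a) \<le> n2*((c-a)*(h*B*a-a*c)*flank_quad h B a y)"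
      using n by (rule_tac mult_left_mono)
    also have "\<dots> = n2*((c-a)*(h*B*a-a*c))*flank_quad h B a y" by simp
    also have "\<dots> \<le> n3*flank_quad h B a a*flank_quad h B a y" using V gy by (rule mult_right_mono)
    finally have "n2*((c-y)*(h*B*y-a*c))*flank_quad h B a a \<le> n3*flank_quad h B a y*flank_quad h B a a"
      by (simp add: algebra_simps)
    then show ?thesis using g by simp
  qed
  then have "(y-a)*(n2*((c-y)*(h*B*y-a*c))) \<le> (y-a)*(n3*flank_quad h B a y)" using y by simp
  then show ?thesis unfolding crossing_poly_def by (simp add: algebra_simps)
qed

text \<open>The counterpart of \<open>gap_nonneg_increasing\<close> for negative parameters.  The cubic can be negative
between \<open>a\<close> and 1, but an eigenvalue that stays in place is \<open>a\<close> or 1, where it is nonnegative.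
If the middle eigenvalue of the end point is \<open>a\<close>, then \<open>low\<close> expresses that its smallest
eigenvalue has already passed below \<open>a\<close>.\<close>

lemma gap_nonneg_decreasing:
  assumes n: "0 \<le> n1" "0 \<le> n2" "0 \<le> n3" "n1 + n2 + n3 = 1"
    and y: "(y-a)*(y-1)*(y-c) = t*drift_poly n1 n2 n3 y"
    and z: "(z-a)*(z-1)*(z-c) = u*drift_poly n1 n2 n3 z"
    and ord: "a \<le> z" "z \<le> y" "y \<le> 1" and tu: "u \<le> t" "t \<le> 0"
    and N: "0 \<le> gap n1 n2 n3 u z"
    and same: "t = u \<Longrightarrow> y = z"
    and low: "n1 = 0 \<Longrightarrow> z = a \<Longrightarrow> (1-a)*(c-a) + u*(n2*(c-a) + n3*(1-a)) \<le> 0"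
  shows "0 \<le> gap n1 n2 n3 t y"
proof -
  have Qa: "(h*B+B)*a^3 - B*(a+1+c)*a^2 + a*c \<ge> 0"
  proof (cases "a = 1")
    case True
    then show ?thesis using cubic_nonneg_right[of 1] by simp
  next
    case False
    then have "flank_quad h B c a \<ge> 0" using flank_quad_c_pos_left[of a] a by simp
    then have "a * flank_quad h B c a \<ge> 0" using a by simp
    moreover have "a * flank_quad h B c a = (h*B+B)*a^3 - B*(a+1+c)*a^2 + a*c"
      unfolding flank_quad_def by (simp add: algebra_simps power2_eq_square power3_eq_cube)
    ultimately show ?thesis by simp
  qed
  show ?thesis
  proof (cases "t = u")
    case True
    then show ?thesis using N same by simp
  next
    case False
    then have u: "u < t" "u < 0" using tu by auto
    have conv: "0 \<le> gap n1 n2 n3 r z" if r: "u \<le> r" "r \<le> 0"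
      and Q: "(h*B+B)*z^3 - B*(a+1+c)*z^2 + a*c \<ge> 0" for r
    proof -
      have "(-u) * gap n1 n2 n3 r z = (r-u)*((h*B+B)*z^3 - B*(a+1+c)*z^2 + a*c) + (-r)*gap n1 n2 n3 u z"
        unfolding gap_def by (simp add: algebra_simps)
      also have "\<dots> \<ge> 0" using mult_nonneg_nonneg[of "r-u", OF _ Q] mult_nonneg_nonneg[of "-r", OF _ N] r
        by simp
      finally show ?thesis using u by (simp add: mult_le_0_iff)
    qed
    show ?thesis
    proof (cases "y = z")
      case True
      have "y = 1 \<or> y = a"
      proof -
        have "(t-u)*drift_poly n1 n2 n3 y = 0" using y z True by (simp add: algebra_simps)
        then have "(y-a)*(y-1)*(y-c) = 0" using y u by simp
        then show ?thesis using ord c by auto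
      qed
      then have "(h*B+B)*z^3 - B*(a+1+c)*z^2 + a*c \<ge> 0" using Qa cubic_nonneg_right[of 1] True by auto
      then show ?thesis using conv[of t] u tu True by auto
    next
      case False
      then have yz: "z < y" "a < 1" "z < 1" "a < y" using ord by auto
      have Vy: "crossing_poly n1 n2 n3 y \<le> 0"
      proof (cases "z = a")
        case False
        then have az: "a < z" using ord by simp
        have "u*drift_poly n1 n2 n3 z > 0" unfolding z[symmetric]
          using az yz c by (intro mult_neg_neg mult_pos_neg) auto
        then have ps: "drift_poly n1 n2 n3 z < 0" using u by (simp add: zero_less_mult_iff)
        then have "gap n1 n2 n3 u z * drift_poly n1 n2 n3 z \<le> 0" using N by (simp add: mult_le_0_iff)
        then have "(z-1)*(z*crossing_poly n1 n2 n3 z) \<ge> 0" using gap_drift[OF n(4) z] by simp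
        then have "z*crossing_poly n1 n2 n3 z \<le> 0" using yz by (simp add: zero_le_mult_iff)
        moreover have "0 < z" using az a by simp
        ultimately have "crossing_poly n1 n2 n3 z \<le> 0" by (metis mult_pos_pos not_less)
        then show ?thesis using crossing_poly_left[OF n] az yz ord by blast
      next
        case True
        then have n1: "n1 = 0" using z u yz c unfolding drift_poly_def by auto
        have bt: "n2*(c-a) + n3*(1-a) > 0"
          using n n1 yz c by (smt (verit) mult_nonneg_nonneg mult_pos_pos)
        \<comment> \<open>the parameter at which the smallest eigenvalue reaches \<open>a\<close>\<close>
        define r where "r = - ((1-a)*(c-a)/(n2*(c-a) + n3*(1-a)))"
        have rb: "r*(n2*(c-a) + n3*(1-a)) = - ((1-a)*(c-a))" using bt unfolding r_def by simp
        have "r \<le> 0" using yz c bt unfolding r_def by simp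
        have "u*(n2*(c-a) + n3*(1-a)) \<le> r*(n2*(c-a) + n3*(1-a))" using low[OF n1 True] rb by simp
        then have "u \<le> r" using bt by simp
        then have "gap n1 n2 n3 r a \<ge> 0" using conv[of r] True Qa \<open>r \<le> 0\<close> by simp
        then have Nr: "gap n1 n2 n3 r a*(n2*(c-a) + n3*(1-a)) \<ge> 0" using bt by simp
        have "gap n1 n2 n3 r a*(n2*(c-a) + n3*(1-a)) = 
           - ((1-a)*(a*(n2*((c-a)*(h*B*a-a*c)) - n3*flank_quad h B a a)))"
        proof -
          have K: "h*B = B*(a+c)-a*c" using curve by simp
          have n': "n2 = 1-n3" using n n1 by simp
          have "gap n1 n2 n3 r a*(n2*(c-a) + n3*(1-a)) =
            ((h*B+B)*a^3 - B*(a+1+c)*a^2 + a*c)*(n2*(c-a) + n3*(1-a))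
              + (r*(n2*(c-a) + n3*(1-a)))*(n1*c+n2*(a*c)+n3*a - B*a^2)"
            unfolding gap_def by (simp add: algebra_simps)
          also have "\<dots> = ((h*B+B)*a^3 - B*(a+1+c)*a^2 + a*c)*(n2*(c-a) + n3*(1-a))
              + (- ((1-a)*(c-a)))*(n1*c+n2*(a*c)+n3*a - B*a^2)" unfolding rb ..
          also have "\<dots> = - ((1-a)*(a*(n2*((c-a)*(h*B*a-a*c)) - n3*flank_quad h B a a)))"
            unfolding n1 n' flank_quad_def K by (simp add: algebra_simps power2_eq_square power3_eq_cube)
          finally show ?thesis .
        qed
        then have "(1-a)*(a*(n2*((c-a)*(h*B*a-a*c)) - n3*flank_quad h B a a)) \<le> 0" using Nr by simp
        then have "n2*((c-a)*(h*B*a-a*c)) - n3*flank_quad h B a a \<le> 0" using yz a by (simp add: mult_le_0_iff)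
        then show ?thesis using crossing_poly_left_end[of n2 n3 y] n n1 yz ord by simp
      qed
      show ?thesis
      proof (cases "y = 1")
        case False
        then have "y < 1" using ord by simp
        then have pos: "t*drift_poly n1 n2 n3 y > 0" unfolding y[symmetric]
          using yz c by (intro mult_neg_neg mult_pos_neg) auto
        then have ps: "drift_poly n1 n2 n3 y < 0" using tu by (simp add: zero_less_mult_iff)
        have "(1-y)*(y*crossing_poly n1 n2 n3 y) \<le> 0" using Vy \<open>y < 1\<close> yz a by (simp add: mult_le_0_iff)
        then have "gap n1 n2 n3 t y * drift_poly n1 n2 n3 y \<le> 0"
          unfolding gap_drift[OF n(4) y] by (simp add: algebra_simps)
        then show ?thesis using ps by (simp add: mult_le_0_iff)
      next
        case True
        show ?thesis
        proof (cases "t = 0")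
          case False
          then have t: "t < 0" using tu by simp
          have n2: "n2 = 0" using y True t c_gt1 yz unfolding drift_poly_def by auto
          have "(1-a)*(c-1)*(n1*c+n2*(a*c)+n3*a - B) \<le> 0"
            using Vy crossing_poly_at_1[OF n(4) n2] True by simp
          moreover have "(1-a)*(c-1) > 0" using yz c_gt1 by simp
          ultimately have "n1*c+n2*(a*c)+n3*a - B \<le> 0" by (metis mult_pos_pos not_less diff_gt_0_iff_gt diff_le_0_iff_le less_eq_real_def)
          then show ?thesis using True t by (simp add: gap_at_1 mult_nonpos_nonpos)
        qed (simp add: True gap_at_1)
      qed
    qed
  qed
qed

end

section \<open>Stability of the two boundary inequalities\<close>

text \<open>For \<open>h = 2/(3u) - 1\<close> and a triple of sum 1 this is \<open>b(u)\<close> up to a positive factor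
(\<open>curve_form_b_value\<close>), made homogeneous in the triple.\<close>

definition curve_form where
  "curve_form h x y z = (h+1)*x*z - (3*h-1)*y*(x+z) + h*(3*h-1)*y^2" for h :: real

lemma curve_form_scale: "curve_form h (k*x) (k*y) (k*z) = k^2 * curve_form h x y z"
  unfolding curve_form_def by (simp add: algebra_simps power2_eq_square)

lemma update_scale:
  assumes "rank_one_update a b c p q r t l m n" "k \<noteq> 0"
  shows "rank_one_update (k*a) (k*b) (k*c) p q r (k*t) (k*l) (k*m) (k*n)"
  unfolding rank_one_update_def
proof
  fix x
  have x: "x = k*(x/k)" using assms by simp
  have "secular (k*a) (k*b) (k*c) p q r (k*t) (k*y) = k^3 * secular a b c p q r t y" for y
    unfolding secular_def by (simp add: algebra_simps power3_eq_cube)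
  moreover have "(k*y-k*l)*(k*y-k*m)*(k*y-k*n) = k^3*((y-l)*(y-m)*(y-n))" for y
    by (simp add: algebra_simps power3_eq_cube)
  ultimately show "secular (k*a) (k*b) (k*c) p q r (k*t) x = (x-k*l)*(x-k*m)*(x-k*n)"
    using assms x unfolding rank_one_update_def by metis
qed

context boundary_triple
begin

text \<open>This connects the polynomial \<open>gap\<close> of the trajectory with the condition on its spectrum.\<close>

lemma gap_curve_form:
  assumes "p + q + r = 1" "rank_one_update a 1 c p q r t l m n"
  shows "(h+1)*gap p q r t m = m*curve_form h l m n"
proof -
  have e1: "a + 1 + c = l+m+n - t" and e3: "l*m*n = a*c+t*(p*c+q*(a*c)+r*a)"
    using update_coeffs(1,3)[OF assms(2)] unfolding assms(1) by (simp_all add: algebra_simps)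
  have "gap p q r t m = (h*B+B)*m^3 - B*(a+1+c+t)*m^2 + (a*c+t*(p*c+q*(a*c)+r*a))"
    unfolding gap_def by (simp add: algebra_simps)
  also have "\<dots> = (h*B+B)*m^3 - B*(l+m+n)*m^2 + l*m*n" using e1 e3 by simp
  finally have N: "gap p q r t m = (h*B+B)*m^3 - B*(l+m+n)*m^2 + l*m*n" .
  show ?thesis unfolding N curve_form_def using B by algebra
qed

text \<open>Here the interlacing inequalities supply the side conditions of \<open>gap_nonneg_increasing\<close> and
\<open>gap_nonneg_decreasing\<close>, including those for double eigenvalues.\<close>

lemma stable_step:
  assumes n: "0 \<le> p" "0 \<le> q" "0 \<le> r" "p + q + r = 1"
    and m: "rank_one_update a 1 c p q r t l m n" "0 < l" "l \<le> m" "m \<le> n"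
    and m': "rank_one_update a 1 c p q r u l' m' n'" "0 < l'" "l' \<le> m'" "m' \<le> n'"
    and seg: "(0 \<le> t \<and> t \<le> u) \<or> (u \<le> t \<and> t \<le> 0)"
    and b: "0 \<le> curve_form h l' m' n'"
  shows "0 \<le> curve_form h l m n"
proof -
  have h1: "h + 1 > 0" using h by simp
  have "(h+1)*gap p q r u m' \<ge> 0" unfolding gap_curve_form[OF n(4) m'(1)] using b m' by simp
  then have N: "gap p q r u m' \<ge> 0" using h1 by (simp add: zero_le_mult_iff)
  have root: "(x-a)*(x-1)*(x-c) = t'*drift_poly p q r x" 
    if "rank_one_update a 1 c p q r t' l0 x n0" for x t' l0 n0
    using that[unfolded rank_one_update_def, rule_format, of x] unfolding secular_def drift_poly_def by (simp add: algebra_simps)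
  have "gap p q r t m \<ge> 0"
  proof (cases "0 \<le> t \<and> t \<le> u")
    case True
    note i = interlacing[OF a(2) c n(1-3) True[THEN conjunct1] True[THEN conjunct2] m(1,3,4) m'(1,3,4)]
    show ?thesis
    proof (rule gap_nonneg_increasing[OF n root[OF m(1)] root[OF m'(1)] i(4) i(5) i(6) _ _ N])
      show "0 \<le> t" "t \<le> u" using True by auto
      show "m = m'" if "t = u"
        using interlacing(5)[OF a(2) c n(1-3) _ _ m'(1,3,4) m(1,3,4)] i(5) True that by auto
      show "m' = 1" if "a = 1" "m = 1" "0 < t"
      proof -
        have l: "l = 1" using i that m by auto
        have "n = c + t" using update_coeffs(1)[OF m(1)] n(4) that l by simp
        moreover have "n = c + t*(p*c+q*c+r)" using update_coeffs(3)[OF m(1)] n(4) that l by simp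
        ultimately have "t*(p*c+q*c+r-1) = 0" by (simp add: algebra_simps)
        then have "p*c+q*c+r-1 = 0" using that by simp
        then have "(p+q)*(c-1) = 0" using n(4) by algebra
        then have "p + q = 0" using c_gt1 by simp
        then have pq: "p = 0" "q = 0" "r = 1" using n by auto
        have "(m'-1)*((m'-1)*(m'-c-u)) = 0"
          using root[OF m'(1)] that(1) unfolding drift_poly_def pq by (simp add: algebra_simps)
        moreover have "m'-c-u < 0" using i(6) True that by linarith
        ultimately show ?thesis by simp
      qed
    qed
  next
    case False
    then have tu: "u \<le> t" "t \<le> 0" using seg by auto
    note i = interlacing_neg[OF a(2) c n(1-3) tu m(1,3,4) m'(1,3,4)]
    show ?thesis
    proof (rule gap_nonneg_decreasing[OF n root[OF m(1)] root[OF m'(1)] i(3) i(4) i(5) tu N])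
      show "m = m'" if "t = u"
        using interlacing_neg(4)[OF a(2) c n(1-3) _ _ m'(1,3,4) m(1,3,4)] i(4) tu that by auto
      show "(1-a)*(c-a) + u*(q*(c-a) + r*(1-a)) \<le> 0" if "p = 0" "m' = a"
      proof -
        have n4: "q = 1 - r" using n(4) that by simp
        have s1: "l' + n' = 1 + c + u" using update_coeffs(1)[OF m'(1)] n4 that by simp
        have "l'*a + a*n' + l'*n' = a + c + a*c + u*(q*(a+c)+r*(a+1))"
          using update_coeffs(2)[OF m'(1)] that by (simp add: algebra_simps)
        then have "a*(l'+n') + l'*n' = a + c + a*c + u*(q*(a+c)+r*(a+1))" by (simp add: algebra_simps)
        then have s2: "l'*n' = a + c + a*c + u*(q*(a+c)+r*(a+1)) - a*(1+c+u)" unfolding s1 by simp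
        have "(a-l')*(a-n') = a^2 - a*(l'+n') + l'*n'" by (simp add: algebra_simps power2_eq_square)
        also have "\<dots> = (1-a)*(c-a) + u*(q*(c-a) + r*(1-a))"
          unfolding s1 s2 n4 by (simp add: algebra_simps power2_eq_square)
        finally have "(1-a)*(c-a) + u*(q*(c-a) + r*(1-a)) = (a-l')*(a-n')" ..
        moreover have "(a-l')*(a-n') \<le> 0" using m'(3,4) that by (intro mult_nonneg_nonpos) auto
        ultimately show ?thesis by simp
      qed
    qed
  qed
  then have "m*curve_form h l m n \<ge> 0" unfolding gap_curve_form[OF n(4) m(1), symmetric] using h1 by simp
  then show ?thesis using m by (simp add: zero_le_mult_iff)
qed

end

lemma stable_from_boundary:
  assumes h: "1 < h" and f: "0 < a" "a \<le> b" "b \<le> c" "curve_form h a b c = 0"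
    and n: "0 \<le> p" "0 \<le> q" "0 \<le> r" "p + q + r = 1"
    and m: "rank_one_update a b c p q r t l m n" "0 < l" "l \<le> m" "m \<le> n"
    and m': "rank_one_update a b c p q r u l' m' n'" "0 < l'" "l' \<le> m'" "m' \<le> n'"
    and seg: "(0 \<le> t \<and> t \<le> u) \<or> (u \<le> t \<and> t \<le> 0)"
    and b: "0 \<le> curve_form h l' m' n'"
  shows "0 \<le> curve_form h l m n"
proof -
  define k where "k = 1/b"
  have b0: "0 < b" using f by simp
  have k: "0 < k" "k*b = 1" using b0 by (auto simp: k_def)
  define B where "B = (3*h-1)/(h+1)"
  have B: "B*(h+1) = 3*h-1" using h by (simp add: B_def)
  have "(h+1)*((k*a)*(k*c) - B*(k*a+k*c) + h*B) = curve_form h (k*a) (k*b) (k*c)"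
  proof -
    have "curve_form h (k*a) (k*b) (k*c) = (h+1)*((k*a)*(k*c)) - (3*h-1)*(k*a+k*c) + h*(3*h-1)"
      unfolding curve_form_def k(2) by (simp add: algebra_simps)
    then show ?thesis unfolding B[symmetric] by (simp add: algebra_simps)
  qed
  also have "\<dots> = 0" unfolding curve_form_scale f(4) by simp
  finally have "(k*a)*(k*c) - B*(k*a+k*c) + h*B = 0" using h by simp
  then have "boundary_triple h B (k*a) (k*c)"
  proof (unfold_locales)
    show "k*a \<le> 1" using mult_left_mono[OF f(2), of k] k by simp
    show "1 \<le> k*c" using mult_left_mono[OF f(3), of k] k by simp
  qed (use h B k f in auto)
  then interpret boundary_triple h B "k*a" "k*c" .
  have k0: "k \<noteq> 0" using k by simp
  have kap: "(0 \<le> k*t \<and> k*t \<le> k*u) \<or> (k*u \<le> k*t \<and> k*t \<le> 0)"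
    using seg k by (auto simp: mult_le_0_iff zero_le_mult_iff)
  have "0 \<le> curve_form h (k*l) (k*m) (k*n)"
    using stable_step[OF n update_scale[OF m(1) k0, unfolded k(2)] _ _ _
        update_scale[OF m'(1) k0, unfolded k(2)] _ _ _ kap] k m m' b by (simp add: curve_form_scale)
  then show ?thesis unfolding curve_form_scale using k by (simp add: zero_le_mult_iff)
qed

lemma curve_form_1: "curve_form 1 x y z = - 2*((y-x)*(z-y))"
  unfolding curve_form_def by (simp add: algebra_simps power2_eq_square)

text \<open>As a quadratic polynomial in \<open>h\<close> the form is convex and nonpositive at 1 (\<open>curve_form_1\<close>), so 1
separates its roots.\<close>

lemma curve_form_factor:
  assumes "0 < x" "x \<le> y" "y \<le> z"
  obtains r s where "r \<le> 1" "1 \<le> s" "\<And>h. curve_form h x y z = 3*y^2*((h-r)*(h-s))"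
proof -
  define A C D where "A = 3*y^2" and "C = x*z - 3*y*(x+z) - y^2" and "D = x*z+y*(x+z)"
  have A: "A > 0" using assms by (simp add: A_def)
  have q: "curve_form h x y z = A*h^2+C*h+D" for h
    unfolding curve_form_def A_def C_def D_def by (simp add: algebra_simps power2_eq_square)
  have "0 \<le> (y-x)*(z-y)" using assms by simp
  then have q1: "A + C + D \<le> 0" using q[of 1] unfolding curve_form_1 by simp
  define W where "W = sqrt (C^2-4*A*D)"
  have "4*A*(A+C+D) = (2*A+C)^2 - (C^2-4*A*D)" by (simp add: algebra_simps power2_eq_square)
  moreover have "4*A*(A+C+D) \<le> 0" using q1 A by (simp add: mult_le_0_iff)
  ultimately have disc: "(2*A+C)^2 \<le> C^2-4*A*D" by simp
  then have W2: "W^2 = C^2-4*A*D" unfolding W_def by (smt (verit) real_sqrt_pow2 zero_le_power2)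
  have "\<bar>2*A+C\<bar> \<le> W" unfolding W_def using disc real_le_rsqrt by (simp add: real_le_rsqrt)
  then have W: "2*A+C \<le> W" "-(2*A+C) \<le> W" by auto
  show thesis
  proof (rule that[of "(-C-W)/(2*A)" "(-C+W)/(2*A)"])
    show "(-C-W)/(2*A) \<le> 1" "1 \<le> (-C+W)/(2*A)" using W A by (auto simp: field_simps)
    have e: "A*((h - (-C-W)/(2*A))*(h-(-C+W)/(2*A))) = A*h^2 + C*h + D" for h
    proof -
      have "4*A*(A*((h - (-C-W)/(2*A))*(h-(-C+W)/(2*A)))) = (2*A*h+C+W)*(2*A*h+C-W)"
        using A by (simp add: field_simps)
      also have "\<dots> = 4*A*(A*h^2+C*h+D)" using W2 by (simp add: algebra_simps power2_eq_square)
      finally show ?thesis using A by simp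
    qed
    show "curve_form h x y z = 3*y^2*((h - (-C-W)/(2*A))*(h-(-C+W)/(2*A)))" for h
      unfolding q e[symmetric] by (simp add: A_def)
  qed
qed

lemma curve_form_mono:
  assumes "0 < x" "x \<le> y" "y \<le> z" "1 < g" "g \<le> h" "0 \<le> curve_form g x y z"
  shows "0 \<le> curve_form h x y z"
proof -
  obtain r w where rs: "r \<le> 1" "1 \<le> w" "\<And>h. curve_form h x y z = 3*y^2*((h-r)*(h-w))"
    using curve_form_factor[OF assms(1-3)] by metis
  have "(g-r)*(g-w) \<ge> 0" using assms rs(3)[of g] by (simp add: zero_le_mult_iff)
  then have "w \<le> g" using rs assms by (simp add: zero_le_mult_iff)
  then show ?thesis unfolding rs(3) using rs assms by simp
qed

text \<open>The value \<open>w\<close> is the parameter of the boundary curve through the given triple.  If it equals 1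
then the two larger entries agree: when the two smaller ones agree instead, the other root is
\<open>(y + 2z)/(3y)\<close>, which exceeds 1 unless \<open>z = y\<close>.\<close>

lemma largest_root:
  assumes f: "0 < x" "x \<le> y" "y \<le> z" and H: "1 < H" "0 \<le> curve_form H x y z"
  obtains w where "1 \<le> w" "w \<le> H" "curve_form w x y z = 0" "\<And>h. w \<le> h \<Longrightarrow> 0 \<le> curve_form h x y z"
    "w = 1 \<Longrightarrow> y = z"
proof -
  obtain r w where rs: "r \<le> 1" "1 \<le> w" "\<And>h. curve_form h x y z = 3*y^2*((h-r)*(h-w))"
    using curve_form_factor[OF f] by metis
  have "(H-r)*(H-w) \<ge> 0" using H f rs(3)[of H] by (simp add: zero_le_mult_iff)
  then have wH: "w \<le> H" using rs H by (simp add: zero_le_mult_iff)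
  have nn: "0 \<le> curve_form h x y z" if "w \<le> h" for h unfolding rs(3) using that rs by simp
  have yz: "y = z" if "w = 1"
  proof (rule ccontr)
    assume ne: "y \<noteq> z"
    have "curve_form 1 x y z = 0" using rs(3)[of 1] that by simp
    then have "x = y" using ne by (simp add: curve_form_1)
    \<comment> \<open>a point strictly between 1 and the other root\<close>
    define h where "h = (2*y+z)/(3*y)"
    have y: "y > 0" "y < z" using f ne by auto
    then have h: "1 < h" "3*h*y = 2*y+z" by (auto simp: h_def field_simps)
    have "curve_form h x y z = (h-1)*(y*((3*h-1)*y - 2*z))"
      unfolding curve_form_def \<open>x = y\<close> by (simp add: algebra_simps power2_eq_square)
    also have "(3*h-1)*y - 2*z = y - z" using h by (simp add: algebra_simps)
    also have "(h-1)*(y*(y-z)) < 0" using h y by (simp add: mult_pos_neg)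
    finally show False using nn[of h] that h by simp
  qed
  show thesis by (rule that[OF rs(2) wH _ nn yz]) (simp add: rs(3))
qed

text \<open>The parameter \<open>t\<close> lies on the segment from 0 to \<open>u\<close>, whose orientation depends on which of the
two ends of the trajectory is taken as the origin.\<close>

definition between where "between t u \<longleftrightarrow> (0 \<le> t \<and> t \<le> u) \<or> (u \<le> t \<and> t \<le> (0::real))"

text \<open>The trajectory is described from both ends, because the argument starts at the end with the
larger boundary parameter.  Only if both parameters equal 1 is there no curve to start from; then both ends
have a double largest eigenvalue, and monotonicity forces it on every point between.\<close>

lemma stable_gt1:
  assumes H: "1 < H" and f: "0 < a" "a \<le> b" "b \<le> c" and g: "0 < a'" "a' \<le> b'" "b' \<le> c'"
    and m: "0 < l" "l \<le> m" "m \<le> n"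
    and w: "0 \<le> p" "0 \<le> q" "0 \<le> r" "p + q + r = 1" and w': "0 \<le> p'" "0 \<le> q'" "0 \<le> r'" "p' + q' + r' = 1"
    and fg: "rank_one_update a b c p q r u a' b' c'" and fm: "rank_one_update a b c p q r t l m n" "between t u"
    and gf: "rank_one_update a' b' c' p' q' r' u' a b c" and gm: "rank_one_update a' b' c' p' q' r' t' l m n" "between t' u'"
    and bf: "0 \<le> curve_form H a b c" and bg: "0 \<le> curve_form H a' b' c'"
  shows "0 \<le> curve_form H l m n"
proof -
  obtain x where x: "1 \<le> x" "x \<le> H" "curve_form x a b c = 0" "\<And>h. x \<le> h \<Longrightarrow> 0 \<le> curve_form h a b c"
    "x = 1 \<Longrightarrow> b = c" using largest_root[OF f H bf] by metis
  obtain y where y: "1 \<le> y" "y \<le> H" "curve_form y a' b' c' = 0" "\<And>h. y \<le> h \<Longrightarrow> 0 \<le> curve_form h a' b' c'"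
    "y = 1 \<Longrightarrow> b' = c'" using largest_root[OF g H bg] by metis
  consider "x = 1 \<and> y = 1" | "1 < x \<and> y \<le> x" | "1 < y \<and> x \<le> y" using x y by linarith
  then show ?thesis
  proof cases
    case 1
    then have bc: "b = c" "b' = c'" using x y by auto
    have "m = n"
    proof (cases "0 \<le> t \<and> t \<le> u")
      case True
      note i = interlacing[OF f(2,3) w(1-3) True[THEN conjunct1] True[THEN conjunct2] fm(1) m(2,3) fg g(2,3)]
      show ?thesis using i bc m by linarith
    next
      case False
      then have tu: "u \<le> t" "t \<le> 0" using fm(2) by (auto simp: between_def)
      note i = interlacing_neg[OF f(2,3) w(1-3) tu fm(1) m(2,3) fg g(2,3)]
      show ?thesis using i bc m by linarith
    qed
    have "curve_form H l m n = (H-1)*(m*((3*H-1)*m - 2*l))"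
      unfolding curve_form_def \<open>m = n\<close> by (simp add: algebra_simps power2_eq_square)
    also have "\<dots> \<ge> 0"
    proof -
      have "2*m \<le> (3*H-1)*m" using H m by (intro mult_right_mono) auto
      then have "0 \<le> (3*H-1)*m - 2*l" using m by linarith
      then show ?thesis using H m by simp
    qed
    finally show ?thesis .
  next
    case 2
    then have "0 \<le> curve_form x l m n"
      using stable_from_boundary[OF _ f x(3) w fm(1) m fg g fm(2)[unfolded between_def] y(4)] by simp
    then show ?thesis by (rule curve_form_mono[OF m, rotated 2]) (use 2 x in auto)
  next
    case 3
    then have "0 \<le> curve_form y l m n"
      using stable_from_boundary[OF _ g y(3) w' gm(1) m gf f gm(2)[unfolded between_def] x(4)] by simp
    then show ?thesis by (rule curve_form_mono[OF m, rotated 2]) (use 3 y in auto)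
  qed
qed

lemma weighted_inverse_squares_pos:
  fixes p q r a b c :: real
  assumes "0 \<le> p" "0 \<le> q" "0 \<le> r" "p + q + r = 1" "0 < a" "0 < b" "0 < c"
  shows "0 < p/a^2 + q/b^2 + r/c^2"
proof -
  have "p \<noteq> 0 \<or> q \<noteq> 0 \<or> r \<noteq> 0" using assms by auto
  moreover have "p/a^2 \<ge> 0" "q/b^2 \<ge> 0" "r/c^2 \<ge> 0" using assms by auto
  moreover have "p/a^2 = 0 \<longleftrightarrow> p = 0" "q/b^2 = 0 \<longleftrightarrow> q = 0" "r/c^2 = 0 \<longleftrightarrow> r = 0" using assms by auto
  ultimately show ?thesis by argo
qed

text \<open>The Sherman--Morrison formula for the inverse matrix, at the level of characteristic
polynomials: \<open>F + t n \<otimes> n\<close> has the inverse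
\<open>F^-1 - t / (1 + t kap) (F^-1 n) \<otimes> (F^-1 n)\<close>, and \<open>Z\<close> is the squared norm of \<open>F^-1 n\<close>.\<close>

lemma update_inverse:
  assumes f: "0 < a" "0 < b" "0 < c" and m: "0 < l" "0 < m" "0 < n"
    and w: "0 \<le> p" "0 \<le> q" "0 \<le> r" "p + q + r = 1" and u: "rank_one_update a b c p q r t l m n"
  defines "Z \<equiv> p/a^2+q/b^2+r/c^2" and "kap \<equiv> p/a+q/b+r/c"
  shows "0 < 1 + t*kap"
    and "rank_one_update (1/c) (1/b) (1/a) (r/c^2/Z) (q/b^2/Z) (p/a^2/Z) (- (t/(1+t*kap))*Z) (1/n) (1/m) (1/l)"
proof -
  have Z: "Z > 0" unfolding Z_def by (rule weighted_inverse_squares_pos[OF w f])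
  have s: "l*m*n = (1 + t*kap)*(a*b*c)"
    using update_coeffs(3)[OF u] f unfolding kap_def by (simp add: field_simps)
  have "l*m*n > 0" "a*b*c > 0" using f m by simp_all
  then show s0: "0 < 1 + t*kap" unfolding s by (metis zero_less_mult_pos2)
  define \<sigma> where "\<sigma> = 1 + t*kap"
  have \<sigma>: "\<sigma> > 0" using s0 by (simp add: \<sigma>_def)
  have key: "(x-1/a)*(x-1/b)*(x-1/c) + t*x*(p/a*((x-1/b)*(x-1/c))+q/b*((x-1/a)*(x-1/c))+r/c*((x-1/a)*(x-1/b)))
     = \<sigma>*((x-1/l)*(x-1/m)*(x-1/n))" for x
  proof (cases "x = 0")
    case True
    then show ?thesis using s f m \<sigma> unfolding \<sigma>_def[symmetric] by (simp add: field_simps)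
  next
    case False
    \<comment> \<open>the inverse matrix has the characteristic polynomial with reversed coefficients\<close>
    define y where "y = 1/x"
    have xy: "x*y = 1" using False by (simp add: y_def)
    have fac: "x - 1/d = - (x/d)*(y-d)" if "0 < d" for d using that xy False by (simp add: field_simps y_def)
    have "(x-1/a)*(x-1/b)*(x-1/c) + t*x*(p/a*((x-1/b)*(x-1/c))+q/b*((x-1/a)*(x-1/c))+r/c*((x-1/a)*(x-1/b)))
      = - (x^3/(a*b*c)) * secular a b c p q r t y"
      unfolding fac[OF f(1)] fac[OF f(2)] fac[OF f(3)] secular_def using f
      by (simp add: field_simps power3_eq_cube)
    also have "\<dots> = - (x^3/(a*b*c))*((y-l)*(y-m)*(y-n))" using u by (simp add: rank_one_update_def)
    also have "\<dots> = \<sigma>*(l*m*n/(\<sigma>*(a*b*c)))*(- (x^3/(l*m*n))*((y-l)*(y-m)*(y-n)))"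
      using f m \<sigma> by simp
    also have "l*m*n/(\<sigma>*(a*b*c)) = 1" using s f \<sigma> unfolding \<sigma>_def[symmetric] by simp
    also have "\<sigma>*1*(- (x^3/(l*m*n))*((y-l)*(y-m)*(y-n))) = \<sigma>*((x-1/l)*(x-1/m)*(x-1/n))"
      unfolding fac[OF m(1)] fac[OF m(2)] fac[OF m(3)] using m by (simp add: field_simps power3_eq_cube)
    finally show ?thesis .
  qed
  show "rank_one_update (1/c) (1/b) (1/a) (r/c^2/Z) (q/b^2/Z) (p/a^2/Z) (- (t/(1+t*kap))*Z) (1/n) (1/m) (1/l)"
    unfolding rank_one_update_def \<sigma>_def[symmetric]
  proof
    fix x
    have "secular (1/c) (1/b) (1/a) (r/c^2/Z) (q/b^2/Z) (p/a^2/Z) (- (t/\<sigma>)*Z) x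
      = (x-1/a)*(x-1/b)*(x-1/c) + (t/\<sigma>)*(p/a^2*((x-1/b)*(x-1/c))+q/b^2*((x-1/a)*(x-1/c))+r/c^2*((x-1/a)*(x-1/b)))"
    proof -
      have "Z*(r/c^2/Z*R1+q/b^2/Z*R2+p/a^2/Z*R3) = p/a^2*R3+q/b^2*R2+r/c^2*R1" for R1 R2 R3
        using Z by (simp add: field_simps)
      note zz = this[of "(x-1/b)*(x-1/a)" "(x-1/c)*(x-1/a)" "(x-1/c)*(x-1/b)"]
      have "secular (1/c) (1/b) (1/a) (r/c^2/Z) (q/b^2/Z) (p/a^2/Z) (- (t/\<sigma>)*Z) x
        = (x-1/c)*(x-1/b)*(x-1/a) + (t/\<sigma>)*(Z*(r/c^2/Z*((x-1/b)*(x-1/a))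
            + q/b^2/Z*((x-1/c)*(x-1/a)) + p/a^2/Z*((x-1/c)*(x-1/b))))"
        unfolding secular_def by simp
      then show ?thesis unfolding zz by (simp only: ac_simps)
    qed
    also have "\<sigma>*\<dots> = (x-1/a)*(x-1/b)*(x-1/c)*\<sigma> + t*(p/a^2*((x-1/b)*(x-1/c))+q/b^2*((x-1/a)*(x-1/c))+r/c^2*((x-1/a)*(x-1/b)))"
      using \<sigma> by (simp add: algebra_simps)
    also have "\<dots> = (x-1/a)*(x-1/b)*(x-1/c) + t*x*(p/a*((x-1/b)*(x-1/c))+q/b*((x-1/a)*(x-1/c))+r/c*((x-1/a)*(x-1/b)))"
    proof -
      have "(x-A)*(x-B)*(x-C)*(1+t*(p*A+q*B+r*C))
          + t*(p*A^2*((x-B)*(x-C))+q*B^2*((x-A)*(x-C))+r*C^2*((x-A)*(x-B)))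
        = (x-A)*(x-B)*(x-C) + t*x*(p*A*((x-B)*(x-C))+q*B*((x-A)*(x-C))+r*C*((x-A)*(x-B)))" for A B C
        by (simp add: algebra_simps power2_eq_square)
      from this[of "1/a" "1/b" "1/c"] show ?thesis unfolding \<sigma>_def kap_def
        by (simp add: power_divide)
    qed
    finally show "secular (1/c) (1/b) (1/a) (r/c^2/Z) (q/b^2/Z) (p/a^2/Z) (- (t/\<sigma>)*Z) x = (x-1/n)*(x-1/m)*(x-1/l)"
      unfolding key using \<sigma> by (simp add: ac_simps)
  qed
qed

text \<open>Inversion reverses the order of the entries and exchanges \<open>h\<close> with \<open>G = (H + 1) / (3H - 1) > 1\<close>,
so this is \<open>stable_gt1\<close> for the inverse triples.\<close>

lemma stable_lt1:
  assumes H: "1/3 < H" "H < 1" and f: "0 < a" "a \<le> b" "b \<le> c" and g: "0 < a'" "a' \<le> b'" "b' \<le> c'"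
    and m: "0 < l" "l \<le> m" "m \<le> n"
    and w: "0 \<le> p" "0 \<le> q" "0 \<le> r" "p + q + r = 1" and w': "0 \<le> p'" "0 \<le> q'" "0 \<le> r'" "p' + q' + r' = 1"
    and fg: "rank_one_update a b c p q r u a' b' c'" and fm: "rank_one_update a b c p q r t l m n" "between t u"
    and gf: "rank_one_update a' b' c' p' q' r' u' a b c" and gm: "rank_one_update a' b' c' p' q' r' t' l m n" "between t' u'"
    and bf: "0 \<le> curve_form H a b c" and bg: "0 \<le> curve_form H a' b' c'"
  shows "0 \<le> curve_form H l m n"
proof -
  define G where "G = (H+1)/(3*H-1)"
  have G: "1 < G" using H by (simp add: G_def field_simps)
  have inv: "curve_form G (1/z) (1/y) (1/x) = 4*curve_form H x y z/((3*H-1)^2*x*y^2*z)"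
    if "0 < x" "x \<le> y" "y \<le> z" for x y z
  proof -
    have d: "3*H-1 \<noteq> 0" "x \<noteq> 0" "y \<noteq> 0" "z \<noteq> 0" using that H by auto
    have G1: "(3*H-1)*G = H+1" using d by (simp add: G_def)
    have "x*y^2*z*curve_form G (1/z) (1/y) (1/x) = (G+1)*y^2 - (3*G-1)*y*(x+z) + G*(3*G-1)*x*z"
      unfolding curve_form_def using d by (simp add: field_simps power2_eq_square)
    then have "(3*H-1)^2*(x*y^2*z*curve_form G (1/z) (1/y) (1/x)) = 4*curve_form H x y z"
      unfolding curve_form_def using G1 by algebra
    then show ?thesis using d by (simp add: field_simps)
  qed
  have inv0: "0 \<le> curve_form G (1/z) (1/y) (1/x) \<longleftrightarrow> 0 \<le> curve_form H x y z" if "0 < x" "x \<le> y" "y \<le> z" for x y z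
  proof -
    have "(3*H-1)^2*x*y^2*z > 0" using that H by simp
    then show ?thesis unfolding inv[OF that] by (simp add: zero_le_divide_iff)
  qed
  have srt: "0 < 1/z" "1/z \<le> 1/y" "1/y \<le> 1/x" if "0 < x" "x \<le> y" "y \<le> z" for x y z :: real
    using that by (auto intro!: divide_left_mono)
  have bet: "between (- (t/(1+t*k))*Z) (- (u/(1+u*k))*Z)"
    if "between t u" "0 < 1+t*k" "0 < 1+u*k" "0 \<le> Z" for t u k Z
  proof -
    have 1: "t/(1+t*k) \<le> u/(1+u*k) \<longleftrightarrow> t \<le> u" "u/(1+u*k) \<le> t/(1+t*k) \<longleftrightarrow> u \<le> t"
      using that(2,3) by (simp_all add: field_simps)
    show ?thesis using that(1) unfolding between_def
    proof (elim disjE conjE)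
      assume "0 \<le> t" "t \<le> u"
      then have "t/(1+t*k) \<le> u/(1+u*k)" "0 \<le> t/(1+t*k)" using 1 that by simp_all
      then have "t/(1+t*k)*Z \<le> u/(1+u*k)*Z" "0 \<le> t/(1+t*k)*Z"
        using mult_right_mono that(4) mult_nonneg_nonneg by blast+
      then show "0 \<le> - (t/(1+t*k))*Z \<and> - (t/(1+t*k))*Z \<le> - (u/(1+u*k))*Z \<or>
         - (u/(1+u*k))*Z \<le> - (t/(1+t*k))*Z \<and> - (t/(1+t*k))*Z \<le> 0" by simp
    next
      assume "u \<le> t" "t \<le> 0"
      then have "u/(1+u*k) \<le> t/(1+t*k)" "t/(1+t*k) \<le> 0"
        using 1 that by (simp_all add: divide_nonpos_pos)
      then have "u/(1+u*k)*Z \<le> t/(1+t*k)*Z" "t/(1+t*k)*Z \<le> 0"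
        using mult_right_mono that(4) mult_nonpos_nonneg by blast+
      then show "0 \<le> - (t/(1+t*k))*Z \<and> - (t/(1+t*k))*Z \<le> - (u/(1+u*k))*Z \<or>
         - (u/(1+u*k))*Z \<le> - (t/(1+t*k))*Z \<and> - (t/(1+t*k))*Z \<le> 0" by simp
    qed
  qed
  define Z Z' where "Z = p/a^2+q/b^2+r/c^2" and "Z' = p'/a'^2+q'/b'^2+r'/c'^2"
  have pos: "0 < b" "0 < c" "0 < b'" "0 < c'" "0 < m" "0 < n" using f g m by auto
  have Z: "0 < Z" unfolding Z_def by (rule weighted_inverse_squares_pos[OF w f(1) pos(1,2)])
  have Z': "0 < Z'" unfolding Z'_def by (rule weighted_inverse_squares_pos[OF w' g(1) pos(3,4)])
  note U = update_inverse[OF f(1) pos(1,2) _ _ _ w, folded Z_def]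
  note U' = update_inverse[OF g(1) pos(3,4) _ _ _ w', folded Z'_def]
  have s1: "r/c^2/Z + q/b^2/Z + p/a^2/Z = 1"
    using Z unfolding add_divide_distrib[symmetric] by (simp add: Z_def add.commute add.left_commute)
  have s2: "r'/c'^2/Z' + q'/b'^2/Z' + p'/a'^2/Z' = 1"
    using Z' unfolding add_divide_distrib[symmetric] by (simp add: Z'_def add.commute add.left_commute)
  have "0 \<le> curve_form G (1/n) (1/m) (1/l)"
  proof (rule stable_gt1[OF G srt[OF f] srt[OF g] srt[OF m] _ _ _ s1 _ _ _ s2
        U(2)[OF g(1) pos(3,4) fg] U(2)[OF m(1) pos(5,6) fm(1)] _ U'(2)[OF f(1) pos(1,2) gf] U'(2)[OF m(1) pos(5,6) gm(1)]])
    show "between (- (t/(1+t*(p/a+q/b+r/c)))*Z) (- (u/(1+u*(p/a+q/b+r/c)))*Z)"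
      by (rule bet[OF fm(2) U(1)[OF m(1) pos(5,6) fm(1)] U(1)[OF g(1) pos(3,4) fg]]) (use Z in simp)
    show "between (- (t'/(1+t'*(p'/a'+q'/b'+r'/c')))*Z') (- (u'/(1+u'*(p'/a'+q'/b'+r'/c')))*Z')"
      by (rule bet[OF gm(2) U'(1)[OF m(1) pos(5,6) gm(1)] U'(1)[OF f(1) pos(1,2) gf]]) (use Z' in simp)
    show "0 \<le> curve_form G (1/c) (1/b) (1/a)" using inv0[OF f] bf by simp
    show "0 \<le> curve_form G (1/c') (1/b') (1/a')" using inv0[OF g] bg by simp
  qed (use w w' Z Z' in auto)
  then show ?thesis using inv0[OF m] by simp
qed

section \<open>Matrices and their sorted spectra\<close>

lemma scaleR_mult_left: "(k *\<^sub>R A) ** B = k *\<^sub>R (A ** B)" for A :: "real^'n^'m" and B :: "real^'k^'n"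
  by (vector matrix_matrix_mult_def) (simp add: sum_distrib_left mult.assoc)

lemma scaleR_mult_right: "A ** (k *\<^sub>R B) = k *\<^sub>R (A ** B)" for A :: "real^'n^'m" and B :: "real^'k^'n"
  by (vector matrix_matrix_mult_def) (simp add: sum_distrib_left algebra_simps)

lemma diff_mult_left: "(A - B) ** C = A ** C - B ** C" for A :: "real^'n^'m" and C :: "real^'k^'n"
  by (vector matrix_matrix_mult_def) (simp add: sum_subtractf left_diff_distrib)

lemma diff_mult_right: "C ** (A - B) = C ** A - C ** B" for C :: "real^'n^'m" and A :: "real^'k^'n"
  by (vector matrix_matrix_mult_def) (simp add: sum_subtractf right_diff_distrib)

lemma conj_tensor: "R ** tensor n n ** transpose R = tensor (R *v n) (R *v n)" for R :: "real^3^3"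
  unfolding vec_eq_iff tensor_def transpose_def matrix_matrix_mult_def matrix_vector_mult_def
  by (simp add: sum_3 forall_3 algebra_simps)

lemma charpoly_conj:
  fixes R :: "real^3^3"
  assumes "orthogonal_matrix R"
  shows "det (x *\<^sub>R mat 1 - R ** A ** transpose R) = det (x *\<^sub>R mat 1 - A)"
proof -
  have RR: "R ** transpose R = mat 1" using assms by (simp add: orthogonal_matrix_def)
  have "R ** (x *\<^sub>R mat 1 - A) ** transpose R = x *\<^sub>R mat 1 - R ** A ** transpose R"
    by (simp add: diff_mult_left diff_mult_right scaleR_mult_left scaleR_mult_right RR)
  then have "det (x *\<^sub>R mat 1 - R ** A ** transpose R) = det R * det (x *\<^sub>R mat 1 - A) * det (transpose R)"
    by (metis det_mul)
  also have "\<dots> = det (R ** transpose R) * det (x *\<^sub>R mat 1 - A)" by (simp add: det_mul)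
  finally show ?thesis by (simp add: RR)
qed

lemma charpoly_update:
  "det (x *\<^sub>R mat 1 - (k *\<^sub>R diag3 d + w *\<^sub>R tensor n n))
     = secular (k*d$1) (k*d$2) (k*d$3) ((n$1)^2) ((n$2)^2) ((n$3)^2) w x"
  unfolding det_3 secular_def diag3_def tensor_def mat_def
  by (simp add: algebra_simps power2_eq_square)

lemma ordered_eigenvalues_eq:
  assumes "l \<le> m" "m \<le> n" and "\<And>x. det (x *\<^sub>R mat 1 - A) = (x-l)*(x-m)*(x-n)"
  shows "ordered_eigenvalues A = vector [l,m,n]"
  unfolding ordered_eigenvalues_def
proof (rule the_equality)
  fix z :: "real^3"
  assume z: "z$1 \<le> z$2 \<and> z$2 \<le> z$3 \<and> (\<forall>x. det (x *\<^sub>R mat 1 - A) = (x - z$1)*(x - z$2)*(x - z$3))"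
  then have "(x-l)*(x-m)*(x-n) = (x - z$1)*(x - z$2)*(x - z$3)" for x using assms(3) by metis
  from sorted_roots_unique[OF this assms(1,2)] z show "z = vector [l,m,n]"
    by (simp add: vec_eq_iff forall_3)
qed (use assms in simp)

text \<open>The sorted entries of a triple are taken as symmetric continuous functions of it, so that
permutations and limits need no choice of a sorting permutation.\<close>

definition lo :: "real^3 \<Rightarrow> real" where "lo x = Min (range (\<lambda>i. x$i))"
definition hi :: "real^3 \<Rightarrow> real" where "hi x = Max (range (\<lambda>i. x$i))"
definition mid :: "real^3 \<Rightarrow> real" where "mid x = (\<Sum>i\<in>UNIV. x$i) - lo x - hi x"

lemma lo_min: "lo x = min (x$1) (min (x$2) (x$3))" unfolding lo_def UNIV_3 by simp
lemma hi_max: "hi x = max (x$1) (max (x$2) (x$3))" unfolding hi_def UNIV_3 by simp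
lemma mid_eq: "mid x = x$1 + x$2 + x$3 - lo x - hi x" unfolding mid_def by (simp add: sum_3)

lemma sorted_lo_mid_hi: "lo x \<le> mid x" "mid x \<le> hi x"
  unfolding mid_eq lo_min hi_max by (auto simp: min_def max_def)

lemma lo_mid_hi_sorted:
  assumes "l \<le> m" "m \<le> n"
  shows "lo (vector [l,m,n]) = l" "mid (vector [l,m,n]) = m" "hi (vector [l,m,n]) = n"
  using assms unfolding mid_eq lo_min hi_max by (auto simp: min_def max_def)

lemma orderings:
  "(lo x, mid x, hi x) \<in> {(x$1,x$2,x$3),(x$1,x$3,x$2),(x$2,x$1,x$3),(x$2,x$3,x$1),(x$3,x$1,x$2),(x$3,x$2,x$1)}"
  unfolding mid_eq lo_min hi_max by (auto simp: min_def max_def)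

text \<open>Sorting the diagonal entries permutes the weights along with them.\<close>

lemma secular_sort:
  assumes "0 \<le> p" "0 \<le> q" "0 \<le> r"
  obtains p' q' r' where "0 \<le> p'" "0 \<le> q'" "0 \<le> r'" "p' + q' + r' = p + q + r"
    "\<And>t x. secular (d$1) (d$2) (d$3) p q r t x = secular (lo d) (mid d) (hi d) p' q' r' t x"
proof -
  have "\<exists>p' q' r'. 0 \<le> p' \<and> 0 \<le> q' \<and> 0 \<le> r' \<and> p' + q' + r' = p + q + r \<and>
    (\<forall>t x. secular (d$1) (d$2) (d$3) p q r t x = secular (lo d) (mid d) (hi d) p' q' r' t x)"
    (is "\<exists>p' q' r'. ?P p' q' r'")
  proof -
    consider "lo d = d$1 \<and> mid d = d$2 \<and> hi d = d$3" | "lo d = d$1 \<and> mid d = d$3 \<and> hi d = d$2"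
      | "lo d = d$2 \<and> mid d = d$1 \<and> hi d = d$3" | "lo d = d$2 \<and> mid d = d$3 \<and> hi d = d$1"
      | "lo d = d$3 \<and> mid d = d$1 \<and> hi d = d$2" | "lo d = d$3 \<and> mid d = d$2 \<and> hi d = d$1"
      using orderings[of d] by auto
    then show ?thesis
    proof cases
      case 1 then have "?P p q r" using assms by simp then show ?thesis by blast
    next
      case 2 then have "?P p r q" using assms by (simp add: secular_def algebra_simps) then show ?thesis by blast
    next
      case 3 then have "?P q p r" using assms by (simp add: secular_def algebra_simps) then show ?thesis by blast
    next
      case 4 then have "?P q r p" using assms by (simp add: secular_def algebra_simps) then show ?thesis by blast
    next
      case 5 then have "?P r p q" using assms by (simp add: secular_def algebra_simps) then show ?thesis by blast
    next
      case 6 then have "?P r q p" using assms by (simp add: secular_def algebra_simps) then show ?thesis by blast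
    qed
  qed
  then show thesis using that by blast
qed

lemma lo_mid_hi_scale:
  assumes "0 < k" shows "lo (k *\<^sub>R x) = k * lo x" "hi (k *\<^sub>R x) = k * hi x" "mid (k *\<^sub>R x) = k * mid x"
proof -
  show 1: "lo (k *\<^sub>R x) = k * lo x" "hi (k *\<^sub>R x) = k * hi x"
    unfolding lo_min hi_max using assms by (auto simp: min_def max_def)
  show "mid (k *\<^sub>R x) = k * mid x" unfolding mid_eq 1 by (simp add: algebra_simps)
qed

lemma diag3_mult: "diag3 d *v x = (\<chi> i. d$i * x$i)"
  unfolding diag3_def matrix_vector_mult_def vec_eq_iff by (simp add: if_distrib if_distribR cong: if_cong)

text \<open>All columns are multiples of one vector \<open>w\<close>, and symmetry makes the factors proportional to the
entries of \<open>w\<close>.\<close>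

lemma rank_one_symmetric:
  fixes A :: "real^3^3"
  assumes "rank A = 1" "transpose A = A"
  obtains c n where "norm n = 1" "A = c *\<^sub>R tensor n n"
proof -
  have d: "dim (range (\<lambda>x. A *v x)) = 1" using assms(1) by (simp add: rank_dim_range)
  obtain S where S: "S \<subseteq> range (\<lambda>x. A *v x)" "independent S" "range (\<lambda>x. A *v x) \<subseteq> span S" "card S = 1"
    using basis_exists[of "range (\<lambda>x. A *v x)"] d by metis
  then obtain w where w: "S = {w}" by (metis card_1_singletonE)
  then have w0: "w \<noteq> 0" using S(2) dependent_zero by blast
  have "\<exists>k. A *v axis j 1 = k *\<^sub>R w" for j
    using S(3) unfolding w span_singleton by auto
  then obtain k where k: "A *v axis j 1 = k j *\<^sub>R w" for j by metis
  have A: "A$i$j = k j * w$i" for i j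
  proof -
    have "(A *v axis j 1)$i = A$i$j" by (simp add: matrix_vector_mult_basis column_def)
    then show ?thesis using k[of j] by simp
  qed
  have sym: "A$i$j = A$j$i" for i j using assms(2) unfolding transpose_def vec_eq_iff by simp
  obtain i0 where i0: "w$i0 \<noteq> 0" using w0 by (auto simp: vec_eq_iff)
  \<comment> \<open>the common ratio of \<open>k j\<close> to \<open>w$j\<close>\<close>
  define e where "e = k i0 / w$i0"
  have kj: "k j = e * w$j" for j
    using sym[of i0 j] A[of i0 j] A[of j i0] i0 unfolding e_def by (simp add: field_simps)
  define n where "n = (1/norm w) *\<^sub>R w"
  have nw: "norm w > 0" using w0 by simp
  show thesis
  proof (rule that)
    show "norm n = 1" unfolding n_def using nw by simp
    show "A = (e*(norm w)^2) *\<^sub>R tensor n n"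
      unfolding vec_eq_iff tensor_def n_def using A kj nw by (simp add: field_simps power2_eq_square)
  qed
qed

text \<open>The trace identifies the factor of \<open>n \<otimes> n\<close>.  A vector \<open>y\<close> orthogonal to \<open>n\<close> is in the kernel
of the difference, and comparing the two positive definite forms at \<open>y\<close> shows that \<open>l\<close> is
positive.\<close>

lemma rank_one_connection:
  fixes R :: "real^3^3"
  assumes F: "\<And>i. 0 < F$i" "F$1 + F$2 + F$3 = 1" and G: "\<And>i. 0 < G$i" "G$1 + G$2 + G$3 = 1"
    and R: "orthogonal_matrix R" and rk: "rank (l *\<^sub>R diag3 F - transpose R ** diag3 G ** R) = 1"
  obtains n where "0 < l" "norm n = 1"
    "transpose R ** diag3 G ** R = l *\<^sub>R diag3 F + (1-l) *\<^sub>R tensor n n"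
proof -
  define A where "A = l *\<^sub>R diag3 F - transpose R ** diag3 G ** R"
  have RR: "R ** transpose R = mat 1" using R by (simp add: orthogonal_matrix_def)
  have dT: "transpose (diag3 d) = diag3 d" for d unfolding diag3_def transpose_def by (auto simp: vec_eq_iff)
  have tS: "transpose (transpose R ** diag3 G ** R) = transpose R ** diag3 G ** R"
    by (simp add: matrix_transpose_mul dT matrix_mul_assoc)
  have "transpose A = A"
  proof -
    have "A$i$j = A$j$i" for i j
    proof -
      have "(transpose R ** diag3 G ** R)$i$j = (transpose R ** diag3 G ** R)$j$i"
        using tS unfolding vec_eq_iff transpose_def by simp
      then show ?thesis unfolding A_def by (simp add: diag3_def)
    qed
    then show ?thesis unfolding transpose_def vec_eq_iff by simp
  qed
  then obtain c n where n: "norm n = 1" and A: "A = c *\<^sub>R tensor n n"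
    using rank_one_symmetric[of A] rk A_def by metis
  have nn: "(n$1)^2 + (n$2)^2 + (n$3)^2 = 1"
    using n unfolding norm_eq_1 by (simp add: inner_vec_def sum_3 power2_eq_square)
  have c: "c = l - 1"
  proof -
    have trace_lin: "trace (k *\<^sub>R X - Y) = k * trace X - trace Y" for k and X Y :: "real^3^3"
      unfolding trace_def by (simp add: sum_3 algebra_simps)
    have trace_lin0: "trace (k *\<^sub>R X) = k * trace X" for k and X :: "real^3^3"
      unfolding trace_def by (simp add: sum_3 algebra_simps)
    have tr_diag: "trace (diag3 d) = d$1 + d$2 + d$3" for d
      unfolding trace_def diag3_def by (simp add: sum_3)
    have tr_tensor: "trace (tensor n n) = (n$1)^2 + (n$2)^2 + (n$3)^2"
      unfolding trace_def tensor_def by (simp add: sum_3 power2_eq_square)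
    have "trace (transpose R ** diag3 G ** R) = trace (diag3 G)"
    proof -
      have "trace (transpose R ** (diag3 G ** R)) = trace ((diag3 G ** R) ** transpose R)"
        by (rule trace_mul_sym)
      also have "(diag3 G ** R) ** transpose R = diag3 G" by (simp add: matrix_mul_assoc[symmetric] RR)
      finally show ?thesis by (simp add: matrix_mul_assoc)
    qed
    then have "trace A = l - 1"
      unfolding A_def trace_lin by (simp add: tr_diag F(2) G(2))
    moreover have "trace A = c"
      unfolding A trace_lin0 tr_tensor nn by simp
    ultimately show ?thesis by simp
  qed
  have eq: "transpose R ** diag3 G ** R = l *\<^sub>R diag3 F + (1-l) *\<^sub>R tensor n n"
  proof -
    have "transpose R ** diag3 G ** R = l *\<^sub>R diag3 F - A" unfolding A_def by simp
    also have "\<dots> = l *\<^sub>R diag3 F + (1-l) *\<^sub>R tensor n n" unfolding A c by (simp add: algebra_simps)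
    finally show ?thesis .
  qed
  have "0 < l"
  proof -
    obtain y where y: "y \<noteq> 0" "orthogonal n y" using orthogonal_to_vector_exists[of n] by auto
    have Ay: "A *v y = 0"
    proof -
      have "tensor n n *v y = inner n y *\<^sub>R n"
        unfolding tensor_def matrix_vector_mult_def vec_eq_iff inner_vec_def
        by (simp add: sum_3 algebra_simps)
      then show ?thesis unfolding A using y(2) by (simp add: orthogonal_def scaleR_matrix_vector_assoc[symmetric])
    qed
    have quad: "inner z (diag3 d *v z) > 0" if d: "\<And>i. 0 < d$i" and z: "z \<noteq> 0" for d z :: "real^3"
    proof -
      obtain j where "z$j \<noteq> 0" using z by (auto simp: vec_eq_iff)
      have "inner z (diag3 d *v z) = (\<Sum>i\<in>UNIV. d$i*(z$i)^2)"
        unfolding diag3_mult inner_vec_def by (simp add: power2_eq_square algebra_simps)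
      also have "\<dots> > 0" using d \<open>z$j \<noteq> 0\<close> by (intro sum_pos2[of _ j]) (auto simp: less_imp_le)
      finally show ?thesis .
    qed
    have "l * inner y (diag3 F *v y) = inner y ((transpose R ** diag3 G ** R) *v y)"
    proof -
      have "inner y (A *v y) = l * inner y (diag3 F *v y) - inner y ((transpose R ** diag3 G ** R) *v y)"
        unfolding A_def by (simp add: matrix_vector_mult_diff_rdistrib inner_diff_right scaleR_matrix_vector_assoc[symmetric])
      then show ?thesis using Ay by simp
    qed
    also have "\<dots> = inner (R *v y) (diag3 G *v (R *v y))"
    proof -
      have "inner y ((transpose R ** diag3 G ** R) *v y) = inner y (transpose R *v (diag3 G *v (R *v y)))"
        by (simp add: matrix_vector_mul_assoc matrix_mul_assoc)
      also have "\<dots> = inner (y v* transpose R) (diag3 G *v (R *v y))" by (rule dot_lmul_matrix[symmetric])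
      finally show ?thesis by (simp only: vector_transpose_matrix)
    qed
    also have "\<dots> > 0"
    proof (rule quad[OF G(1)])
      have "transpose R *v (R *v y) = y" using R by (simp add: orthogonal_matrix_def matrix_vector_mul_assoc)
      then show "R *v y \<noteq> 0" using y(1) by auto
    qed
    finally show ?thesis using quad[OF F(1) y(1)] by (simp add: zero_less_mult_iff)
  qed
  then show thesis using that n eq by blast
qed

lemma eta_denominator_pos:
  fixes l t :: real
  assumes "0 < l" "0 \<le> t" "t \<le> 1"
  shows "0 < l + t*(1-l)"
proof -
  have "l + t*(1-l) = (1-t)*l + t" by (simp add: algebra_simps)
  also have "\<dots> > 0" using assms by (cases "t = 0") (auto intro!: add_nonneg_pos)
  finally show ?thesis .
qed

definition region :: "real \<Rightarrow> real \<Rightarrow> (real^3) set" where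
  "region h k = {x \<in> unit_sum_plane. 0 < lo x \<and> 0 \<le> curve_form h (lo x) (mid x) (hi x)
     \<and> 0 \<le> curve_form k (lo x) (mid x) (hi x)}"

lemma lo_le: "lo x \<le> x$i" unfolding lo_def by (intro Min_le) auto

lemma sum_sq_1: "norm n = 1 \<Longrightarrow> (n$1)^2 + (n$2)^2 + (n$3)^2 = 1" for n :: "real^3"
  unfolding norm_eq_1 by (simp add: inner_vec_def sum_3 power2_eq_square)

text \<open>Both ends serve as origin: conjugation by \<open>R\<close> turns the segment into one that starts at
\<open>G / l\<close>.  After sorting, \<open>stable_gt1\<close> and \<open>stable_lt1\<close> apply to the spectrum divided by
\<open>eta l t\<close>.\<close>

lemma stable_region:
  assumes h: "1 < h" and k: "1/3 < k" "k < 1"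
  shows "stable_under_lamination (region h k)"
  unfolding stable_under_lamination_def
proof (intro ballI allI impI)
  fix F G l R t
  assume F: "F \<in> region h k" and G: "G \<in> region h k" and rot: "rotation_matrix R"
    and rk: "rank (l *\<^sub>R diag3 F - transpose R ** diag3 G ** R) = 1" and t: "t \<in> {0..1::real}"
  have R: "orthogonal_matrix R" using rot by (simp add: rotation_matrix_def)
  have pos: "0 < F$i" "0 < G$i" for i
    using F G lo_le[of F i] lo_le[of G i] unfolding region_def by force+
  have sum: "F$1 + F$2 + F$3 = 1" "G$1 + G$2 + G$3 = 1"
    using F G by (auto simp: region_def unit_sum_plane_def)
  obtain n0 where l: "0 < l" and n0: "norm n0 = 1 \<and> transpose R ** diag3 G ** R = l *\<^sub>R diag3 F + (1-l) *\<^sub>R tensor n0 n0"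
    using rank_one_connection[OF pos(1) sum(1) pos(2) sum(2) R rk] by metis
  define n where "n = connecting_normal F G l R"
  have n: "norm n = 1" and E: "transpose R ** diag3 G ** R = l *\<^sub>R diag3 F + (1-l) *\<^sub>R tensor n n"
    using someI[of "\<lambda>n. norm n = 1 \<and> transpose R ** diag3 G ** R = l *\<^sub>R diag3 F + (1-l) *\<^sub>R tensor n n", OF n0]
    unfolding n_def connecting_normal_def by blast+
  define N where "N = R *v n"
  have N: "norm N = 1" unfolding N_def using n R by (metis orthogonal_transformation_matrix orthogonal_transformation_norm matrix_of_matrix_vector_mul matrix_vector_mul_linear)
  define u where "u = (1-l)/l"
  define g where "g = (1/l) *\<^sub>R G"
  have gs: "lo g = (1/l)*lo G" "mid g = (1/l)*mid G" "hi g = (1/l)*hi G"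
    using l by (simp_all add: g_def lo_mid_hi_scale)
  have swap: "secular (F$1) (F$2) (F$3) ((n$1)^2) ((n$2)^2) ((n$3)^2) y x
     = secular (g$1) (g$2) (g$3) ((N$1)^2) ((N$2)^2) ((N$3)^2) (y-u) x" for x y
  proof -
    define A where "A = 1 *\<^sub>R diag3 F + y *\<^sub>R tensor n n"
    have RR: "R ** transpose R = mat 1" using R by (simp add: orthogonal_matrix_def)
    have "diag3 F = (1/l) *\<^sub>R (transpose R ** diag3 G ** R - (1-l) *\<^sub>R tensor n n)"
      unfolding E using l by simp
    then have A: "A = (1/l) *\<^sub>R (transpose R ** diag3 G ** R) - (u-y) *\<^sub>R tensor n n"
    proof -
      have u: "(1/l)*(1-l) = u" by (simp add: u_def)
      assume *: "diag3 F = (1/l) *\<^sub>R (transpose R ** diag3 G ** R - (1-l) *\<^sub>R tensor n n)"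
      show ?thesis unfolding A_def * scaleR_one scaleR_diff_right scaleR_scaleR u
        unfolding scaleR_diff_left by simp
    qed
    have c: "R ** (transpose R ** diag3 G ** R) ** transpose R = diag3 G"
      using RR by (metis matrix_mul_assoc matrix_mul_lid matrix_mul_rid)
    have "R ** A ** transpose R = (1/l) *\<^sub>R diag3 G - (u-y) *\<^sub>R tensor N N"
      unfolding A diff_mult_left diff_mult_right scaleR_mult_left scaleR_mult_right c conj_tensor N_def ..
    also have "\<dots> = (1/l) *\<^sub>R diag3 G + (y-u) *\<^sub>R tensor N N" by (simp add: algebra_simps)
    finally have "det (x *\<^sub>R mat 1 - ((1/l) *\<^sub>R diag3 G + (y-u) *\<^sub>R tensor N N)) = det (x *\<^sub>R mat 1 - A)"
      using charpoly_conj[OF R, of x A] by simp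
    then show ?thesis unfolding A_def charpoly_update by (simp add: g_def)
  qed
  obtain p q r where w: "0 \<le> p" "0 \<le> q" "0 \<le> r" "p + q + r = 1"
    and pF: "\<And>y x. secular (F$1) (F$2) (F$3) ((n$1)^2) ((n$2)^2) ((n$3)^2) y x = secular (lo F) (mid F) (hi F) p q r y x"
    using secular_sort[of "(n$1)^2" "(n$2)^2" "(n$3)^2" F] sum_sq_1[OF n] by (metis zero_le_power2)
  obtain p' q' r' where w': "0 \<le> p'" "0 \<le> q'" "0 \<le> r'" "p' + q' + r' = 1"
    and pG: "\<And>y x. secular (g$1) (g$2) (g$3) ((N$1)^2) ((N$2)^2) ((N$3)^2) y x = secular (lo g) (mid g) (hi g) p' q' r' y x"
    using secular_sort[of "(N$1)^2" "(N$2)^2" "(N$3)^2" g] sum_sq_1[OF N] by (metis zero_le_power2)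
  have sw: "secular (lo F) (mid F) (hi F) p q r y x = secular (lo g) (mid g) (hi g) p' q' r' (y-u) x" for x y
    using swap pF pG by metis
  have s0: "secular a b c d e f 0 x = (x-a)*(x-b)*(x-c)" for a b c d e f x by (simp add: secular_def)
  have fg: "rank_one_update (lo F) (mid F) (hi F) p q r u (lo g) (mid g) (hi g)"
    unfolding rank_one_update_def sw by (simp add: s0)
  have gf: "rank_one_update (lo g) (mid g) (hi g) p' q' r' (-u) (lo F) (mid F) (hi F)"
    unfolding rank_one_update_def using sw[of 0] by (simp add: s0)
  obtain x y z where m: "rank_one_update (lo F) (mid F) (hi F) p q r (t*u) x y z" "x \<le> y" "y \<le> z"
    using update_exists[OF sorted_lo_mid_hi w(1-3)] by blast
  have gm: "rank_one_update (lo g) (mid g) (hi g) p' q' r' (t*u-u) x y z"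
    using m(1) unfolding rank_one_update_def sw .
  have b1: "between (t*u) u"
    using t by (cases "0 \<le> u") (auto simp: between_def mult_left_le_one_le mult_nonneg_nonpos
        dest: mult_right_mono_neg[of t 1 u])
  have b2: "between (t*u-u) (-u)"
    using t by (cases "0 \<le> u") (auto simp: between_def mult_left_le_one_le mult_nonneg_nonpos
        dest: mult_right_mono_neg[of t 1 u])
  have fpos: "0 < lo F" and gpos: "0 < lo g" using F G l unfolding gs region_def by auto
  have x: "0 < x"
  proof (cases "0 \<le> t*u \<and> t*u \<le> u")
    case True
    show ?thesis using interlacing(1)[OF sorted_lo_mid_hi w(1-3) True[THEN conjunct1] True[THEN conjunct2]
        m fg sorted_lo_mid_hi] fpos by simp
  next
    case False
    then have "u \<le> t*u" "t*u \<le> 0" using b1 by (auto simp: between_def)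
    then show ?thesis using interlacing_neg(1)[OF sorted_lo_mid_hi w(1-3) _ _ m fg sorted_lo_mid_hi] gpos by simp
  qed
  have bg: "0 \<le> curve_form v (lo g) (mid g) (hi g)" if "0 \<le> curve_form v (lo G) (mid G) (hi G)" for v
    unfolding gs curve_form_scale using that by simp
  have bF: "0 \<le> curve_form h (lo F) (mid F) (hi F)" "0 \<le> curve_form k (lo F) (mid F) (hi F)"
    and bG: "0 \<le> curve_form h (lo g) (mid g) (hi g)" "0 \<le> curve_form k (lo g) (mid g) (hi g)"
    using F G bg unfolding region_def by auto
  have c1: "0 \<le> curve_form h x y z"
    by (rule stable_gt1[OF h fpos sorted_lo_mid_hi gpos sorted_lo_mid_hi x m(2,3) w w' fg m(1) b1 gf gm b2 bF(1) bG(1)])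
  have c2: "0 \<le> curve_form k x y z"
    by (rule stable_lt1[OF k fpos sorted_lo_mid_hi gpos sorted_lo_mid_hi x m(2,3) w w' fg m(1) b1 gf gm b2 bF(2) bG(2)])
  define e where "e = eta l t"
  have den: "0 < l + t*(1-l)" using eta_denominator_pos[OF l] t by simp
  have e: "0 < e" "1 - e = e*(t*u)"
  proof -
    show "0 < e" unfolding e_def eta_def using den l by simp
    have "1 - e = (l + t*(1-l) - l)/(l + t*(1-l))"
      unfolding e_def eta_def diff_divide_distrib using den by simp
    also have "\<dots> = e*(t*u)" unfolding e_def eta_def u_def using l by simp
    finally show "1 - e = e*(t*u)" .
  qed
  have ev: "lam_m F G R l t = vector [e*x, e*y, e*z]"
    unfolding lam_m_def
  proof (rule ordered_eigenvalues_eq)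
    show "e*x \<le> e*y" "e*y \<le> e*z" using e m by auto
    fix a
    have "det (a *\<^sub>R mat 1 - lam_M F G R l t)
        = secular (e*F$1) (e*F$2) (e*F$3) ((n$1)^2) ((n$2)^2) ((n$3)^2) (1-e) a"
      unfolding lam_M_def traj_def n_def[symmetric] e_def[symmetric] charpoly_update ..
    also have "\<dots> = (a-e*x)*(a-e*y)*(a-e*z)"
    proof -
      have "rank_one_update (F$1) (F$2) (F$3) ((n$1)^2) ((n$2)^2) ((n$3)^2) (t*u) x y z"
        using m(1) unfolding rank_one_update_def pF .
      from update_scale[OF this, of e] show ?thesis using e unfolding rank_one_update_def by simp
    qed
    finally show "det (a *\<^sub>R mat 1 - lam_M F G R l t) = (a-e*x)*(a-e*y)*(a-e*z)" .
  qed
  have srt: "e*x \<le> e*y" "e*y \<le> e*z" using e m by auto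
  have "x + y + z = 1 + t*u"
    using update_coeffs(1)[OF m(1)] w(4) sum unfolding mid_eq by simp
  then have "e*(x + y + z) = e*(1 + t*u)" by simp
  then have "e*x + e*y + e*z = e + e*(t*u)" by (simp only: distrib_left mult_1_right)
  also have "\<dots> = 1" using e by simp
  finally have "vector [e*x, e*y, e*z] \<in> region h k"
    unfolding region_def unit_sum_plane_def using x e c1 c2
    by (simp add: lo_mid_hi_sorted[OF srt] curve_form_scale)
  then show "lam_m F G R l t \<in> region h k" unfolding ev .
qed

section \<open>The set enclosed by the curve\<close>

text \<open>The polynomial \<open>b\<close> formed with an arbitrary triple.\<close>

definition b_value :: "real \<Rightarrow> real \<Rightarrow> real \<Rightarrow> real \<Rightarrow> real" where
  "b_value l m n x = 6*m*x^2 + x*(l*n - 3*m - 4*m^2) + 2*m^2"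

lemma curve_form_b_value:
  assumes "l + m + n = 1" "0 < x"
  shows "curve_form (2/(3*x) - 1) l m n = 2/(3*x^2) * b_value l m n x"
proof -
  have n: "n = 1 - l - m" using assms by simp
  show ?thesis unfolding n curve_form_def b_value_def using assms(2)
    by (simp add: field_simps power2_eq_square)
qed

lemma curve_form_b_value_sign:
  assumes "l + m + n = 1" "0 < x"
  shows "0 \<le> curve_form (2/(3*x) - 1) l m n \<longleftrightarrow> 0 \<le> b_value l m n x"
  unfolding curve_form_b_value[OF assms] using assms(2) by (simp add: zero_le_mult_iff zero_le_divide_iff)

text \<open>For a given middle entry the product of the outer entries of a sorted triple is greatest when one
of them equals the middle one.  The bound confines the middle entry to one side of \<open>x\<close> whenever
\<open>b(x) \<ge> 0\<close>.\<close>

lemma b_value_le: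
  assumes "l + m + n = 1" "l \<le> m" "m \<le> n" "0 < x"
  shows "b_value l m n x \<le> 2*m*((3*x-1)*(x-m))"
proof -
  have "0 \<le> x*((m-l)*(n-m))" using assms by simp
  moreover have n: "n = 1 - l - m" using assms by simp
  ultimately show ?thesis unfolding b_value_def n by (simp add: algebra_simps power2_eq_square)
qed

text \<open>The product of the roots of \<open>b\<close> is a third of the middle entry, so one root determines the other.\<close>

lemma b_value_other_root:
  assumes "b_value l m n u = 0"
  shows "u*b_value l m n x = (x-u)*(2*m*(3*u*x - m))"
  using assms unfolding b_value_def by algebra

lemma b_value_0_iff:
  assumes "0 < u"
  shows "b_value l m n u = 0 \<longleftrightarrow> l*n = 3*(1-2*u)*m - 2*((1-2*u)/u)*m^2"
  unfolding b_value_def using assms by (auto simp: field_simps power2_eq_square)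

text \<open>With \<open>X = B m - l\<close> and \<open>Y = n - B m\<close> the condition is \<open>X Y \<le> B (h - B) m^2\<close>.  Adding the same
\<open>d \<ge> 0\<close> to all entries decreases both \<open>X / m\<close> and \<open>Y / m\<close>, and they are never both negative,
so the condition is preserved.\<close>

lemma star_shape:
  assumes h: "1/3 < h" "h \<noteq> 1" and f: "0 < l" "l \<le> m" "m \<le> n" and b: "0 \<le> curve_form h l m n"
    and r: "0 \<le> r" "0 \<le> d"
  shows "0 \<le> curve_form h (d+r*l) (d+r*m) (d+r*n)"
proof -
  define B where "B = (3*h-1)/(h+1)"
  have B: "B*(h+1) = 3*h-1" "0 < B" using h by (auto simp: B_def)
  have form: "curve_form h x y z = (h+1)*(B*(h-B)*y^2 - (B*y-x)*(z-B*y))" for x y z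
    unfolding curve_form_def using B(1) by algebra
  have h1: "0 < h + 1" using h by simp
  have kap: "0 \<le> B*(h-B)"
  proof -
    have "(h+1)*(h-B) = (h-1)^2" using B(1) by algebra
    then have "0 \<le> (h+1)*(h-B)" by simp
    then have "0 \<le> h - B" using h1 by (simp add: zero_le_mult_iff)
    then show ?thesis using B by simp
  qed
  define m' where "m' = d+r*m"
  define X Y X' Y' where "X = B*m-l" and "Y = n-B*m"
    and "X' = B*m'-(d+r*l)" and "Y' = (d+r*n)-B*m'"
  have b': "X*Y \<le> B*(h-B)*m^2" using b h1 unfolding form X_def Y_def by (simp add: zero_le_mult_iff)
  have m': "0 \<le> m'" unfolding m'_def using r f by simp
  have m0: "0 < m" using f by simp
  have "d*((B-1)*m) \<le> d*X" unfolding X_def using f r by (intro mult_left_mono) (auto simp: algebra_simps)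
  then have XX: "X'*m \<le> X*m'" unfolding X'_def m'_def X_def by (simp add: algebra_simps)
  have "d*((1-B)*m) \<le> d*Y" unfolding Y_def using f r by (intro mult_left_mono) (auto simp: algebra_simps)
  then have YY: "Y'*m \<le> Y*m'" unfolding Y'_def m'_def Y_def by (simp add: algebra_simps)
  have "X'*Y' \<le> B*(h-B)*m'^2"
  proof (cases "0 < X' \<and> 0 < Y'")
    case True
    then have "(X'*m)*(Y'*m) \<le> (X*m')*(Y*m')"
    proof (intro mult_mono[of "X'*m" "X*m'" "Y'*m" "Y*m'"] XX YY)
      have "0 \<le> X'*m" "0 \<le> Y'*m" using True m0 by simp_all
      then show "0 \<le> X*m'" "0 \<le> Y'*m" using XX by linarith+
    qed
    also have "\<dots> = (X*Y)*m'^2" by (simp add: power2_eq_square)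
    also have "\<dots> \<le> B*(h-B)*m^2*m'^2" using b' by (intro mult_right_mono) auto
    finally have "m^2*(X'*Y') \<le> m^2*(B*(h-B)*m'^2)" by (simp add: power2_eq_square algebra_simps)
    then show ?thesis using m0 by simp
  next
    case False
    have "0 \<le> X' \<or> 0 \<le> Y'"
    proof (cases "1 \<le> B")
      case True
      have "r*l \<le> r*m" using f r by (intro mult_left_mono) auto
      moreover have "1*m' \<le> B*m'" using True m' by (intro mult_right_mono) auto
      ultimately show ?thesis unfolding X'_def m'_def by auto
    next
      case False
      have "r*m \<le> r*n" using f r by (intro mult_left_mono) auto
      moreover have "B*m' \<le> 1*m'" using False m' by (intro mult_right_mono) auto
      ultimately show ?thesis unfolding Y'_def m'_def by auto
    qed
    then have "X'*Y' \<le> 0" using False by (auto simp: mult_le_0_iff)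
    also have "0 \<le> B*(h-B)*m'^2" using kap by simp
    finally show ?thesis .
  qed
  then show ?thesis unfolding form using h1 unfolding X'_def Y'_def m'_def by simp
qed

lemma curve_form_center: "0 \<le> curve_form h (1/3) (1/3) (1/3)"
proof -
  have eq: "curve_form h (1/3) (1/3) (1/3) = (h-1)^2/3" unfolding curve_form_def by (simp add: field_simps power2_eq_square)
  show ?thesis unfolding eq by simp
qed

locale spectrum =
  fixes c1 c2 c3 :: real
  assumes s: "0 < c1" "c1 < c2" "c2 < c3" "c1 + c2 + c3 = 1"
begin

definition S :: "real^3" where "S = vector [c1,c2,c3]"

lemma S_nth: "S$1 = c1" "S$2 = c2" "S$3 = c3" by (simp_all add: S_def)

lemma b_poly_b_value: "b_poly S x = b_value c1 c2 c3 x" unfolding b_poly_def b_value_def S_nth by simp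

definition ua where "ua = u_alpha S"
definition ub where "ub = u_beta S"

text \<open>The signs of \<open>b\<close> at \<open>0\<close>, \<open>1/3\<close> and \<open>1/2\<close> separate the two roots, and \<open>b(c2) < 0\<close> places
\<open>c2\<close> between them.\<close>

lemma roots: "0 < ua" "ua < 1/3" "1/3 < ub" "ub < 1/2" "3*ua*ub = c2"
    "b_value c1 c2 c3 ua = 0" "b_value c1 c2 c3 ub = 0" "ua < c2" "c2 < ub"
proof -
  have cont: "continuous_on T (b_value c1 c2 c3)" for T unfolding b_value_def by (intro continuous_intros)
  have v0: "b_value c1 c2 c3 0 > 0" unfolding b_value_def using s by simp
  have c3: "c3 = 1 - c1 - c2" using s by simp
  have e1: "b_value c1 c2 c3 (1/3) = (c2-c1)*(c2-c3)/3"
    unfolding b_value_def c3 by (simp add: field_simps power2_eq_square)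
  have v1: "b_value c1 c2 c3 (1/3) < 0" unfolding e1 using s by (simp add: mult_pos_neg)
  have e2: "b_value c1 c2 c3 (1/2) = c1*c3/2"
    unfolding b_value_def by (simp add: field_simps power2_eq_square)
  have v2: "b_value c1 c2 c3 (1/2) > 0" unfolding e2 using s by simp
  obtain x where x: "0 \<le> x" "x \<le> 1/3" "b_value c1 c2 c3 x = 0"
    using IVT2'[of "b_value c1 c2 c3" "1/3" 0 0] v0 v1 cont by auto
  obtain y where y: "1/3 \<le> y" "y \<le> 1/2" "b_value c1 c2 c3 y = 0"
    using IVT'[of "b_value c1 c2 c3" "1/3" 0 "1/2"] v1 v2 cont by auto
  have x': "0 < x" "x < 1/3" "1/3 < y" "y < 1/2" using x y v0 v1 v2
    by (metis less_eq_real_def less_irrefl)+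
  have "(y-x)*(2*c2*(3*x*y-c2)) = 0" using b_value_other_root[OF x(3), of y] y by simp
  then have xy: "3*x*y = c2" using x' s by simp
  have fact: "x*b_value c1 c2 c3 z = (z-x)*(6*c2*x*(z-y))" for z
  proof -
    have "3*x*z - c2 = 3*x*(z-y)" using xy by (simp add: algebra_simps)
    then show ?thesis unfolding b_value_other_root[OF x(3), of z] by simp
  qed
  have set: "{z. b_value c1 c2 c3 z = 0} = {x,y}"
  proof -
    have "b_value c1 c2 c3 z = 0 \<longleftrightarrow> z = x \<or> z = y" for z
      using fact[of z] x' s by auto
    then show ?thesis by auto
  qed
  have ua: "ua = x" unfolding ua_def u_alpha_def b_poly_b_value set using x' by simp
  have ub: "ub = y" unfolding ub_def u_beta_def b_poly_b_value set using x' by simp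
  have "b_value c1 c2 c3 c2 = c2*((c2-c1)*(c2-c3))"
    unfolding b_value_def c3 by (simp add: algebra_simps power2_eq_square)
  then have v3: "b_value c1 c2 c3 c2 < 0" using s by (simp add: mult_pos_neg)
  have "x*b_value c1 c2 c3 c2 < 0" using v3 x' by (simp add: mult_pos_neg)
  then have "(c2-x)*(c2-y) < 0" using s x' unfolding fact by (auto simp: mult_less_0_iff zero_less_mult_iff)
  then have "x < c2" "c2 < y" using x' by (auto simp: mult_less_0_iff)
  then show "0 < ua" "ua < 1/3" "1/3 < ub" "ub < 1/2" "3*ua*ub = c2"
    "b_value c1 c2 c3 ua = 0" "b_value c1 c2 c3 ub = 0" "ua < c2" "c2 < ub"
    unfolding ua ub using x' x y xy by auto
qed

text \<open>Since \<open>l * c2 = u\<close>, the double entry \<open>u\<close> of \<open>g\<close> contributes \<open>(u - l x)^2 = l^2 (c2 - x)^2\<close>, which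
cancels against the denominator.\<close>

lemma nsq_values:
  assumes l: "l*c2 = u" "l \<noteq> 0"
    and g: "\<And>x. (g$1 - x)*(g$2 - x)*(g$3 - x) = (u-x)^2*(1-2*u-x)"
  shows "nsq S g l 1 = (c2-c1)*(1-2*u-l*c1)/((1-l)*(c3-c1))"
    "nsq S g l 2 = 0"
    "nsq S g l 3 = (c3-c2)*(1-2*u-l*c3)/((1-l)*(c3-c1))"
proof -
  have U: "UNIV - {1} = {2,3::3}" "UNIV - {2} = {1,3::3}" "UNIV - {3} = {1,2::3}"
    unfolding UNIV_3 by auto
  have d: "c2-c1 \<noteq> 0" "c3-c1 \<noteq> 0" "c3-c2 \<noteq> 0" using s by auto
  have "nsq S g l 1 = (l*(c2-c1))^2*(1-2*u-l*c1)/(l^2*(1-l)*((c2-c1)*(c3-c1)))"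
    unfolding nsq_def S_nth g U l(1)[symmetric] by (simp add: S_nth algebra_simps)
  also have "\<dots> = (c2-c1)*(1-2*u-l*c1)/((1-l)*(c3-c1))"
    using l(2) d by (simp add: power2_eq_square)
  finally show "nsq S g l 1 = (c2-c1)*(1-2*u-l*c1)/((1-l)*(c3-c1))" .
  show "nsq S g l 2 = 0" unfolding nsq_def S_nth g l(1) by simp
  have "nsq S g l 3 = (l*(c2-c3))^2*(1-2*u-l*c3)/(l^2*(1-l)*((c1-c3)*(c2-c3)))"
    unfolding nsq_def S_nth g U l(1)[symmetric] by (simp add: S_nth algebra_simps)
  also have "\<dots> = (c2-c3)*(1-2*u-l*c3)/((1-l)*(c1-c3))"
    using l(2) d by (simp add: power2_eq_square)
  also have "\<dots> = (- ((c3-c2)*(1-2*u-l*c3)))/(- ((1-l)*(c3-c1)))" by (simp add: algebra_simps)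
  also have "\<dots> = (c3-c2)*(1-2*u-l*c3)/((1-l)*(c3-c1))" by (rule minus_divide_divide)
  finally show "nsq S g l 3 = (c3-c2)*(1-2*u-l*c3)/((1-l)*(c3-c1))" .
qed

text \<open>The part of the conic \<open>b(u) = 0\<close> (see \<open>b_value_0_iff\<close>) whose middle entry lies between its values at
the two ends of the arc.\<close>

definition arc :: "real \<Rightarrow> (real^3) set" where
  "arc u = {vector [x,y,z] | x y z. x \<le> y \<and> y \<le> z \<and> x + y + z = 1
     \<and> x*z = 3*(1-2*u)*y - 2*((1-2*u)/u)*y^2
     \<and> y \<in> closed_segment u c2}"

lemma eta_image:
  assumes "0 < l" "l \<noteq> 1"
  shows "eta l ` {0..1} = closed_segment l 1"
proof -
  note den = eta_denominator_pos[OF assms(1)]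
  show ?thesis
  proof (intro equalityI subsetI)
    fix x assume "x \<in> eta l ` {0..1}"
    then obtain t where t: "0 \<le> t" "t \<le> 1" "x = eta l t" by auto
    have d: "0 < l + t*(1-l)" using den t by simp
    define r where "r = t/(l + t*(1-l))"
    have r: "0 \<le> r" "r \<le> 1"
    proof -
      show "0 \<le> r" unfolding r_def using t d by simp
      have "t \<le> l + t*(1-l)" using t assms mult_left_mono[of t 1 l] by (simp add: algebra_simps)
      then show "r \<le> 1" unfolding r_def using d by simp
    qed
    have "x = 1 - r*(1-l)"
    proof -
      have "1 - r*(1-l) = (l + t*(1-l) - t*(1-l))/(l + t*(1-l))"
        unfolding r_def diff_divide_distrib using d by simp
      then show ?thesis unfolding t(3) eta_def by simp
    qed
    then have "x = (1-r)*1 + r*l" by (simp add: algebra_simps)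
    then show "x \<in> closed_segment l 1"
      unfolding closed_segment_commute[of l 1] in_segment using r by auto
  next
    fix x assume "x \<in> closed_segment l 1"
    then obtain r where r: "0 \<le> r" "r \<le> 1" "x = (1-r)*l + r"
      unfolding in_segment by auto
    have x: "0 < x" unfolding r(3) using r assms by (cases "r = 0") (auto intro!: add_nonneg_pos)
    define t where "t = l*(1-r)/x"
    have "t \<le> 1" unfolding t_def using x r by (simp add: algebra_simps)
    moreover have "0 \<le> t" unfolding t_def using x r assms by simp
    moreover have "eta l t = x"
    proof -
      have tx: "t*x = l*(1-r)" unfolding t_def using x by simp
      have "x*(l + t*(1-l)) = x*l + (t*x)*(1-l)" by (simp add: algebra_simps)
      also have "\<dots> = x*l + l*(1-r)*(1-l)" unfolding tx ..
      also have "\<dots> = l" unfolding r(3) by (simp add: algebra_simps)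
      finally have "x*(l + t*(1-l)) = l" .
      moreover have "0 < l + t*(1-l)" using den \<open>0 \<le> t\<close> \<open>t \<le> 1\<close> by simp
      ultimately show ?thesis unfolding eta_def by (simp add: field_simps)
    qed
    ultimately show "x \<in> eta l ` {0..1}" by (auto intro!: image_eqI[of _ _ t])
  qed
qed

text \<open>Since \<open>n\<close> has no second component, \<open>y = eta l t * c2\<close> is an eigenvalue.  The product of the
other two is a quadratic polynomial in \<open>y\<close> without constant term; it agrees with the conic at
\<open>y = c2\<close> because \<open>b(u) = 0\<close>, and at \<open>y = u\<close>, hence everywhere.  The assumption \<open>side\<close> makes
\<open>y\<close> the middle one of the three.\<close>

lemma arc_traj:
  assumes u: "0 < u" "b_value c1 c2 c3 u = 0" "u \<noteq> c2" and l: "l*c2 = u"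
    and side: "\<And>y. y \<in> closed_segment u c2 \<Longrightarrow> (3*u-1)*(y-u) \<le> 0"
    and n: "(n$1)^2 = (c2-c1)*(1-2*u-l*c1)/((1-l)*(c3-c1))" "(n$2)^2 = 0"
      "(n$3)^2 = (c3-c2)*(1-2*u-l*c3)/((1-l)*(c3-c1))"
  shows "(\<lambda>t. ordered_eigenvalues (traj S n l t)) ` {0..1} = arc u"
proof -
  have s0: "c2 \<noteq> 0" "0 < c2" "c3-c1 \<noteq> 0" using s by auto
  have l': "l = u/c2" using l s0 by (simp add: field_simps)
  have l0: "0 < l" "l \<noteq> 1" using u s0 l' by auto
  define w where "w = 1-2*u"
  define P where "P y = 3*w*y - 2*(w/u)*y^2" for y
  have c13: "c1*c3 = P c2" using b_value_0_iff[OF u(1), of c1 c2 c3] u(2) by (simp add: P_def w_def)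
  have seg: "(y \<in> closed_segment u c2) \<longleftrightarrow> (y/c2 \<in> closed_segment l 1)" for y
    unfolding l' closed_segment_eq_real_ivl using s0 by (auto simp: field_simps)
  have q: "c1*(n$3)^2 + c3*(n$1)^2 = (w*c2 - l*(c1*c3))/(1-l)"
  proof -
    have "c1*(n$3)^2 + c3*(n$1)^2 = (c1*((c3-c2)*(w-l*c1*0-l*c3)) + c3*((c2-c1)*(w-l*c1)))/((1-l)*(c3-c1))"
      unfolding n w_def by (simp add: add_divide_distrib)
    also have "\<dots> = ((w*c2 - l*(c1*c3))*(c3-c1))/((1-l)*(c3-c1))" by (simp add: algebra_simps)
    finally show ?thesis using s0 by simp
  qed
  have n1: "(n$1)^2 + (n$3)^2 = 1"
  proof -
    have "(n$1)^2 + (n$3)^2 = ((c2-c1)*(w-l*c1) + (c3-c2)*(w-l*c3))/((1-l)*(c3-c1))"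
      unfolding n w_def by (simp add: add_divide_distrib)
    also have "(c2-c1)*(w-l*c1) + (c3-c2)*(w-l*c3) = (1-l)*(c3-c1)"
    proof -
      have "u = l*c2" "c2 = 1 - c1 - c3" using l s by auto
      then show ?thesis unfolding w_def by algebra
    qed
    finally show ?thesis using s0 l0 by simp
  qed
  have char: "det (x *\<^sub>R mat 1 - traj S n l t) = (x-y)*(x^2-(1-y)*x+P y)"
    if y: "y = eta l t*c2" for x y t
  proof -
    define e where "e = eta l t"
    have y': "y = e*c2" using y by (simp add: e_def)
    have prod: "e^2*(c1*c3) + e*(1-e)*(c1*(n$3)^2+c3*(n$1)^2) = P y"
    proof -
      have "(1-l)*(e^2*(c1*c3) + e*(1-e)*((w*c2 - l*(c1*c3))/(1-l))) = (1-l)*(e^2*(c1*c3)) + e*(1-e)*(w*c2 - l*(c1*c3))"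
      proof -
        define Q where "Q = (w*c2 - l*(c1*c3))/(1-l)"
        have Q: "w*c2 - l*(c1*c3) = (1-l)*Q" unfolding Q_def using l0 by simp
        have c: "((1-l)*Q)/(1-l) = Q" using l0 by simp
        show ?thesis unfolding Q c by (simp add: algebra_simps)
      qed
      also have "\<dots> = (1-l)*(P y)"
      proof -
        have "P c2 = c2*(3*w) - 2*(w/l)*c2" "P y = 3*w*(e*c2) - 2*(w/l)*(e^2*c2)"
          unfolding P_def y' l[symmetric] using s0 l0 by (simp_all add: field_simps power2_eq_square)
        moreover have "l*(w/l) = w" using l0 by simp
        ultimately show ?thesis unfolding c13 by algebra
      qed
      finally show ?thesis unfolding q using l0 by simp
    qed
    have sum: "e*c1 + e*c3 + (1-e)*((n$1)^2+(n$3)^2) = 1 - y"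
    proof -
      have "c1 + c3 = 1 - c2" using s by simp
      then have "e*(c1+c3) = e*(1-c2)" by simp
      then show ?thesis unfolding n1 y' by (simp add: algebra_simps)
    qed
    have "det (x *\<^sub>R mat 1 - traj S n l t) = (x-y)*((x-e*c1)*(x-e*c3) - (1-e)*((n$1)^2*(x-e*c3) + (n$3)^2*(x-e*c1)))"
      unfolding traj_def e_def[symmetric] charpoly_update S_nth secular_def n(2) y' by (simp add: algebra_simps)
    also have "(x-e*c1)*(x-e*c3) - (1-e)*((n$1)^2*(x-e*c3) + (n$3)^2*(x-e*c1))
       = x^2 - (e*c1 + e*c3 + (1-e)*((n$1)^2+(n$3)^2))*x + (e^2*(c1*c3) + e*(1-e)*(c1*(n$3)^2+c3*(n$1)^2))"
      by (simp add: algebra_simps power2_eq_square)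
    finally show ?thesis unfolding sum prod .
  qed
  have ev: "ordered_eigenvalues (traj S n l t) = vector [a,y,b]"
    if "y = eta l t*c2" "a \<le> y" "y \<le> b" "a + y + b = 1" "a*b = P y" for a y b t
  proof (rule ordered_eigenvalues_eq[OF that(2,3)])
    fix x
    have ab: "1 - y = a + b" using that(4) by simp
    show "det (x *\<^sub>R mat 1 - traj S n l t) = (x-a)*(x-y)*(x-b)"
      unfolding char[OF that(1)] that(5)[symmetric] ab by (simp add: algebra_simps power2_eq_square)
  qed
  show ?thesis
  proof (intro equalityI subsetI)
    fix v assume "v \<in> (\<lambda>t. ordered_eigenvalues (traj S n l t)) ` {0..1}"
    then obtain t where t: "t \<in> {0..1}" "v = ordered_eigenvalues (traj S n l t)" by auto
    define y where "y = eta l t*c2"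
    have "eta l t \<in> closed_segment l 1" using eta_image[OF l0] t(1) by blast
    then have ys: "y \<in> closed_segment u c2" unfolding seg y_def using s0 by simp
    have neg: "y^2-(1-y)*y+P y \<le> 0"
    proof -
      have "y > 0" using ys u(1) s0 unfolding closed_segment_eq_real_ivl by (auto split: if_splits)
      have "u*(y^2-(1-y)*y+P y) = 2*y*((3*u-1)*(y-u))"
        unfolding P_def w_def using u(1) by (simp add: field_simps power2_eq_square)
      also have "\<dots> \<le> 0" using side[OF ys] \<open>y > 0\<close> by (simp add: mult_nonneg_nonpos)
      finally show ?thesis using u(1) by (simp add: mult_le_0_iff)
    qed
    define D where "D = (1-y)^2 - 4*P y"
    have "4*(y^2-(1-y)*y+P y) = (2*y-(1-y))^2 - D" unfolding D_def by (simp add: algebra_simps power2_eq_square)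
    then have D: "(2*y-(1-y))^2 \<le> D" using neg by simp
    then have W: "\<bar>2*y-(1-y)\<bar> \<le> sqrt D" using real_le_rsqrt by simp
    have W2: "sqrt D^2 = D" using D by (smt (verit) real_sqrt_pow2 zero_le_power2)
    define a b where "a = ((1-y)-sqrt D)/2" and "b = ((1-y)+sqrt D)/2"
    have ab: "a \<le> y" "y \<le> b" "a + y + b = 1" using W unfolding a_def b_def by (auto simp: field_simps)
    have eq: "a*b = ((1-y)^2 - sqrt D^2)/4" unfolding a_def b_def by (simp add: algebra_simps power2_eq_square)
    have "a*b = P y" unfolding eq W2 by (simp add: D_def)
    then show "v \<in> arc u" using ev[OF y_def ab] ys ab unfolding t(2) arc_def P_def w_def by blast
  next
    fix v assume "v \<in> arc u"
    then obtain a y b where v: "v = vector [a,y,b]" and ab: "a \<le> y" "y \<le> b" "a + y + b = 1" "a*b = P y"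
      and ys: "y \<in> closed_segment u c2" unfolding arc_def P_def w_def by auto
    have "y/c2 \<in> eta l ` {0..1}" using ys unfolding seg eta_image[OF l0] .
    then obtain t where t: "t \<in> {0..1}" "y/c2 = eta l t" by auto
    then have "y = eta l t*c2" using s0 by (simp add: field_simps)
    from ev[OF this ab] show "v \<in> (\<lambda>t. ordered_eigenvalues (traj S n l t)) ` {0..1}"
      unfolding v using t(1) by force
  qed
qed

lemma unit_vector_exists:
  assumes "0 \<le> x" "0 \<le> z" "x + z = 1" "f 1 = x" "f 2 = 0" "f 3 = z"
  shows "\<exists>n::real^3. norm n = 1 \<and> (\<forall>i. (n$i)^2 = f i)"
proof -
  define n :: "real^3" where "n = vector [sqrt x, 0, sqrt z]"
  have "(n$1)^2 = x" "(n$2)^2 = 0" "(n$3)^2 = z" unfolding n_def using assms by simp_all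
  moreover from this have "norm n = 1"
    unfolding norm_eq_1 inner_vec_def using assms by (simp add: sum_3 power2_eq_square)
  ultimately show ?thesis using assms by (auto simp: forall_3)
qed

text \<open>These identities determine the signs of \<open>1 - 2u - l c3\<close> and \<open>1 - 2u - l c1\<close>, and thereby show
that \<open>n_alpha\<close> and \<open>n_beta\<close> exist.\<close>

lemma curve_slopes:
  assumes "b_value c1 c2 c3 u = 0"
  shows "((1-2*u)*c2 - u*c3)*(3*(1-2*u)*c2 - c1) = (1-2*u)*(1-3*u)*(c2*(c2-c1))"
    "((1-2*u)*c2 - u*c1)*(3*(1-2*u)*c2 - c3) = (1-2*u)*(1-3*u)*(c2*(c2-c3))"
proof -
  have c: "c1 = 1 - c2 - c3" using s by simp
  show "((1-2*u)*c2 - u*c3)*(3*(1-2*u)*c2 - c1) = (1-2*u)*(1-3*u)*(c2*(c2-c1))"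
    "((1-2*u)*c2 - u*c1)*(3*(1-2*u)*c2 - c3) = (1-2*u)*(1-3*u)*(c2*(c2-c3))"
    using assms unfolding b_value_def c by algebra+
qed

lemma weights_sum:
  assumes l: "l*c2 = u" "l \<noteq> 1"
  shows "(c2-c1)*(1-2*u-l*c1)/((1-l)*(c3-c1)) + (c3-c2)*(1-2*u-l*c3)/((1-l)*(c3-c1)) = 1"
proof -
  have "(c2-c1)*(1-2*u-l*c1) + (c3-c2)*(1-2*u-l*c3) = (1-l)*(c3-c1)"
  proof -
    have "u = l*c2" "c2 = 1 - c1 - c3" using l s by auto
    then show ?thesis by algebra
  qed
  then show ?thesis using l s by (simp add: add_divide_distrib[symmetric])
qed

lemma Gamma_alpha_arc: "Gamma_alpha S = arc ua"
proof -
  have s0: "0 < c2" using s by simp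
  define l where "l = ua/c2"
  have l: "l*c2 = ua" "0 < l" "l < 1" using roots s0 by (auto simp: l_def)
  have al: "alpha S = l" unfolding alpha_def l_def ua_def S_nth ..
  have U: "(U_alpha S$1 - x)*(U_alpha S$2 - x)*(U_alpha S$3 - x) = (ua-x)^2*(1-2*ua-x)" for x
    unfolding U_alpha_def ua_def by (simp add: power2_eq_square)
  note v = nsq_values[OF l(1) _ U]
  have slope: "l*c3 \<le> 1-2*ua"
  proof -
    have "0 < (1-2*ua)*(1-3*ua)*(c2*(c2-c1))" using roots s by simp
    then have *: "0 < ((1-2*ua)*c2 - ua*c3)*(3*(1-2*ua)*c2 - c1)" using curve_slopes(1)[OF roots(6)] by simp
    have "1*c2 \<le> 3*(1-2*ua)*c2" using roots s0 by (intro mult_right_mono) auto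
    then have "0 < 3*(1-2*ua)*c2 - c1" using s by linarith
    then have "0 < (1-2*ua)*c2 - ua*c3" using * by (simp add: zero_less_mult_iff)
    also have "(1-2*ua)*c2 - ua*c3 = c2*(1-2*ua - l*c3)" by (simp add: l(1)[symmetric] algebra_simps)
    finally have "0 < c2*(1-2*ua - l*c3)" .
    then show ?thesis using s0 by (simp add: zero_less_mult_iff)
  qed
  have "l*c1 \<le> l*c3" using l s by simp
  then have nn: "0 \<le> 1-2*ua-l*c1" "0 \<le> 1-2*ua-l*c3" using slope by auto
  define n where "n = n_alpha S"
  have "\<exists>n::real^3. norm n = 1 \<and> (\<forall>i. (n$i)^2 = nsq S (U_alpha S) (alpha S) i)"
    unfolding al by (rule unit_vector_exists[OF _ _ weights_sum[OF l(1)] v]) (use nn l s in auto)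
  then have "norm n = 1 \<and> (\<forall>i. (n$i)^2 = nsq S (U_alpha S) (alpha S) i)"
    unfolding n_def n_alpha_def by (rule someI_ex)
  then have n: "(n$i)^2 = nsq S (U_alpha S) l i" for i unfolding al by blast
  have l0: "l \<noteq> 0" using l by simp
  have "(\<lambda>t. ordered_eigenvalues (traj S n l t)) ` {0..1} = arc ua"
  proof (rule arc_traj[OF roots(1,6) _ l(1)])
    show "ua \<noteq> c2" using roots by simp
    show "(3*ua-1)*(y-ua) \<le> 0" if "y \<in> closed_segment ua c2" for y
      using that roots unfolding closed_segment_eq_real_ivl by (intro mult_nonpos_nonneg) (auto split: if_splits)
  qed (simp_all only: n v[OF l0])
  then show ?thesis unfolding Gamma_alpha_def M_alpha_def n_def al .
qed

lemma Gamma_beta_arc: "Gamma_beta S = arc ub"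
proof -
  have s0: "0 < c2" using s by simp
  define l where "l = ub/c2"
  have l: "l*c2 = ub" "1 < l" using roots s0 by (auto simp: l_def)
  have al: "beta S = l" unfolding beta_def l_def ub_def S_nth ..
  have U: "(U_beta S$1 - x)*(U_beta S$2 - x)*(U_beta S$3 - x) = (ub-x)^2*(1-2*ub-x)" for x
    unfolding U_beta_def ub_def by (simp add: power2_eq_square)
  note v = nsq_values[OF l(1) _ U]
  have slope: "1-2*ub \<le> l*c1"
  proof -
    have "0 < (1-2*ub)*((1-3*ub)*(c2*(c2-c3)))" using roots s by (intro mult_pos_pos mult_neg_neg mult_pos_neg) auto
    then have *: "0 < ((1-2*ub)*c2 - ub*c1)*(3*(1-2*ub)*c2 - c3)" using curve_slopes(2)[OF roots(7)] by simp
    have "3*(1-2*ub)*c2 \<le> 1*c2" using roots s0 by (intro mult_right_mono) auto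
    then have "3*(1-2*ub)*c2 - c3 < 0" using s by linarith
    then have "(1-2*ub)*c2 - ub*c1 < 0" using * by (simp add: zero_less_mult_iff)
    also have "(1-2*ub)*c2 - ub*c1 = c2*(1-2*ub - l*c1)" by (simp add: l(1)[symmetric] algebra_simps)
    finally have "c2*(1-2*ub - l*c1) < 0" .
    then show ?thesis using s0 by (simp add: mult_less_0_iff)
  qed
  have "l*c1 \<le> l*c3" using l s by simp
  then have nn: "1-2*ub-l*c1 \<le> 0" "1-2*ub-l*c3 \<le> 0" using slope by auto
  have pos: "0 \<le> (c2-c1)*(1-2*ub-l*c1)/((1-l)*(c3-c1))" "0 \<le> (c3-c2)*(1-2*ub-l*c3)/((1-l)*(c3-c1))"
    using nn l s by (auto intro!: divide_nonpos_neg mult_nonneg_nonpos mult_neg_pos)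
  define n where "n = n_beta S"
  have l0: "l \<noteq> 0" "l \<noteq> 1" using l by auto
  have "\<exists>n::real^3. norm n = 1 \<and> (\<forall>i. (n$i)^2 = nsq S (U_beta S) (beta S) i)"
    unfolding al by (rule unit_vector_exists[OF pos weights_sum[OF l(1) l0(2)] v[OF l0(1)]])
  then have "norm n = 1 \<and> (\<forall>i. (n$i)^2 = nsq S (U_beta S) (beta S) i)"
    unfolding n_def n_beta_def by (rule someI_ex)
  then have n: "(n$i)^2 = nsq S (U_beta S) l i" for i unfolding al by blast
  have "(\<lambda>t. ordered_eigenvalues (traj S n l t)) ` {0..1} = arc ub"
  proof (rule arc_traj[OF _ roots(7) _ l(1)])
    show "ub \<noteq> c2" "0 < ub" using roots by simp_all
    show "(3*ub-1)*(y-ub) \<le> 0" if "y \<in> closed_segment ub c2" for y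
      using that roots unfolding closed_segment_eq_real_ivl by (intro mult_nonneg_nonpos) (auto split: if_splits)
  qed (simp_all only: n v[OF l0(1)])
  then show ?thesis unfolding Gamma_beta_def M_beta_def n_def al .
qed

text \<open>It turns out to be \<open>lam_set S\<close> (\<open>lam_set_eq\<close>).\<close>

definition admissible where "admissible = {x \<in> unit_sum_plane. 0 < lo x \<and> 0 \<le> b_value (lo x) (mid x) (hi x) ua
   \<and> 0 \<le> b_value (lo x) (mid x) (hi x) ub}"

text \<open>If one of \<open>u_alpha\<close>, \<open>u_beta\<close> is a root of \<open>b\<close> for the triple, the other root is known from the
middle entry \<open>m\<close>, and the second inequality says exactly on which side of \<open>c2\<close> the entry
\<open>m\<close> lies.\<close>

lemma arcs_iff:
  assumes f: "l \<le> m" "m \<le> n" "l + m + n = 1"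
  shows "vector [l,m,n] \<in> arc ua \<union> arc ub \<longleftrightarrow>
    0 < l \<and> 0 \<le> b_value l m n ua \<and> 0 \<le> b_value l m n ub \<and> (b_value l m n ua = 0 \<or> b_value l m n ub = 0)"
proof -
  have arc: "vector [l,m,n] \<in> arc u \<longleftrightarrow> b_value l m n u = 0 \<and> m \<in> closed_segment u c2" if "0 < u" for u
  proof -
    have "vector [l,m,n] = (vector [x,y,z]::real^3) \<longleftrightarrow> l = x \<and> m = y \<and> n = z" for x y z
      by (simp add: vec_eq_iff forall_3)
    then show ?thesis unfolding arc_def using f b_value_0_iff[OF that, of l m n] by auto
  qed
  have ub0: "0 < ub" using roots by simp
  have mpos: "0 < m" if "m \<in> closed_segment u c2" "0 < u" for u
    using that s unfolding closed_segment_eq_real_ivl by (auto split: if_splits)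
  have lpos: "0 < l" if u: "b_value l m n u = 0" "0 < u" "u < 1/2" and m: "0 < m" "2*m < 3*u"
    for u
  proof -
    have "u*(l*n) = (1-2*u)*(m*(3*u-2*m))"
      using u(1) unfolding b_value_def by (simp add: algebra_simps power2_eq_square)
    also have "\<dots> > 0" using u m by simp
    finally have "0 < l*n" using u by (simp add: zero_less_mult_iff)
    moreover have "0 < n" using f m by simp
    ultimately show ?thesis by (simp add: zero_less_mult_iff)
  qed
  \<comment> \<open>positivity of \<open>c1 * c3\<close> on the conic\<close>
  have c2a: "2*c2 < 3*ua"
  proof -
    have "ua*(c1*c3) = (1-2*ua)*(c2*(3*ua-2*c2))"
      using roots(6) unfolding b_value_def by (simp add: algebra_simps power2_eq_square)
    moreover have "0 < ua*(c1*c3)" using roots s by simp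
    ultimately have "0 < (1-2*ua)*(c2*(3*ua-2*c2))" by simp
    moreover have "0 < (1-2*ua)*c2" using roots s by simp
    ultimately have "0 < 3*ua-2*c2" by (metis mult.assoc zero_less_mult_pos)
    then show ?thesis by simp
  qed
  have oa: "ua*b_value l m n ub = (ub-ua)*(2*m*(c2-m))" if "b_value l m n ua = 0"
    using b_value_other_root[OF that, of ub] unfolding roots(5) .
  have ob: "ub*b_value l m n ua = (ua-ub)*(2*m*(c2-m))" if "b_value l m n ub = 0"
    using b_value_other_root[OF that, of ua] roots(5) by (simp add: mult.commute[of ub ua] mult.assoc)
  show ?thesis
  proof
    assume "vector [l,m,n] \<in> arc ua \<union> arc ub"
    then consider "b_value l m n ua = 0" "m \<in> closed_segment ua c2" | "b_value l m n ub = 0" "m \<in> closed_segment ub c2"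
      using arc[OF roots(1)] arc[OF ub0] by blast
    then show "0 < l \<and> 0 \<le> b_value l m n ua \<and> 0 \<le> b_value l m n ub \<and> (b_value l m n ua = 0 \<or> b_value l m n ub = 0)"
    proof cases
      case 1
      then have m: "ua \<le> m" "m \<le> c2" using roots unfolding closed_segment_eq_real_ivl by auto
      have "0 < l" by (rule lpos[OF 1(1)]) (use roots m c2a in auto)
      moreover have "0 \<le> ua*b_value l m n ub" unfolding oa[OF 1(1)] using m roots by simp
      then have "0 \<le> b_value l m n ub" using roots by (simp add: zero_le_mult_iff)
      ultimately show ?thesis using 1 by simp
    next
      case 2
      then have m: "c2 \<le> m" "m \<le> ub" using roots unfolding closed_segment_eq_real_ivl by auto
      have "0 < l" by (rule lpos[OF 2(1)]) (use roots m s in auto)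
      moreover have "0 \<le> ub*b_value l m n ua"
      proof -
        have "0 \<le> (ub-ua)*(2*m*(m-c2))" using m roots s by simp
        also have "\<dots> = (ua-ub)*(2*m*(c2-m))" by (simp add: algebra_simps)
        finally show ?thesis unfolding ob[OF 2(1)] .
      qed
      then have "0 \<le> b_value l m n ua" using roots by (simp add: zero_le_mult_iff)
      ultimately show ?thesis using 2 by simp
    qed
  next
    assume *: "0 < l \<and> 0 \<le> b_value l m n ua \<and> 0 \<le> b_value l m n ub \<and> (b_value l m n ua = 0 \<or> b_value l m n ub = 0)"
    then have m: "0 < m" using f by simp
    have "0 \<le> 2*m*((3*ua-1)*(ua-m))" using b_value_le[OF f(3,1,2) roots(1)] * by linarith
    then have m1: "ua \<le> m" using m roots by (simp add: zero_le_mult_iff)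
    have "0 \<le> 2*m*((3*ub-1)*(ub-m))" using b_value_le[OF f(3,1,2) ub0] * by linarith
    then have m2: "m \<le> ub" using m roots by (simp add: zero_le_mult_iff)
    from * consider "b_value l m n ua = 0" | "b_value l m n ub = 0" by blast
    then show "vector [l,m,n] \<in> arc ua \<union> arc ub"
    proof cases
      case 1
      have "0 \<le> ua*b_value l m n ub" using * roots by simp
      then have "0 \<le> (ub-ua)*(2*m*(c2-m))" unfolding oa[OF 1] .
      then have "m \<le> c2" using m roots by (simp add: zero_le_mult_iff)
      then show ?thesis using arc[OF roots(1)] 1 m1 roots unfolding closed_segment_eq_real_ivl by auto
    next
      case 2
      have "0 \<le> ub*b_value l m n ua" using * roots by simp
      then have "0 \<le> (ua-ub)*(2*m*(c2-m))" unfolding ob[OF 2] .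
      then have "m*(c2-m) \<le> 0" using roots by (simp add: zero_le_mult_iff)
      then have "c2 \<le> m" using m by (simp add: mult_le_0_iff)
      then show ?thesis using arc[OF ub0] 2 m2 roots unfolding closed_segment_eq_real_ivl by auto
    qed
  qed
qed

definition sorted_triple :: "real^3 \<Rightarrow> real^3" where "sorted_triple x = vector [lo x, mid x, hi x]"

lemma perm_sorted:
  assumes "p permutes (UNIV :: 3 set)"
  shows "lo (\<chi> i. x$(p i)) = lo x" "mid (\<chi> i. x$(p i)) = mid x" "hi (\<chi> i. x$(p i)) = hi x"
proof -
  have "range p = UNIV" using assms permutes_surj by blast
  then have r: "range (\<lambda>i. (\<chi> i. x$(p i))$i) = range (\<lambda>i. x$i)"
    using image_image[of "\<lambda>i. x$i" p UNIV] by simp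
  show 1: "lo (\<chi> i. x$(p i)) = lo x" "hi (\<chi> i. x$(p i)) = hi x" unfolding lo_def hi_def r by auto
  have "(\<Sum>i\<in>UNIV. x$(p i)) = (\<Sum>i\<in>UNIV. x$i)"
    using sum.permute[OF assms, of "\<lambda>i. x$i"] by (simp add: comp_def)
  then show "mid (\<chi> i. x$(p i)) = mid x" unfolding mid_def 1 by simp
qed

lemma perm_exists: "\<exists>p. p permutes (UNIV :: 3 set) \<and> x = (\<chi> i. sorted_triple x$(p i))"
proof -
  have *: "\<exists>p. p permutes (UNIV :: 3 set) \<and> x = (\<chi> i. sorted_triple x$(p i))"
    if "sorted_triple x$a = x$1" "sorted_triple x$b = x$2" "sorted_triple x$c = x$3" "a \<noteq> b" "b \<noteq> c" "a \<noteq> c" for a b c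
  proof -
    define p where "p i = (if i = (1::3) then a else if i = 2 then b else c)" for i
    have p: "p 1 = a" "p 2 = b" "p 3 = c" unfolding p_def by simp_all
    have "inj p" unfolding inj_def using that by (simp add: forall_3 p)
    then have "bij p" by (simp add: finite_UNIV_inj_surj bij_def)
    then have "p permutes UNIV" by (rule bij_imp_permutes) simp
    moreover have "x = (\<chi> i. sorted_triple x$(p i))" using that by (simp add: vec_eq_iff forall_3 p)
    ultimately show ?thesis by blast
  qed
  have n: "sorted_triple x$1 = lo x" "sorted_triple x$2 = mid x" "sorted_triple x$3 = hi x" unfolding sorted_triple_def by simp_all
  consider "lo x = x$1 \<and> mid x = x$2 \<and> hi x = x$3" | "lo x = x$1 \<and> mid x = x$3 \<and> hi x = x$2"
      | "lo x = x$2 \<and> mid x = x$1 \<and> hi x = x$3" | "lo x = x$2 \<and> mid x = x$3 \<and> hi x = x$1"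
      | "lo x = x$3 \<and> mid x = x$1 \<and> hi x = x$2" | "lo x = x$3 \<and> mid x = x$2 \<and> hi x = x$1"
    using orderings[of x] by auto
  then show ?thesis
  proof cases
    case 1 then show ?thesis using *[of 1 2 3] by (simp add: n)
  next
    case 2 then show ?thesis using *[of 1 3 2] by (simp add: n)
  next
    case 3 then show ?thesis using *[of 2 1 3] by (simp add: n)
  next
    case 4 then show ?thesis using *[of 3 1 2] by (simp add: n)
  next
    case 5 then show ?thesis using *[of 2 3 1] by (simp add: n)
  next
    case 6 then show ?thesis using *[of 3 2 1] by (simp add: n)
  qed
qed

lemma Gamma_curve_iff: "x \<in> Gamma_curve S \<longleftrightarrow> sorted_triple x \<in> arc ua \<union> arc ub"
proof
  assume "x \<in> Gamma_curve S"
  then obtain m p where x: "x = (\<chi> i. m$(p i))" and m: "m \<in> arc ua \<union> arc ub" and p: "p permutes (UNIV :: 3 set)"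
    unfolding Gamma_curve_def Gamma_alpha_arc Gamma_beta_arc by blast
  obtain a b c where abc: "m = vector [a,b,c]" "a \<le> b" "b \<le> c" using m unfolding arc_def by blast
  have "sorted_triple x = m" unfolding sorted_triple_def x perm_sorted[OF p] abc(1) lo_mid_hi_sorted[OF abc(2,3)] ..
  then show "sorted_triple x \<in> arc ua \<union> arc ub" using m by simp
next
  assume "sorted_triple x \<in> arc ua \<union> arc ub"
  then show "x \<in> Gamma_curve S"
    using perm_exists[of x] unfolding Gamma_curve_def Gamma_alpha_arc Gamma_beta_arc by blast
qed

lemma sum_lo_mid_hi: "lo x + mid x + hi x = x$1 + x$2 + x$3" unfolding mid_eq by simp

lemma Gamma_curve_eq:
  "Gamma_curve S = {x \<in> admissible. b_value (lo x) (mid x) (hi x) ua = 0 \<or> b_value (lo x) (mid x) (hi x) ub = 0}"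
proof (intro equalityI subsetI)
  fix x assume x: "x \<in> Gamma_curve S"
  then have m: "sorted_triple x \<in> arc ua \<union> arc ub" unfolding Gamma_curve_iff .
  then obtain a b c where abc: "sorted_triple x = vector [a,b,c]" "a + b + c = 1" unfolding arc_def by blast
  then have "lo x + mid x + hi x = 1" unfolding sorted_triple_def by (simp add: vec_eq_iff forall_3)
  then show "x \<in> {x \<in> admissible. b_value (lo x) (mid x) (hi x) ua = 0 \<or> b_value (lo x) (mid x) (hi x) ub = 0}"
    using arcs_iff[OF sorted_lo_mid_hi[of x]] m
    unfolding admissible_def unit_sum_plane_def sorted_triple_def by (simp add: sum_lo_mid_hi)
next
  fix x assume x: "x \<in> {x \<in> admissible. b_value (lo x) (mid x) (hi x) ua = 0 \<or> b_value (lo x) (mid x) (hi x) ub = 0}"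
  then have "lo x + mid x + hi x = 1" unfolding admissible_def unit_sum_plane_def by (simp add: sum_lo_mid_hi)
  then show "x \<in> Gamma_curve S" using arcs_iff[OF sorted_lo_mid_hi[of x]] x
    unfolding Gamma_curve_iff sorted_triple_def admissible_def by simp
qed

definition ha where "ha = 2/(3*ua) - 1"
definition hb where "hb = 2/(3*ub) - 1"

lemma ha_hb: "1 < ha" "1/3 < hb" "hb < 1"
  unfolding ha_def hb_def using roots by (auto simp: field_simps)

lemma admissible_region: "admissible = region ha hb"
proof -
  have "0 \<le> curve_form ha (lo x) (mid x) (hi x) \<longleftrightarrow> 0 \<le> b_value (lo x) (mid x) (hi x) ua"
    "0 \<le> curve_form hb (lo x) (mid x) (hi x) \<longleftrightarrow> 0 \<le> b_value (lo x) (mid x) (hi x) ub"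
    if "x \<in> unit_sum_plane" for x
    unfolding ha_def hb_def using that roots curve_form_b_value_sign[of "lo x" "mid x" "hi x"]
    by (auto simp: sum_lo_mid_hi unit_sum_plane_def)
  then show ?thesis unfolding admissible_def region_def by auto
qed

definition center :: "real^3" where "center = (\<chi> i. 1/3)"

lemma sorted_ray:
  assumes "0 \<le> r"
  shows "lo (center + r *\<^sub>R (x - center)) = (1-r)/3 + r*lo x"
    "hi (center + r *\<^sub>R (x - center)) = (1-r)/3 + r*hi x"
    "mid (center + r *\<^sub>R (x - center)) = (1-r)/3 + r*mid x"
proof -
  have e: "(center + r *\<^sub>R (x - center))$i = (1-r)/3 + r*x$i" for i
    unfolding center_def by (simp add: algebra_simps diff_divide_distrib)
  show 1: "lo (center + r *\<^sub>R (x - center)) = (1-r)/3 + r*lo x"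
    "hi (center + r *\<^sub>R (x - center)) = (1-r)/3 + r*hi x"
  proof -
    have "min (d + r*a) (d + r*b) = d + r*min a b" "max (d + r*a) (d + r*b) = d + r*max a b" for a b d
      using mult_left_mono[OF _ assms, of a b] mult_left_mono[OF _ assms, of b a]
      by (cases "a \<le> b"; simp add: min_def max_def)+
    then show "lo (center + r *\<^sub>R (x - center)) = (1-r)/3 + r*lo x"
      "hi (center + r *\<^sub>R (x - center)) = (1-r)/3 + r*hi x"
      unfolding lo_min hi_max e by simp_all
  qed
  show "mid (center + r *\<^sub>R (x - center)) = (1-r)/3 + r*mid x"
    unfolding mid_eq 1 e by (simp add: algebra_simps diff_divide_distrib)
qed

lemma admissible_star:
  assumes x: "x \<in> admissible" and r: "0 \<le> r" "r \<le> 1"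
  shows "center + r *\<^sub>R (x - center) \<in> admissible"
proof -
  have d: "0 \<le> (1-r)/3" using r by simp
  have x': "x$1 + x$2 + x$3 = 1" "0 < lo x" "0 \<le> curve_form ha (lo x) (mid x) (hi x)" "0 \<le> curve_form hb (lo x) (mid x) (hi x)"
    using x unfolding admissible_region region_def unit_sum_plane_def by auto
  have h: "1/3 < ha" "ha \<noteq> 1" "hb \<noteq> 1" using ha_hb by auto
  have "r*x$1 + r*x$2 + r*x$3 = r" using x'(1) by (metis distrib_left mult_1_right)
  then have "center + r *\<^sub>R (x - center) \<in> unit_sum_plane"
    unfolding unit_sum_plane_def center_def by (simp add: algebra_simps)
  moreover have "0 < (1-r)/3 + r*lo x" using r x' by (cases "r = 0") (auto intro: add_nonneg_pos)
  ultimately show ?thesis unfolding admissible_region region_def mem_Collect_eq sorted_ray[OF r(1)]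
    using star_shape[OF h(1,2) x'(2) sorted_lo_mid_hi x'(3) r(1) d]
      star_shape[OF ha_hb(2) h(3) x'(2) sorted_lo_mid_hi x'(4) r(1) d] by simp
qed

lemma center_admissible: "center \<in> admissible"
proof -
  have e: "lo center = 1/3" "mid center = 1/3" "hi center = 1/3"
    unfolding mid_eq lo_min hi_max center_def by simp_all
  have "center \<in> unit_sum_plane" unfolding unit_sum_plane_def center_def by simp
  then show ?thesis unfolding admissible_region region_def mem_Collect_eq e using curve_form_center by simp
qed

text \<open>The inequality for \<open>u_beta\<close> bounds the smallest entry below by a multiple of the middle one, and
the inequality for \<open>u_alpha\<close> bounds the middle one.  This keeps the set away from the vertices
of the triangle of positive triples, and makes it closed.\<close>

lemma lo_bound: "\<exists>d>0. \<forall>x\<in>admissible. d \<le> lo x"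
proof (intro exI conjI ballI)
  have p: "0 < ua" "0 < ub" "0 < (1-2*ub)*(3*ub-1)" using roots by auto
  then show "0 < (1-2*ub)*(3*ub-1)*ua/ub" by simp
  fix x assume x: "x \<in> admissible"
  define l m n where "l = lo x" and "m = mid x" and "n = hi x"
  have f: "l \<le> m" "m \<le> n" "l + m + n = 1" "0 < l" "0 \<le> b_value l m n ua" "0 \<le> b_value l m n ub"
    using x sorted_lo_mid_hi[of x] unfolding admissible_def unit_sum_plane_def l_def m_def n_def by (auto simp: sum_lo_mid_hi)
  have "0 \<le> 2*m*((3*ua-1)*(ua-m))" using order_trans[OF f(5) b_value_le[OF f(3,1,2) p(1)]] .
  then have m1: "ua \<le> m" using f roots by (simp add: zero_le_mult_iff)
  have "(1-2*ub)*(3*ub-1)*ua \<le> (1-2*ub)*(3*ub-1)*m" using p m1 by (intro mult_left_mono) auto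
  also have "\<dots> = (1-2*ub)*m*(3*ub-1)" by simp
  also have "\<dots> \<le> (1-2*ub)*m*(3*ub-2*m)" using f roots by (intro mult_left_mono) auto
  also have "\<dots> = ub*(l*n) - b_value l m n ub" unfolding b_value_def by (simp add: algebra_simps power2_eq_square)
  also have "\<dots> \<le> ub*(l*n)" using f by simp
  also have "\<dots> \<le> ub*(l*1)" using f p by (intro mult_left_mono) auto
  finally show "(1-2*ub)*(3*ub-1)*ua/ub \<le> lo x" using p by (simp add: l_def field_simps)
qed

lemma admissible_bounded: "bounded admissible"
proof (rule bounded_subset[OF bounded_cbox])
  show "admissible \<subseteq> cbox 0 (\<chi> i. 1)"
  proof
    fix x assume x: "x \<in> admissible"
    then have p: "0 < x$i" for i using lo_le[of x i] unfolding admissible_def by auto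
    have "x$1 + x$2 + x$3 = 1" using x unfolding admissible_def unit_sum_plane_def by simp
    then show "x \<in> cbox 0 (\<chi> i. 1)"
      unfolding mem_box_cart using p[of 1] p[of 2] p[of 3] by (simp add: forall_3)
  qed
qed

lemma cont_sorted: "continuous_on T lo" "continuous_on T mid" "continuous_on T hi"
  "continuous_on T (\<lambda>x. b_value (lo x) (mid x) (hi x) u)"
proof -
  show 1: "continuous_on T lo" unfolding lo_min by (intro continuous_intros)
  show 2: "continuous_on T hi" unfolding hi_max by (intro continuous_intros)
  show 3: "continuous_on T mid" unfolding mid_eq by (intro continuous_intros 1 2)
  show "continuous_on T (\<lambda>x. b_value (lo x) (mid x) (hi x) u)"
    unfolding b_value_def by (intro continuous_intros 1 2 3)
qed

text \<open>Inside the plane and away from the curve, the set agrees with an open set and also with a closed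
one, so a component that meets it stays in it and is bounded.  From any other point of the plane
the ray that leads away from the centre avoids the set, by \<open>admissible_star\<close>, and is unbounded.\<close>

lemma lam_set_eq: "lam_set S = admissible"
proof -
  obtain d where d: "0 < d" "\<And>x. x \<in> admissible \<Longrightarrow> d \<le> lo x" using lo_bound by blast
  define C where "C = {x. d \<le> lo x} \<inter> {x. 0 \<le> b_value (lo x) (mid x) (hi x) ua} \<inter> {x. 0 \<le> b_value (lo x) (mid x) (hi x) ub}"
  define I where "I = {x. 0 < lo x} \<inter> {x. 0 < b_value (lo x) (mid x) (hi x) ua} \<inter> {x. 0 < b_value (lo x) (mid x) (hi x) ub}"
  have C: "closed C" unfolding C_def
    by (intro closed_Int closed_Collect_le continuous_on_const cont_sorted)
  have I: "open I" unfolding I_def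
    by (intro open_Int open_Collect_less continuous_on_const cont_sorted)
  define X where "X = unit_sum_plane - Gamma_curve S"
  have RC: "admissible = unit_sum_plane \<inter> C" unfolding C_def admissible_def using d unfolding admissible_def by force
  have IR: "unit_sum_plane \<inter> I \<subseteq> admissible" unfolding I_def admissible_def by auto
  have XI: "x \<in> I" if "x \<in> X" "x \<in> admissible" for x
    using that unfolding X_def Gamma_curve_eq I_def admissible_def by force
  have inner: "bounded (connected_component_set X x)" if x: "x \<in> X" "x \<in> admissible" for x
  proof -
    define K where "K = connected_component_set X x"
    have K: "connected K" "K \<subseteq> X" "x \<in> K" unfolding K_def using x by (auto simp: connected_component_subset connected_connected_component connected_component_refl)
    have pl: "X \<subseteq> unit_sum_plane" unfolding X_def by auto
    have "I \<inter> (-C) \<inter> K = {}" using IR RC K pl by blast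
    moreover have "K \<subseteq> I \<union> (-C)" using XI RC K pl by blast
    moreover have "I \<inter> K \<noteq> {}" using XI[OF x] K by blast
    ultimately have "(-C) \<inter> K = {}" using connectedD[OF K(1) I open_Compl[OF C]] by blast
    then have "K \<subseteq> admissible" using RC K pl by blast
    then show ?thesis unfolding K_def[symmetric] using admissible_bounded bounded_subset by blast
  qed
  have outer: "\<not> bounded (connected_component_set X x)" if x: "x \<in> unit_sum_plane" "x \<notin> admissible" for x
  proof
    assume b: "bounded (connected_component_set X x)"
    define f where "f r = center + r *\<^sub>R (x - center)" for r
    have pl: "f r \<in> unit_sum_plane" for r
    proof -
      have "r*x$1 + r*x$2 + r*x$3 = r" using x(1) unfolding unit_sum_plane_def
        by (metis (mono_tags) distrib_left mem_Collect_eq mult_1_right)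
      then show ?thesis unfolding f_def unit_sum_plane_def center_def by (simp add: algebra_simps)
    qed
    have out: "f r \<notin> admissible" if "1 \<le> r" for r
    proof
      assume "f r \<in> admissible"
      from admissible_star[OF this, of "1/r"] have "center + (1/r) *\<^sub>R (f r - center) \<in> admissible" using that by simp
      moreover have "center + (1/r) *\<^sub>R (f r - center) = x" unfolding f_def using that by simp
      ultimately show False using x by simp
    qed
    have "f ` {1..} \<subseteq> connected_component_set X x"
    proof (rule connected_component_maximal)
      show "connected (f ` {1..})" unfolding f_def
        by (intro connected_continuous_image continuous_intros convex_connected convex_real_interval)
      show "f ` {1..} \<subseteq> X" using pl out unfolding X_def Gamma_curve_eq by auto
      show "x \<in> f ` {1..}" unfolding f_def by (auto intro!: image_eqI[of _ _ 1])
    qed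
    then have "bounded (f ` {1..})" using b bounded_subset by blast
    then obtain M where M: "\<And>r. 1 \<le> r \<Longrightarrow> norm (f r) \<le> M" unfolding bounded_iff by auto
    have xc: "norm (x - center) > 0" using x center_admissible by auto
    \<comment> \<open>large enough for the point on the ray to have a norm above \<open>M\<close>\<close>
    define r where "r = 1 + (\<bar>M\<bar> + norm center)/norm (x - center)"
    have r: "1 \<le> r" unfolding r_def using xc by simp
    have "r*norm (x - center) = norm (x - center) + (\<bar>M\<bar> + norm center)"
      unfolding r_def distrib_right using xc by simp
    moreover have "norm (r *\<^sub>R (x - center)) = r*norm (x - center)" using r by simp
    moreover have "norm (r *\<^sub>R (x - center)) \<le> norm (f r) + norm center"
      using norm_triangle_ineq4[of "f r" center] unfolding f_def by simp
    ultimately show False using M[OF r] xc by linarith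
  qed
  have G: "Gamma_curve S \<subseteq> admissible" "admissible \<subseteq> unit_sum_plane" unfolding Gamma_curve_eq admissible_def by auto
  show ?thesis unfolding lam_set_def X_def[symmetric] using inner outer G unfolding X_def by blast
qed

lemma stable_lam_set: "stable_under_lamination (lam_set S)"
  unfolding lam_set_eq admissible_region by (rule stable_region[OF ha_hb])

end

theorem theorem4p2:
  fixes s1 s2 s3 :: real
  assumes "0 < s1" and "s1 < s2" and "s2 < s3" and "s1 + s2 + s3 = 1"
  shows "stable_under_lamination (lam_set (vector [s1, s2, s3]))"
proof -
  interpret spectrum s1 s2 s3 using assms by unfold_locales
  show ?thesis using stable_lam_set unfolding S_def .
qed

end
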